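(* Let $[c,d]\subset\mathbb{R}$ be a finite interval and let $\rho$ be a finite positive Borel measure on $\mathbb{R}$ supported on $[c,d]$. For $\alpha\in\mathbb{R}$ let $$\Phi(z)=\Phi_{\alpha}(z)=\alpha+z+\int_{-\infty}^{\infty}\frac{1+tz}{t-z}\,d\rho(t),\qquad z\in\mathbb{C}^{+},$$ extended by the same formula to $\mathbb{R}\setminus[c,d]$. Assume that $$\lim_{x\uparrow c}\Phi(x)>\lim_{x\downarrow d}\Phi(x)$$ (a condition which does not depend on $\alpha$). Then $C_\Phi$ is similar to an isometry provided that $|\alpha|$ is sufficiently large; that is, there exists $\alpha_0>0$ (depending on $\rho$, $c$, $d$) such that for every $\alpha\in\mathbb{R}$ with $|\alpha|\ge\alpha_0$ the operator $C_{\Phi_\alpha}$ on $H^2_{\mathbb{C}^+}$ is similar to an isometry.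
   Context: $\mathbb{C}^{+}=\{x+iy:y>0\}$ is the open upper half-plane. $H^2_{\mathbb{C}^+}$ is the Hardy space of analytic functions $u:\mathbb{C}^+\to\mathbb{C}$ with $\|u\|_2^2=\sup_{y>0}\int_{-\infty}^{\infty}|u(x+iy)|^2\,dx<\infty$; it is a Hilbert space. The composition operator is $C_\Phi u=u\circ\Phi$; for $\Phi$ of the form $\Phi(z)=\alpha+z+\int_{-\infty}^{\infty}\frac{1+tz}{t-z}\,d\rho(t)$, $z\in\mathbb{C}^{+}$, with $\alpha\in\mathbb{R}$ and $\rho$ a finite positive Borel measure on $\mathbb{R}$ supported on $[c,d]$, $\Phi$ maps $\mathbb{C}^+$ into itself and $C_\Phi$ is known to be a contraction on $H^2_{\mathbb{C}^+}$. The function $\Phi$ is real and increasing on each of $(-\infty,c)$ and $(d,+\infty)$, so the one-sided limits in the hypothesis exist in $[-\infty,+\infty]$ (the first may be $+\infty$ and the second $-\infty$). A bounded operator $T$ on a Hilbert space $H$ is similar to an isometry if there are a Hilbert space $K$, a bounded invertible operator $S:H\to K$ with bounded inverse, and a linear isometry $V:K\to K$ such that $T=S^{-1}VS$. *)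

theory Defs
  imports "HOL-Complex_Analysis.Complex_Analysis"
begin

section \<open>Complex Hilbert spaces on carriers\<close>

text \<open>Carrier-based spaces, because \<open>similar_to_isometry\<close> below quantifies existentially over
  Hilbert spaces. The operations matter only on the carrier.\<close>

record 'a cspace =
  vcarrier :: "'a set"
  vzero :: 'a
  vadd :: "'a \<Rightarrow> 'a \<Rightarrow> 'a"
  vscale :: "complex \<Rightarrow> 'a \<Rightarrow> 'a"
  vnorm :: "'a \<Rightarrow> real"

definition complex_vector_space :: "'a cspace \<Rightarrow> bool" where
  "complex_vector_space H \<longleftrightarrow>
     vzero H \<in> vcarrier H \<and>
     (\<forall>u\<in>vcarrier H. \<forall>v\<in>vcarrier H. vadd H u v \<in> vcarrier H) \<and>
     (\<forall>a. \<forall>u\<in>vcarrier H. vscale H a u \<in> vcarrier H) \<and>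
     (\<forall>u\<in>vcarrier H. \<forall>v\<in>vcarrier H. \<forall>w\<in>vcarrier H.
        vadd H (vadd H u v) w = vadd H u (vadd H v w)) \<and>
     (\<forall>u\<in>vcarrier H. \<forall>v\<in>vcarrier H. vadd H u v = vadd H v u) \<and>
     (\<forall>u\<in>vcarrier H. vadd H (vzero H) u = u) \<and>
     (\<forall>u\<in>vcarrier H. vadd H u (vscale H (-1) u) = vzero H) \<and>
     (\<forall>a. \<forall>u\<in>vcarrier H. \<forall>v\<in>vcarrier H.
        vscale H a (vadd H u v) = vadd H (vscale H a u) (vscale H a v)) \<and>
     (\<forall>a b. \<forall>u\<in>vcarrier H. vscale H (a + b) u = vadd H (vscale H a u) (vscale H b u)) \<and>
     (\<forall>a b. \<forall>u\<in>vcarrier H. vscale H a (vscale H b u) = vscale H (a * b) u) \<and>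
     (\<forall>u\<in>vcarrier H. vscale H 1 u = u)"

text \<open>Linear in the first argument. The first condition fixes \<open>vnorm\<close> as the norm of \<open>ip\<close>.\<close>

definition inner_product_for :: "'a cspace \<Rightarrow> ('a \<Rightarrow> 'a \<Rightarrow> complex) \<Rightarrow> bool" where
  "inner_product_for H ip \<longleftrightarrow>
     (\<forall>u\<in>vcarrier H. 0 \<le> vnorm H u \<and> ip u u = complex_of_real ((vnorm H u)\<^sup>2)) \<and>
     (\<forall>u\<in>vcarrier H. ip u u = 0 \<longrightarrow> u = vzero H) \<and>
     (\<forall>u\<in>vcarrier H. \<forall>v\<in>vcarrier H. ip v u = cnj (ip u v)) \<and>
     (\<forall>u\<in>vcarrier H. \<forall>v\<in>vcarrier H. \<forall>w\<in>vcarrier H. ip (vadd H u v) w = ip u w + ip v w) \<and>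
     (\<forall>a. \<forall>u\<in>vcarrier H. \<forall>v\<in>vcarrier H. ip (vscale H a u) v = a * ip u v)"

definition vdist :: "'a cspace \<Rightarrow> 'a \<Rightarrow> 'a \<Rightarrow> real" where
  "vdist H u v = vnorm H (vadd H u (vscale H (-1) v))"

definition norm_complete :: "'a cspace \<Rightarrow> bool" where
  "norm_complete H \<longleftrightarrow>
     (\<forall>X::nat \<Rightarrow> 'a. range X \<subseteq> vcarrier H \<longrightarrow>
        (\<forall>e>0. \<exists>N. \<forall>m\<ge>N. \<forall>n\<ge>N. vdist H (X m) (X n) < e) \<longrightarrow>
        (\<exists>l\<in>vcarrier H. (\<lambda>n. vdist H (X n) l) \<longlonglongrightarrow> 0))"

definition complex_hilbert_space :: "'a cspace \<Rightarrow> bool" where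
  "complex_hilbert_space H \<longleftrightarrow>
     complex_vector_space H \<and> (\<exists>ip. inner_product_for H ip) \<and> norm_complete H"

definition linear_operator :: "'a cspace \<Rightarrow> 'b cspace \<Rightarrow> ('a \<Rightarrow> 'b) \<Rightarrow> bool" where
  "linear_operator H K T \<longleftrightarrow>
     T \<in> vcarrier H \<rightarrow> vcarrier K \<and>
     (\<forall>u\<in>vcarrier H. \<forall>v\<in>vcarrier H. T (vadd H u v) = vadd K (T u) (T v)) \<and>
     (\<forall>a. \<forall>u\<in>vcarrier H. T (vscale H a u) = vscale K a (T u))"

definition bounded_operator :: "'a cspace \<Rightarrow> 'b cspace \<Rightarrow> ('a \<Rightarrow> 'b) \<Rightarrow> bool" where
  "bounded_operator H K T \<longleftrightarrow>
     linear_operator H K T \<and> (\<exists>B. \<forall>u\<in>vcarrier H. vnorm K (T u) \<le> B * vnorm H u)"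

definition linear_isometry :: "'a cspace \<Rightarrow> 'b cspace \<Rightarrow> ('a \<Rightarrow> 'b) \<Rightarrow> bool" where
  "linear_isometry H K V \<longleftrightarrow>
     linear_operator H K V \<and> (\<forall>u\<in>vcarrier H. vnorm K (V u) = vnorm H u)"

text \<open>\<open>K\<close> ranges over Hilbert spaces whose elements have the same type as those of \<open>H\<close>. This is no
  restriction: \<open>S\<close> is a bijection, so the structure of an arbitrary \<open>K\<close> can be transported to the
  carrier of \<open>H\<close>.\<close>

definition similar_to_isometry :: "'a cspace \<Rightarrow> ('a \<Rightarrow> 'a) \<Rightarrow> bool" where
  "similar_to_isometry H T \<longleftrightarrow>
     (\<exists>(K :: 'a cspace) S V.
        complex_hilbert_space K \<and>
        bounded_operator H K S \<and>
        bij_betw S (vcarrier H) (vcarrier K) \<and>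
        bounded_operator K H (inv_into (vcarrier H) S) \<and>
        linear_isometry K K V \<and>
        (\<forall>u\<in>vcarrier H. T u = inv_into (vcarrier H) S (V (S u))))"


section \<open>The Hardy space of the upper half-plane and composition operators\<close>

definition uhp :: "complex set" where
  "uhp = {z. 0 < Im z}"

definition hardy_sq :: "(complex \<Rightarrow> complex) \<Rightarrow> ennreal" where
  "hardy_sq u = (SUP y\<in>{0<..}. \<integral>\<^sup>+x. ennreal ((cmod (u (Complex x y)))\<^sup>2) \<partial>lborel)"

text \<open>Functions on \<open>uhp\<close> are represented by \<open>extensional\<close> ones, so that equality of
  elements is equality on \<open>uhp\<close>.\<close>

definition hardy_space :: "(complex \<Rightarrow> complex) cspace" where
  "hardy_space =
     \<lparr>vcarrier = {u \<in> extensional uhp. u holomorphic_on uhp \<and> hardy_sq u < \<infinity>},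
      vzero = (\<lambda>z\<in>uhp. 0),
      vadd = (\<lambda>u v. \<lambda>z\<in>uhp. u z + v z),
      vscale = (\<lambda>a u. \<lambda>z\<in>uhp. a * u z),
      vnorm = (\<lambda>u. sqrt (enn2real (hardy_sq u)))\<rparr>"

definition composition_operator ::
    "(complex \<Rightarrow> complex) \<Rightarrow> (complex \<Rightarrow> complex) \<Rightarrow> complex \<Rightarrow> complex" where
  "composition_operator \<Phi> u = compose uhp u \<Phi>"

text \<open>Used for \<open>z\<close> in \<open>uhp\<close> and for real \<open>z\<close> outside the support of \<open>\<rho>\<close>, where the value is real.\<close>

definition Phi :: "real measure \<Rightarrow> real \<Rightarrow> complex \<Rightarrow> complex" where
  "Phi \<rho> \<alpha> z = of_real \<alpha> + z + (LINT t|\<rho>. (1 + of_real t * z) / (of_real t - z))"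

end

theory Submission
  imports Defs "HOL-Probability.Sinc_Integral"
begin

text \<open>Write \<open>T\<close> for the operator \<open>u \<mapsto> u \<circ> \<Phi>\<close>. Since \<open>T\<close> is a contraction, \<open>\<parallel>T\<^sup>n u\<parallel>\<close> decreases to a
limit, and this limit is a Hilbert norm for which \<open>T\<close> is isometric. It is equivalent to the original
norm as soon as \<open>\<parallel>u\<parallel> \<le> C \<parallel>T\<^sup>n u\<parallel>\<close> with \<open>C\<close> independent of \<open>n\<close> and \<open>u\<close>
(\<open>similar_to_isometry_contraction\<close>). So the theorem is this lower bound.

For the bound, consider boundary values. On \<open>\<real> - [c, d]\<close> the function \<open>\<Phi>\<close> is real with derivative
\<open>1 + \<integral> (1 + t\<^sup>2) / (t - x)\<^sup>2 d\<rho>(t)\<close>, which is at most \<open>1 + \<kappa> / (1 + x\<^sup>2)\<close> away from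
\<open>[c, d]\<close>. Because the limit at \<open>c\<close> exceeds the limit at \<open>d\<close>, there are \<open>a < c\<close> and \<open>b > d\<close>, not
depending on \<open>\<alpha>\<close>, with \<open>\<Phi>(a) \<ge> \<Phi>(b)\<close>; then already the two half-lines \<open>x \<le> a\<close> and \<open>x \<ge> b\<close> are
mapped onto a covering of \<open>\<real>\<close>. On these half-lines \<open>\<Phi>(x) - x\<close> differs from \<open>\<alpha>\<close> by a bounded
quantity, so for large \<open>\<bar>\<alpha>\<bar>\<close> every step moves by at least \<open>1\<close>, always in the direction of \<open>\<alpha>\<close>. The
derivatives along an orbit staying in the half-lines therefore have a bounded product: each factor is
at most \<open>exp (C \<bar>arctan \<Phi>(x) - arctan x\<bar>)\<close>, and these exponents telescope. Equivalently, the
weight \<open>w(x) = exp (- C sgn \<alpha> arctan x)\<close> satisfies \<open>w(\<Phi>(x)) \<Phi>'(x) \<le> w(x)\<close>, and the change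
of variables \<open>y = \<Phi>(x)\<close> gives
\<open>\<integral> F w \<le> \<integral> (F \<circ> \<Phi>) w\<close>, the second integral being over the two half-lines. This can be
iterated without loss (\<open>transfer_iterate\<close>), and \<open>w\<close> is bounded above and below.

Boundary values of Hardy functions are avoided by working with the vertical shifts \<open>u(z + i \<epsilon>)\<close>, which
are continuous up to the real line. For them the transfer inequality with \<open>F(y) = \<bar>u(y + i \<epsilon>)\<bar>\<^sup>2\<close>
and Fatou's lemma give the lower bound, and the shifts converge to \<open>u\<close> in norm
(\<open>hardy_shift_up_approx\<close>).

The facts about the Hardy space that this needs rest on two estimates. Averaging Cauchy's formula for
\<open>u\<^sup>2\<close> over rectangles bounds point evaluations (\<open>hardy_point_bound\<close>), which gives completeness.
The Poisson inequality \<open>\<pi> \<bar>f(z)\<bar>\<^sup>2 \<le> \<integral> Im (1 / (t - z)) \<bar>f(t)\<bar>\<^sup>2 dt\<close>, combined with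
\<open>\<integral> Im (1 / (t - \<Phi>(x + i y))) dx = \<pi>\<close>, gives contractivity of \<open>T\<close>, and for the identity in
place of \<open>\<Phi>\<close> it gives monotonicity of the integrals over horizontal lines, whence the inner product.\<close>

section \<open>Hermitian forms and contractions similar to isometries\<close>

text \<open>The algebraic part of \<open>inner_product_for\<close>, without reference to the norm; unlike inner products,
such forms can be obtained as pointwise limits.\<close>

definition hermitian_form :: "'a cspace \<Rightarrow> ('a \<Rightarrow> 'a \<Rightarrow> complex) \<Rightarrow> bool" where
  "hermitian_form H B \<longleftrightarrow>
     (\<forall>u\<in>vcarrier H. \<forall>v\<in>vcarrier H. B v u = cnj (B u v)) \<and>
     (\<forall>u\<in>vcarrier H. \<forall>v\<in>vcarrier H. \<forall>w\<in>vcarrier H. B (vadd H u v) w = B u w + B v w) \<and>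
     (\<forall>a. \<forall>u\<in>vcarrier H. \<forall>v\<in>vcarrier H. B (vscale H a u) v = a * B u v)"

lemma hermitian_formD:
  assumes "hermitian_form H B" and "u \<in> vcarrier H" and "v \<in> vcarrier H"
  shows "B v u = cnj (B u v)" and "B (vscale H a u) v = a * B u v"
    and "w \<in> vcarrier H \<Longrightarrow> B (vadd H u v) w = B u w + B v w"
  using assms unfolding hermitian_form_def by blast+

lemma complex_vector_space_closed:
  assumes "complex_vector_space H" and "u \<in> vcarrier H" and "v \<in> vcarrier H"
  shows "vadd H u v \<in> vcarrier H" and "vscale H a u \<in> vcarrier H"
proof -
  have "\<forall>u\<in>vcarrier H. \<forall>v\<in>vcarrier H. vadd H u v \<in> vcarrier H"
    using assms(1) unfolding complex_vector_space_def by (elim conjE)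
  moreover have "\<forall>a. \<forall>u\<in>vcarrier H. vscale H a u \<in> vcarrier H"
    using assms(1) unfolding complex_vector_space_def by (elim conjE)
  ultimately show "vadd H u v \<in> vcarrier H" and "vscale H a u \<in> vcarrier H"
    using assms(2,3) by blast+
qed

lemma hermitian_form_diagonal:
  assumes H: "complex_vector_space H" and B: "hermitian_form H B"
    and u: "u \<in> vcarrier H" and v: "v \<in> vcarrier H"
  shows "B (vadd H u (vscale H a v)) (vadd H u (vscale H a v))
           = B u u + a * B v u + cnj a * B u v + a * cnj a * B v v"
proof -
  define w where "w = vscale H a v"
  have w: "w \<in> vcarrier H" and s: "vadd H u w \<in> vcarrier H"
    using complex_vector_space_closed[OF H] u v unfolding w_def by blast+
  have add: "B (vadd H x y) z = B x z + B y z"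
    if "x \<in> vcarrier H" "y \<in> vcarrier H" "z \<in> vcarrier H" for x y z
    using B that unfolding hermitian_form_def by blast
  have scale: "B w z = a * B v z" if "z \<in> vcarrier H" for z
    using B v that unfolding hermitian_form_def w_def by blast
  have sym: "B y x = cnj (B x y)" if "x \<in> vcarrier H" "y \<in> vcarrier H" for x y
    using B that unfolding hermitian_form_def by blast
  have 1: "B u (vadd H u w) = B u u + cnj a * B u v"
    unfolding sym[OF s u] add[OF u w u] scale[OF u] by (simp add: sym[OF u u, symmetric] sym[OF v u, symmetric])
  have 2: "B v (vadd H u w) = B v u + cnj a * B v v"
    unfolding sym[OF s v] add[OF u w v] scale[OF v] by (simp add: sym[OF v v, symmetric] sym[OF u v, symmetric])
  show ?thesis
    unfolding w_def[symmetric] add[OF u w s] scale[OF s] 1 2 by (simp add: algebra_simps)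
qed

text \<open>In \<open>hermitian_form_diagonal\<close> the sum over the fourth roots of unity \<open>a\<close>, weighted by \<open>a\<close>,
kills every term but \<open>B u v\<close>.\<close>

lemma hermitian_form_polarization:
  assumes "complex_vector_space H" and "hermitian_form H B"
    and "u \<in> vcarrier H" and "v \<in> vcarrier H"
  defines "p \<equiv> \<lambda>a. B (vadd H u (vscale H a v)) (vadd H u (vscale H a v))"
  shows "B u v = (p 1 - p (-1) + \<i> * p \<i> - \<i> * p (-\<i>)) / 4"
  unfolding p_def hermitian_form_diagonal[OF assms(1-4)]
  by (simp add: field_simps)

text \<open>By polarization, convergence on the diagonal forces convergence everywhere. This is used twice: for the
forms given by horizontal lines approaching the real axis, and for the forms \<open>\<langle>T\<^sup>n u, T\<^sup>n v\<rangle>\<close>.\<close>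

lemma hermitian_form_limit:
  assumes H: "complex_vector_space H" and B: "\<And>n::nat. hermitian_form H (B n)"
    and conv: "\<And>u. u \<in> vcarrier H \<Longrightarrow> convergent (\<lambda>n. B n u u)"
  defines "L \<equiv> \<lambda>u v. lim (\<lambda>n. B n u v)"
  shows "hermitian_form H L"
    and "\<And>u v. u \<in> vcarrier H \<Longrightarrow> v \<in> vcarrier H \<Longrightarrow> (\<lambda>n. B n u v) \<longlonglongrightarrow> L u v"
proof -
  show lims: "(\<lambda>n. B n u v) \<longlonglongrightarrow> L u v" if u: "u \<in> vcarrier H" and v: "v \<in> vcarrier H" for u v
  proof -
    have "vadd H u (vscale H a v) \<in> vcarrier H" for a
      using complex_vector_space_closed[OF H] u v by blast
    note c = conv[OF this]
    have "convergent (\<lambda>n. B n u v)"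
      unfolding hermitian_form_polarization[OF H B u v] divide_inverse
      by (intro convergent_mult convergent_diff convergent_add convergent_const c)
    then show ?thesis by (simp add: L_def convergent_LIMSEQ_iff)
  qed
  have cl: "vadd H u v \<in> vcarrier H" "vscale H a u \<in> vcarrier H"
    if "u \<in> vcarrier H" "v \<in> vcarrier H" for u v a
    using complex_vector_space_closed[OF H] that by blast+
  show "hermitian_form H L"
    unfolding hermitian_form_def
  proof (intro conjI ballI allI)
    fix u v assume uv: "u \<in> vcarrier H" "v \<in> vcarrier H"
    have "(\<lambda>n. B n v u) \<longlonglongrightarrow> cnj (L u v)"
      using tendsto_cnj[OF lims[OF uv]] unfolding hermitian_formD(1)[OF B uv, symmetric] .
    then show "L v u = cnj (L u v)"
      using lims uv LIMSEQ_unique by blast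
  next
    fix a u v assume uv: "u \<in> vcarrier H" "v \<in> vcarrier H"
    have "(\<lambda>n. B n (vscale H a u) v) \<longlonglongrightarrow> a * L u v"
      using tendsto_mult_left[OF lims[OF uv], of a] unfolding hermitian_formD(2)[OF B uv, symmetric] .
    then show "L (vscale H a u) v = a * L u v"
      using lims[OF cl(2)[OF uv] uv(2)] LIMSEQ_unique by blast
  next
    fix u v w assume uv: "u \<in> vcarrier H" "v \<in> vcarrier H" and w: "w \<in> vcarrier H"
    have "(\<lambda>n. B n (vadd H u v) w) \<longlonglongrightarrow> L u w + L v w"
      using tendsto_add[OF lims[OF uv(1) w] lims[OF uv(2) w]]
      unfolding hermitian_formD(3)[OF B uv w, symmetric] .
    then show "L (vadd H u v) w = L u w + L v w"
      using lims[OF cl(1)[OF uv] w] LIMSEQ_unique by blast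
  qed
qed

text \<open>The space \<open>K\<close> is \<open>H\<close> with the norm \<open>N u = lim \<parallel>T\<^sup>n u\<parallel>\<close>, and \<open>S\<close> is the identity. The limit exists
because the norms decrease, \<open>N (T u) = N u\<close> because dropping the first term does not change a limit, and
the lower bound makes \<open>N\<close> equivalent to the norm of \<open>H\<close>, so that completeness carries over.\<close>

lemma similar_to_isometry_contraction:
  fixes H :: "'a cspace"
  assumes H: "complex_hilbert_space H" and T: "linear_operator H H T"
    and contr: "\<And>u. u \<in> vcarrier H \<Longrightarrow> vnorm H (T u) \<le> vnorm H u"
    and below: "\<And>u n. u \<in> vcarrier H \<Longrightarrow> vnorm H u \<le> C * vnorm H ((T ^^ n) u)"
  shows "similar_to_isometry H T"
proof -
  obtain ip where vs: "complex_vector_space H" and ip: "inner_product_for H ip"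
    and compl: "norm_complete H"
    using H unfolding complex_hilbert_space_def by blast
  have hf: "hermitian_form H ip"
    using ip unfolding inner_product_for_def hermitian_form_def by blast
  have nn: "0 \<le> vnorm H u" and ipn: "ip u u = complex_of_real ((vnorm H u)\<^sup>2)"
    and ip0: "ip u u = 0 \<Longrightarrow> u = vzero H" if "u \<in> vcarrier H" for u
    using ip that unfolding inner_product_for_def by blast+
  have cl: "vadd H u v \<in> vcarrier H" "vscale H a u \<in> vcarrier H"
    if "u \<in> vcarrier H" "v \<in> vcarrier H" for u v a
    using complex_vector_space_closed[OF vs] that by blast+
  have Tc: "T u \<in> vcarrier H" if "u \<in> vcarrier H" for u
    using T that unfolding linear_operator_def by blast
  have Tnc: "(T ^^ n) u \<in> vcarrier H" if "u \<in> vcarrier H" for n u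
    using that by (induction n) (auto simp: Tc)
  have Tadd: "(T ^^ n) (vadd H u v) = vadd H ((T ^^ n) u) ((T ^^ n) v)"
    and Tscale: "(T ^^ n) (vscale H a u) = vscale H a ((T ^^ n) u)"
    if "u \<in> vcarrier H" "v \<in> vcarrier H" for n u v a
    using T that by (induction n) (auto simp: linear_operator_def Tnc)
  define N where "N u = lim (\<lambda>n. vnorm H ((T ^^ n) u))" for u
  have dec: "decseq (\<lambda>n. vnorm H ((T ^^ n) u))" if "u \<in> vcarrier H" for u
    using that contr Tnc by (intro decseq_SucI) simp
  have Nlim: "(\<lambda>n. vnorm H ((T ^^ n) u)) \<longlonglongrightarrow> N u" if u: "u \<in> vcarrier H" for u
  proof -
    have "\<forall>n. 0 \<le> vnorm H ((T ^^ n) u)" using nn[OF Tnc[OF u]] by blast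
    then have "convergent (\<lambda>n. vnorm H ((T ^^ n) u))"
      using decseq_convergent[OF dec[OF u], of 0] unfolding convergent_def by blast
    then show ?thesis by (simp add: N_def convergent_LIMSEQ_iff)
  qed
  have Nle: "N u \<le> vnorm H u" if u: "u \<in> vcarrier H" for u
    using decseq_ge[OF dec[OF u] Nlim[OF u], of 0] by simp
  have Nge: "vnorm H u \<le> C * N u" if u: "u \<in> vcarrier H" for u
    using below[OF u] by (intro LIMSEQ_le_const[OF tendsto_mult_left[OF Nlim[OF u]]]) auto
  have N0: "0 \<le> N u" if u: "u \<in> vcarrier H" for u
    using nn[OF Tnc[OF u]] by (intro LIMSEQ_le_const[OF Nlim[OF u]]) auto
  have NT: "N (T u) = N u" if u: "u \<in> vcarrier H" for u
  proof -
    have "(\<lambda>n. vnorm H ((T ^^ n) (T u))) \<longlonglongrightarrow> N u"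
      using LIMSEQ_Suc[OF Nlim[OF u]] by (simp add: funpow_swap1)
    then show ?thesis using Nlim[OF Tc[OF u]] LIMSEQ_unique by blast
  qed
  define B where "B n u v = ip ((T ^^ n) u) ((T ^^ n) v)" for n u v
  have Bh: "hermitian_form H (B n)" for n
    unfolding hermitian_form_def B_def
  proof (intro conjI ballI allI)
    fix u v assume uv: "u \<in> vcarrier H" "v \<in> vcarrier H"
    note uv' = Tnc[OF uv(1)] Tnc[OF uv(2)]
    show "ip ((T ^^ n) v) ((T ^^ n) u) = cnj (ip ((T ^^ n) u) ((T ^^ n) v))"
      by (rule hermitian_formD(1)[OF hf uv'])
    show "ip ((T ^^ n) (vscale H a u)) ((T ^^ n) v) = a * ip ((T ^^ n) u) ((T ^^ n) v)" for a
      unfolding Tscale[OF uv] by (rule hermitian_formD(2)[OF hf uv'])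
    show "ip ((T ^^ n) (vadd H u v)) ((T ^^ n) w) = ip ((T ^^ n) u) ((T ^^ n) w) + ip ((T ^^ n) v) ((T ^^ n) w)"
      if "w \<in> vcarrier H" for w
      unfolding Tadd[OF uv] by (rule hermitian_formD(3)[OF hf uv' Tnc[OF that]])
  qed
  have Bdiag: "(\<lambda>n. B n u u) \<longlonglongrightarrow> complex_of_real ((N u)\<^sup>2)" if u: "u \<in> vcarrier H" for u
    unfolding B_def ipn[OF Tnc[OF u]]
    by (intro tendsto_of_real tendsto_power Nlim u)
  have Bconv: "convergent (\<lambda>n. B n u u)" if "u \<in> vcarrier H" for u
    using Bdiag[OF that] convergent_def by blast
  define L where "L u v = lim (\<lambda>n. B n u v)" for u v
  have Lh: "hermitian_form H L"
    and Llim: "\<And>u v. u \<in> vcarrier H \<Longrightarrow> v \<in> vcarrier H \<Longrightarrow> (\<lambda>n. B n u v) \<longlonglongrightarrow> L u v"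
    using hermitian_form_limit[of H B, OF vs Bh Bconv] unfolding L_def by blast+
  have Ldiag: "L u u = complex_of_real ((N u)\<^sup>2)" if u: "u \<in> vcarrier H" for u
    using Llim[OF u u] Bdiag[OF u] LIMSEQ_unique by blast
  define K where "K = H\<lparr>vnorm := N\<rparr>"
  have K: "vcarrier K = vcarrier H" "vzero K = vzero H" "vadd K = vadd H" "vscale K = vscale H"
    "vnorm K = N"
    by (simp_all add: K_def)
  have L0: "u = vzero H" if u: "u \<in> vcarrier H" and "L u u = 0" for u
  proof -
    have "N u = 0" using that Ldiag by simp
    then have "vnorm H u = 0" using Nge[OF u] nn[OF u] by simp
    then show ?thesis using ip0 ipn u by simp
  qed
  have "inner_product_for K L"
    using Lh Ldiag L0 N0 unfolding inner_product_for_def hermitian_form_def K by blast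
  moreover have "complex_vector_space K"
    using vs unfolding complex_vector_space_def K .
  moreover have "norm_complete K"
    unfolding norm_complete_def
  proof (intro allI impI)
    fix X :: "nat \<Rightarrow> 'a"
    assume X: "range X \<subseteq> vcarrier K"
      and Cauchy: "\<forall>e>0. \<exists>N. \<forall>m\<ge>N. \<forall>n\<ge>N. vdist K (X m) (X n) < e"
    have Xc: "X n \<in> vcarrier H" for n using X K by auto
    have diff: "vadd H u (vscale H (-1) v) \<in> vcarrier H"
      if "u \<in> vcarrier H" "v \<in> vcarrier H" for u v
      using that cl by blast
    have "\<forall>e>0. \<exists>N. \<forall>m\<ge>N. \<forall>n\<ge>N. vdist H (X m) (X n) < e"
    proof (intro allI impI)
      fix e :: real assume e: "0 < e"
      have "0 < e / (\<bar>C\<bar> + 1)" using e by simp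
      then obtain M where M: "\<And>m n. m \<ge> M \<Longrightarrow> n \<ge> M \<Longrightarrow> vdist K (X m) (X n) < e / (\<bar>C\<bar> + 1)"
        using Cauchy by blast
      have "vdist H (X m) (X n) < e" if "m \<ge> M" "n \<ge> M" for m n
      proof -
        let ?D = "vadd H (X m) (vscale H (-1) (X n))"
        have D: "N ?D < e / (\<bar>C\<bar> + 1)" using M[OF that] by (simp add: vdist_def K)
        have "vnorm H ?D \<le> C * N ?D" using Nge diff Xc by blast
        also have "\<dots> \<le> (\<bar>C\<bar> + 1) * N ?D"
          using N0[OF diff[OF Xc Xc]] by (intro mult_right_mono) auto
        also have "\<dots> < (\<bar>C\<bar> + 1) * (e / (\<bar>C\<bar> + 1))" by (intro mult_strict_left_mono D) auto
        also have "\<dots> = e" by simp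
        finally show ?thesis by (simp add: vdist_def)
      qed
      then show "\<exists>N. \<forall>m\<ge>N. \<forall>n\<ge>N. vdist H (X m) (X n) < e" by blast
    qed
    then obtain l where l: "l \<in> vcarrier H" "(\<lambda>n. vdist H (X n) l) \<longlonglongrightarrow> 0"
      using compl X unfolding norm_complete_def K by metis
    have "(\<lambda>n. vdist K (X n) l) \<longlonglongrightarrow> 0"
    proof (rule tendsto_sandwich[OF _ _ tendsto_const l(2)])
      show "\<forall>\<^sub>F n in sequentially. 0 \<le> vdist K (X n) l"
        unfolding vdist_def K by (intro always_eventually allI N0 diff Xc l)
      show "\<forall>\<^sub>F n in sequentially. vdist K (X n) l \<le> vdist H (X n) l"
        unfolding vdist_def K by (intro always_eventually allI Nle diff Xc l)
    qed
    then show "\<exists>l\<in>vcarrier K. (\<lambda>n. vdist K (X n) l) \<longlonglongrightarrow> 0"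
      using l K by auto
  qed
  ultimately have KH: "complex_hilbert_space K"
    unfolding complex_hilbert_space_def by blast
  have inv: "inv_into (vcarrier H) (\<lambda>u. u) u = u" if "u \<in> vcarrier H" for u
    using that by (intro inv_into_f_eq) (auto simp: inj_on_def)
  have S: "bounded_operator H K (\<lambda>u. u)"
    unfolding bounded_operator_def linear_operator_def K
    using Nle by (auto intro!: exI[of _ 1])
  have S': "bounded_operator K H (inv_into (vcarrier H) (\<lambda>u. u))"
    unfolding bounded_operator_def linear_operator_def K
    using Nge by (auto intro!: exI[of _ C] simp: inv cl)
  have V: "linear_isometry K K T"
    using T NT unfolding linear_isometry_def linear_operator_def K by blast
  have bij: "bij_betw (\<lambda>u. u) (vcarrier H) (vcarrier K)"
    by (simp add: K bij_betw_def)
  have "T u = inv_into (vcarrier H) (\<lambda>u. u) (T u)" if "u \<in> vcarrier H" for u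
    using inv[OF Tc[OF that]] by simp
  then show ?thesis
    unfolding similar_to_isometry_def using KH S S' V bij by blast
qed

section \<open>Integrals over the real line of functions holomorphic above it\<close>

lemma integrable_inverse_one_plus_square: "integrable lborel (\<lambda>x::real. 1 / (1 + x\<^sup>2))"
  and integral_inverse_one_plus_square: "(LINT x|lborel. 1 / (1 + x\<^sup>2)) = pi"
  using integrable_inverse_1_plus_square LBINT_inverse_1_plus_square
  by (simp_all add: set_integrable_def interval_lebesgue_integral_def set_lebesgue_integral_def
      inverse_eq_divide)

text \<open>A primitive of \<open>G\<close> exists because the half-plane is convex. Its increment along \<open>[-r, r]\<close> is minus its
increment along the upper semicircle, which is \<open>O(1/r)\<close> by the decay of \<open>G\<close>.\<close>

lemma integral_real_line_eq_0:
  assumes e: "0 < e" and G: "G holomorphic_on {z. - e < Im z}"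
    and bound: "\<And>z. 0 \<le> Im z \<Longrightarrow> cmod (G z) \<le> M / (1 + (cmod z)\<^sup>2)"
  shows "integrable lborel (\<lambda>x. G (complex_of_real x))"
    and "(LINT x|lborel. G (complex_of_real x)) = 0"
proof -
  let ?S = "{z::complex. - e < Im z}" and ?g = "\<lambda>x. G (complex_of_real x)"
  have cont: "continuous_on UNIV ?g"
    using e by (intro continuous_on_compose2[OF holomorphic_on_imp_continuous_on[OF G]] continuous_intros) auto
  then have meas[measurable]: "?g \<in> borel_measurable borel"
    by (rule borel_measurable_continuous_onI)
  have bd: "cmod (?g x) \<le> M * (1 / (1 + x\<^sup>2))" for x
    using bound[of "complex_of_real x"] by simp
  have intM: "integrable lborel (\<lambda>x. M * (1 / (1 + x\<^sup>2)))"
    by (intro integrable_mult_right integrable_inverse_one_plus_square)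
  show int: "integrable lborel ?g"
    by (rule Bochner_Integration.integrable_bound[OF intM])
      (auto intro!: AE_I2 order_trans[OF bd] divide_right_mono)
  have S: "convex ?S" "open ?S"
    using convex_halfspace_Im_gt[of "-e"] open_halfspace_Im_gt[of "-e"] by auto
  obtain F where F: "\<And>z. z \<in> ?S \<Longrightarrow> (F has_field_derivative G z) (at z within ?S)"
    using holomorphic_convex_primitive'[OF S G] by blast
  have seg: "(LINT x:{-r..r}|lborel. ?g x) = F (of_real r) - F (- of_real r)"
    and arc: "cmod (F (- of_real r) - F (of_real r)) \<le> \<bar>M\<bar> / (1 + r\<^sup>2) * r * pi"
    if r: "0 < r" for r :: real
  proof -
    have seg0: "closed_segment (- of_real r) (of_real r) \<subseteq> ?S"
      using e by (auto simp: closed_segment_def)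
    have "(G has_contour_integral F (of_real r) - F (- of_real r)) (linepath (- of_real r) (of_real r))"
      using contour_integral_primitive[OF F, where g = "linepath (- of_real r) (of_real r)"] seg0
      by simp
    then have *: "(?g has_integral F (of_real r) - F (- of_real r)) {-r..r}"
      using r by (subst (asm) has_contour_integral_linepath_Reals_iff) auto
    have "set_integrable lborel {-r..r} ?g"
      using int unfolding set_integrable_def by (rule integrable_mult_indicator[rotated]) auto
    then show "(LINT x:{-r..r}|lborel. ?g x) = F (of_real r) - F (- of_real r)"
      using set_borel_integral_eq_integral(2) * by (metis integral_unique)
    have Imge: "0 \<le> Im z" if "z \<in> path_image (part_circlepath 0 r 0 pi)" for z
      using that r by (auto simp: path_image_part_circlepath Im_exp sin_ge_zero)
    have "(G has_contour_integral F (- of_real r) - F (of_real r)) (part_circlepath 0 r 0 pi)"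
      using contour_integral_primitive[OF F, where g = "part_circlepath 0 r 0 pi"] Imge r e
      by (fastforce simp: exp_pi_i')
    then have "cmod (F (- of_real r) - F (of_real r)) \<le> \<bar>M\<bar> / (1 + r\<^sup>2) * r * (pi - 0)"
    proof (rule has_contour_integral_bound_part_circlepath)
      fix z assume z: "z \<in> path_image (part_circlepath 0 r 0 pi)"
      then have "cmod z = r" using r in_path_image_part_circlepath by fastforce
      then show "cmod (G z) \<le> \<bar>M\<bar> / (1 + r\<^sup>2)"
        using bound[OF Imge[OF z]] by (smt (verit) divide_right_mono zero_le_power2)
    qed (use r in auto)
    then show "cmod (F (- of_real r) - F (of_real r)) \<le> \<bar>M\<bar> / (1 + r\<^sup>2) * r * pi"
      by simp
  qed
  have "(\<lambda>n. LINT x:{- real (Suc n)..real (Suc n)}|lborel. ?g x) \<longlonglongrightarrow> (LINT x|lborel. ?g x)"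
    unfolding set_lebesgue_integral_def
  proof (rule integral_dominated_convergence[where w = "\<lambda>x. M * (1 / (1 + x\<^sup>2))"])
    show "AE x in lborel. (\<lambda>n. indicat_real {- real (Suc n)..real (Suc n)} x *\<^sub>R ?g x) \<longlonglongrightarrow> ?g x"
    proof (intro AE_I2 tendsto_eventually)
      fix x :: real
      obtain N where "\<bar>x\<bar> \<le> real N" using real_arch_simple by blast
      then show "\<forall>\<^sub>F n in sequentially. indicat_real {- real (Suc n)..real (Suc n)} x *\<^sub>R ?g x = ?g x"
        by (intro eventually_sequentiallyI[of N]) (auto simp: indicator_def)
    qed
    show "AE x in lborel. norm (indicat_real {- real (Suc n)..real (Suc n)} x *\<^sub>R ?g x) \<le> M * (1 / (1 + x\<^sup>2))" for n
      using bd order_trans[OF norm_ge_zero bd] by (intro AE_I2) (simp add: indicator_def)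
  qed (use intM in auto)
  moreover have "(\<lambda>n. LINT x:{- real (Suc n)..real (Suc n)}|lborel. ?g x) \<longlonglongrightarrow> 0"
  proof (rule Lim_null_comparison)
    show "\<forall>\<^sub>F n in sequentially. norm (LINT x:{- real (Suc n)..real (Suc n)}|lborel. ?g x)
            \<le> \<bar>M\<bar> / (1 + (real (Suc n))\<^sup>2) * real (Suc n) * pi"
    proof (intro always_eventually allI)
      fix n
      have n: "0 < real (Suc n)" by simp
      show "norm (LINT x:{- real (Suc n)..real (Suc n)}|lborel. ?g x)
            \<le> \<bar>M\<bar> / (1 + (real (Suc n))\<^sup>2) * real (Suc n) * pi"
        unfolding seg[OF n] using arc[OF n] by (subst norm_minus_commute)
    qed
    show "(\<lambda>n. \<bar>M\<bar> / (1 + (real (Suc n))\<^sup>2) * real (Suc n) * pi) \<longlonglongrightarrow> 0"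
      by real_asymp
  qed
  ultimately show "(LINT x|lborel. ?g x) = 0"
    by (rule LIMSEQ_unique)
qed

text \<open>Self-maps of the half-plane that are close to the identity near infinity. Both \<open>\<Phi>\<close> and the vertical
shifts are of this kind, and so are their iterates. The displacement is only bounded on the half-planes
\<open>Im z \<ge> y\<close>, since \<open>\<Phi>\<close> may be unbounded near the support of the measure.\<close>

definition bounded_displacement :: "(complex \<Rightarrow> complex) \<Rightarrow> bool" where
  "bounded_displacement \<Psi> \<longleftrightarrow> \<Psi> holomorphic_on uhp \<and> (\<forall>z\<in>uhp. Im z \<le> Im (\<Psi> z)) \<and>
     (\<forall>y>0. \<exists>K. \<forall>z. y \<le> Im z \<longrightarrow> cmod (\<Psi> z - z) \<le> K)"

lemma bounded_displacementD:
  assumes "bounded_displacement \<Psi>"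
  shows "\<Psi> holomorphic_on uhp" and "z \<in> uhp \<Longrightarrow> Im z \<le> Im (\<Psi> z)" and "z \<in> uhp \<Longrightarrow> \<Psi> z \<in> uhp"
  using assms unfolding bounded_displacement_def uhp_def by force+

lemma holomorphic_on_bounded_displacement:
  assumes "bounded_displacement \<Psi>" and "v holomorphic_on uhp"
  shows "(\<lambda>z. v (\<Psi> z)) holomorphic_on uhp"
proof -
  have "v \<circ> \<Psi> holomorphic_on uhp"
    by (rule holomorphic_on_compose_gen[OF bounded_displacementD(1)[OF assms(1)] assms(2)])
      (use bounded_displacementD(3)[OF assms(1)] in blast)
  then show ?thesis by (simp add: o_def)
qed

text \<open>The image under \<open>\<Psi>\<close> of a horizontal line still sees total Poisson mass one from every real point: as
\<open>\<Psi>(z) - z\<close> is bounded, \<open>1 / (t - \<Psi>(z))\<close> and \<open>- 1 / (z + i)\<close> differ by a function decaying like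
\<open>1 / \<bar>z\<bar>\<^sup>2\<close>, whose integral vanishes, and the second one has imaginary part \<open>1 / (1 + x\<^sup>2)\<close> on the
line.\<close>

lemma poisson_mass:
  assumes \<Psi>: "bounded_displacement \<Psi>" and y: "0 < y"
  shows "(\<integral>\<^sup>+x. ennreal (Im (1 / (of_real t - \<Psi> (Complex x y)))) \<partial>lborel) = ennreal pi"
proof -
  obtain K where K: "\<And>z. y \<le> Im z \<Longrightarrow> cmod (\<Psi> z - z) \<le> K"
    using \<Psi> y unfolding bounded_displacement_def by blast
  have hol: "\<Psi> holomorphic_on uhp" and Im: "\<And>z. 0 < Im z \<Longrightarrow> Im z \<le> Im (\<Psi> z)"
    using \<Psi> unfolding bounded_displacement_def uhp_def by auto
  \<comment> \<open>The shifted map is holomorphic above height \<open>- y\<close>, the comparison function above height \<open>- 1\<close>.\<close>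
  define e where "e = min y 1"
  have e: "0 < e" "e \<le> y" "e \<le> 1" using y by (auto simp: e_def)
  let ?W = "\<lambda>z. \<Psi> (z + \<i> * of_real y)"
  define G where "G z = 1 / (of_real t - ?W z) + 1 / (z + \<i>)" for z
  have Wpos: "0 < Im (?W z)" if "- e < Im z" for z
    using Im[of "z + \<i> * of_real y"] that e by simp
  have ne1: "of_real t - ?W z \<noteq> 0" if "- e < Im z" for z
    using Wpos[OF that] by (auto simp: complex_eq_iff)
  have ne2: "z + \<i> \<noteq> 0" if "- e < Im z" for z
    using that e by (auto simp: complex_eq_iff)
  have holW: "?W holomorphic_on {z. - e < Im z}"
  proof -
    have "(\<Psi> \<circ> (\<lambda>z. z + \<i> * of_real y)) holomorphic_on {z. - e < Im z}"
      using e by (intro holomorphic_on_compose_gen[OF _ hol] holomorphic_intros) (auto simp: uhp_def)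
    then show ?thesis by (simp add: o_def)
  qed
  have G: "G holomorphic_on {z. - e < Im z}"
    unfolding G_def by (intro holomorphic_intros holW) (use ne1 ne2 in auto)
  \<comment> \<open>The sum of the two denominators of \<open>G\<close> is bounded by \<open>D\<close>.\<close>
  define D where "D = K + y + 1 + \<bar>t\<bar>"
  have bound: "cmod (G z) \<le> D * (1 + D / y) / (1 + (cmod z)\<^sup>2)" if z: "0 \<le> Im z" for z
  proof -
    let ?a = "of_real t - ?W z" and ?b = "z + \<i>"
    have ez: "- e < Im z" using z e by simp
    have "cmod (?W z - (z + \<i> * of_real y)) \<le> K"
      using K[of "z + \<i> * of_real y"] z by simp
    moreover have "?a + ?b = - (?W z - (z + \<i> * of_real y)) + (of_real t + \<i> * of_real (1 - y))"
      by (simp add: algebra_simps)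
    moreover have "cmod (of_real t + \<i> * of_real (1 - y)) \<le> \<bar>t\<bar> + (1 + y)"
      using y by (intro order_trans[OF norm_triangle_ineq] add_mono) (auto simp: norm_mult simp del: of_real_diff)
    ultimately have ab: "cmod (?a + ?b) \<le> D"
      unfolding D_def
      using norm_triangle_ineq[of "- (?W z - (z + \<i> * of_real y))" "of_real t + \<i> * of_real (1 - y)"]
      by (simp only: norm_minus_cancel)
    have D0: "0 \<le> D" using ab norm_ge_zero order_trans by blast
    have "y \<le> cmod ?a"
      using abs_Im_le_cmod[of ?a] Im[of "z + \<i> * of_real y"] z y by simp
    have "cmod ?b \<le> cmod ?a + D"
      using ab norm_triangle_ineq4[of "?a + ?b" ?a] by simp
    also have "\<dots> \<le> cmod ?a + D * (cmod ?a / y)"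
      using mult_left_mono[of 1 "cmod ?a / y" D] \<open>y \<le> cmod ?a\<close> y D0 by simp
    finally have ba: "cmod ?b \<le> cmod ?a * (1 + D / y)" by (simp add: algebra_simps)
    have "(cmod ?b)\<^sup>2 \<ge> 1 + (cmod z)\<^sup>2"
      using z by (simp add: cmod_power2 power2_sum)
    have b0: "0 < cmod ?b" and a0: "0 < cmod ?a" using ne1[OF ez] ne2[OF ez] by auto
    have "G z = (?a + ?b) / (?a * ?b)"
      unfolding G_def using ne1[OF ez] ne2[OF ez] by (simp add: add_frac_eq add.commute)
    then have "cmod (G z) = cmod (?a + ?b) / (cmod ?a * cmod ?b)"
      by (simp add: norm_divide norm_mult)
    also have "\<dots> \<le> D / (cmod ?a * cmod ?b)"
      using ab by (intro divide_right_mono) auto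
    also have "\<dots> \<le> D * (1 + D / y) / (cmod ?b)\<^sup>2"
    proof -
      have "D / (cmod ?a * cmod ?b) = D * cmod ?b / (cmod ?a * (cmod ?b)\<^sup>2)"
        using a0 b0 by (simp add: power2_eq_square)
      also have "\<dots> \<le> D * (cmod ?a * (1 + D / y)) / (cmod ?a * (cmod ?b)\<^sup>2)"
        using ba D0 by (intro divide_right_mono mult_left_mono) auto
      also have "\<dots> = D * (1 + D / y) / (cmod ?b)\<^sup>2"
        using a0 by simp
      finally show ?thesis .
    qed
    also have "\<dots> \<le> D * (1 + D / y) / (1 + (cmod z)\<^sup>2)"
      using \<open>(cmod ?b)\<^sup>2 \<ge> 1 + (cmod z)\<^sup>2\<close> D0 y b0
      by (intro divide_left_mono mult_nonneg_nonneg mult_pos_pos zero_less_power) (auto intro: add_pos_nonneg)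
    finally show ?thesis .
  qed
  note int = integral_real_line_eq_0[OF e(1) G bound]
  have Cxy: "of_real x + \<i> * of_real y = Complex x y" for x
    by (simp add: complex_eq_iff)
  have eq: "Im (1 / (of_real t - \<Psi> (Complex x y))) = Im (G (of_real x)) + 1 / (1 + x\<^sup>2)" for x
    by (simp add: G_def Cxy Im_divide power2_eq_square add.commute)
  have intI: "integrable lborel (\<lambda>x. Im (G (of_real x)) + 1 / (1 + x\<^sup>2))"
    by (intro Bochner_Integration.integrable_add integrable_Im int integrable_inverse_one_plus_square)
  have nonneg: "0 \<le> Im (G (of_real x)) + 1 / (1 + x\<^sup>2)" for x
    unfolding eq[symmetric] using Wpos[of "of_real x"] e
    by (simp add: Im_divide Cxy)
  have "(\<integral>\<^sup>+x. ennreal (Im (G (of_real x)) + 1 / (1 + x\<^sup>2)) \<partial>lborel)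
      = ennreal (LINT x|lborel. Im (G (of_real x)) + 1 / (1 + x\<^sup>2))"
    using nonneg by (intro nn_integral_eq_integral intI) auto
  also have "(LINT x|lborel. Im (G (of_real x)) + 1 / (1 + x\<^sup>2)) = Im 0 + pi"
    unfolding integral_inverse_one_plus_square[symmetric] int(2)[symmetric]
    by (subst Bochner_Integration.integral_add)
      (simp_all add: integrable_Im int integrable_inverse_one_plus_square)
  finally show ?thesis by (simp add: eq)
qed

section \<open>Point evaluations on the Hardy space\<close>

definition line_sq :: "(complex \<Rightarrow> complex) \<Rightarrow> real \<Rightarrow> ennreal" where
  "line_sq u y = (\<integral>\<^sup>+x. ennreal ((cmod (u (Complex x y)))\<^sup>2) \<partial>lborel)"

lemma hardy_sq_line_sq: "hardy_sq u = (SUP y\<in>{0<..}. line_sq u y)"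
  by (simp add: hardy_sq_def line_sq_def)

lemma line_sq_le_hardy_sq: "0 < y \<Longrightarrow> line_sq u y \<le> hardy_sq u"
  unfolding hardy_sq_line_sq by (rule SUP_upper) simp

lemma continuous_on_uhp_Complex:
  fixes u :: "complex \<Rightarrow> complex"
  assumes "u holomorphic_on uhp" and "continuous_on A f" and "continuous_on A g"
    and "\<And>p. p \<in> A \<Longrightarrow> 0 < g p"
  shows "continuous_on A (\<lambda>p. u (Complex (f p) (g p)))"
proof -
  have eq: "(\<lambda>p. Complex (f p) (g p)) = (\<lambda>p. of_real (f p) + \<i> * of_real (g p))"
    by (simp add: complex_eq_iff fun_eq_iff)
  have "continuous_on A (\<lambda>p. Complex (f p) (g p))"
    unfolding eq by (intro continuous_intros assms)
  then show ?thesis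
    by (rule continuous_on_compose2[OF holomorphic_on_imp_continuous_on[OF assms(1)]])
      (use assms(4) in \<open>auto simp: uhp_def\<close>)
qed

lemma cmod_integral_le_nn_integral:
  fixes g :: "real \<Rightarrow> complex"
  assumes g: "continuous_on {a..b} g" and h: "0 \<le> h"
    and le: "\<And>x. x \<in> {a..b} \<Longrightarrow> h * cmod (g x) \<le> k x"
  shows "ennreal (h * cmod (integral {a..b} g)) \<le> (\<integral>\<^sup>+x. ennreal (k x) * indicator {a..b} x \<partial>lborel)"
proof -
  have int: "(\<lambda>x. cmod (g x)) integrable_on {a..b}"
    by (intro integrable_continuous_real continuous_intros g)
  have "cmod (integral {a..b} g) \<le> integral {a..b} (\<lambda>x. cmod (g x))"
    by (intro integral_norm_bound_integral int integrable_continuous_real g) auto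
  then have "ennreal (h * cmod (integral {a..b} g)) \<le> ennreal (h * integral {a..b} (\<lambda>x. cmod (g x)))"
    using h by (intro ennreal_leI mult_left_mono)
  also have "\<dots> = (\<integral>\<^sup>+x. ennreal (h * cmod (g x)) * indicator {a..b} x \<partial>lborel)"
    using h by (intro nn_integral_has_integral_lebesgue'[symmetric] has_integral_mult_right
        integrable_integral int) auto
  also have "\<dots> \<le> (\<integral>\<^sup>+x. ennreal (k x) * indicator {a..b} x \<partial>lborel)"
    using le by (intro nn_integral_mono) (auto simp: indicator_def intro: ennreal_leI)
  finally show ?thesis .
qed

lemma contour_integral_linepath_horizontal:
  assumes "a < b"
  shows "contour_integral (linepath (Complex a c) (Complex b c)) f = integral {a..b} (\<lambda>x. f (Complex x c))"
proof -
  have C: "Complex x c = of_real x + \<i> * of_real c" for x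
    by (simp add: complex_eq_iff)
  have "contour_integral (linepath (Complex a c) (Complex b c)) f
      = contour_integral (linepath (of_real a) (of_real b)) (\<lambda>w. f (w + \<i> * of_real c))"
    unfolding C linepath_translate[symmetric] by (rule contour_integral_translate)
  also have "\<dots> = integral {a..b} (\<lambda>x. f (Complex x c))"
    using assms by (subst contour_integral_linepath_Reals_eq) (auto simp: C)
  finally show ?thesis .
qed

text \<open>Cauchy's formula for \<open>u\<^sup>2\<close> on a rectangle centred at \<open>z\<close> with half-height \<open>h\<close> and half-width
\<open>s\<close>. All four sides have distance at least \<open>h\<close> from \<open>z\<close>.\<close>

lemma cauchy_rectangle_bound:
  assumes u: "u holomorphic_on uhp" and h: "0 < h" "h \<le> s" and z: "h < Im z"
  defines "x \<equiv> Re z" and "y \<equiv> Im z"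
  defines "V \<equiv> \<lambda>\<xi>. \<integral>\<^sup>+\<eta>. ennreal ((cmod (u (Complex \<xi> \<eta>)))\<^sup>2) * indicator {y - h..y + h} \<eta> \<partial>lborel"
  shows "ennreal (2 * pi * h * (cmod (u z))\<^sup>2)
           \<le> line_sq u (y - h) + V (x + s) + line_sq u (y + h) + V (x - s)"
proof -
  let ?f = "\<lambda>w. (u w)\<^sup>2"
  let ?G = "\<lambda>w. ?f w / (w - z)"
  define a1 a2 a3 a4 where a: "a1 = Complex (x - s) (y - h)" "a2 = Complex (x + s) (y - h)"
    "a3 = Complex (x + s) (y + h)" "a4 = Complex (x - s) (y + h)"
  have s: "0 < s" using h by simp
  have rp: "rectpath a1 a3 = linepath a1 a2 +++ linepath a2 a3 +++ linepath a3 a4 +++ linepath a4 a1"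
    by (simp add: rectpath_def Let_def a)
  have far: "h \<le> cmod (w - z) \<and> 0 < Im w" if "w \<in> path_image (rectpath a1 a3)" for w
  proof -
    have "h \<le> \<bar>Re (w - z)\<bar> \<or> h \<le> \<bar>Im (w - z)\<bar>"
      using that s h by (auto simp: path_image_rectpath a x_def y_def)
    then have "h \<le> cmod (w - z)"
      using abs_Re_le_cmod[of "w - z"] abs_Im_le_cmod[of "w - z"] by linarith
    moreover have "0 < Im w"
      using that s h z by (auto simp: path_image_rectpath a x_def y_def)
    ultimately show ?thesis ..
  qed
  have "(?G has_contour_integral 2 * pi * \<i> * winding_number (rectpath a1 a3) z * ?f z) (rectpath a1 a3)"
  proof (rule Cauchy_integral_formula_convex_simple)
    show "convex uhp" "?f holomorphic_on uhp"
      using convex_halfspace_Im_gt[of 0] by (auto simp: uhp_def intro!: holomorphic_intros u[unfolded uhp_def])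
    show "z \<in> interior uhp"
      using z h open_halfspace_Im_gt[of 0] by (simp add: uhp_def interior_open)
    show "path_image (rectpath a1 a3) \<subseteq> uhp - {z}"
      using far h by (fastforce simp: uhp_def)
  qed auto
  moreover have "winding_number (rectpath a1 a3) z = 1"
    using s h by (intro winding_number_rectpath) (simp add: in_box_complex_iff a x_def y_def)
  ultimately have ci: "contour_integral (rectpath a1 a3) ?G = 2 * pi * \<i> * ?f z"
    using contour_integral_unique by fastforce
  have contG: "continuous_on (path_image (rectpath a1 a3)) ?G"
  proof (intro continuous_intros)
    show "continuous_on (path_image (rectpath a1 a3)) u"
      using far by (intro continuous_on_subset[OF holomorphic_on_imp_continuous_on[OF u]]) (auto simp: uhp_def)
  qed (use far h in fastforce)
  have seg: "closed_segment a1 a2 \<subseteq> path_image (rectpath a1 a3)"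
    "closed_segment a2 a3 \<subseteq> path_image (rectpath a1 a3)"
    "closed_segment a4 a3 \<subseteq> path_image (rectpath a1 a3)"
    "closed_segment a1 a4 \<subseteq> path_image (rectpath a1 a3)"
    by (auto simp: rp path_image_join closed_segment_commute)
  note contseg = seg[THEN continuous_on_subset[OF contG]]
  note intseg = contseg[THEN contour_integrable_continuous_linepath]
  have intseg': "?G contour_integrable_on linepath a3 a4" "?G contour_integrable_on linepath a4 a1"
    using contseg(3,4) by (auto intro!: contour_integrable_continuous_linepath simp: closed_segment_commute)
  define I1 I2 I3 I4 where
    "I1 = integral {x - s..x + s} (\<lambda>\<xi>. ?G (Complex \<xi> (y - h)))" and
    "I2 = integral {y - h..y + h} (\<lambda>\<eta>. ?G (Complex (x + s) \<eta>))" and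
    "I3 = integral {x - s..x + s} (\<lambda>\<xi>. ?G (Complex \<xi> (y + h)))" and
    "I4 = integral {y - h..y + h} (\<lambda>\<eta>. ?G (Complex (x - s) \<eta>))"
  have "contour_integral (rectpath a1 a3) ?G = contour_integral (linepath a1 a2) ?G
      + contour_integral (linepath a2 a3) ?G - contour_integral (linepath a4 a3) ?G
      - contour_integral (linepath a1 a4) ?G"
    unfolding rp using intseg intseg'
    by (simp add: contour_integral_reverse_linepath[OF contseg(3)] contour_integral_reverse_linepath[OF contseg(4)])
  moreover have "contour_integral (linepath a1 a2) ?G = I1"
    unfolding I1_def a using s by (intro contour_integral_linepath_horizontal) auto
  moreover have "contour_integral (linepath a2 a3) ?G = \<i> * I2"
    unfolding I2_def using h by (intro contour_integral_linepath_same_Re) (auto simp: a)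
  moreover have "contour_integral (linepath a4 a3) ?G = I3"
    unfolding I3_def a using s by (intro contour_integral_linepath_horizontal) auto
  moreover have "contour_integral (linepath a1 a4) ?G = \<i> * I4"
    unfolding I4_def using h by (intro contour_integral_linepath_same_Re) (auto simp: a)
  ultimately have sum: "2 * pi * \<i> * ?f z = I1 + \<i> * I2 - I3 - \<i> * I4"
    using ci by simp
  have "2 * pi * (cmod (u z))\<^sup>2 = cmod (I1 + \<i> * I2 - I3 - \<i> * I4)"
    unfolding sum[symmetric] by (simp add: norm_mult norm_power)
  also have "\<dots> \<le> cmod I1 + cmod I2 + cmod I3 + cmod I4"
    using norm_triangle_ineq4[of "I1 + \<i> * I2 - I3" "\<i> * I4"]
      norm_triangle_ineq4[of "I1 + \<i> * I2" I3] norm_triangle_ineq[of I1 "\<i> * I2"]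
    by (simp add: norm_mult)
  finally have "h * (2 * pi * (cmod (u z))\<^sup>2) \<le> h * (cmod I1 + cmod I2 + cmod I3 + cmod I4)"
    using h by (intro mult_left_mono) auto
  then have "ennreal (2 * pi * h * (cmod (u z))\<^sup>2)
      \<le> ennreal (h * cmod I1) + ennreal (h * cmod I2) + ennreal (h * cmod I3) + ennreal (h * cmod I4)"
    using h by (simp add: ennreal_plus[symmetric] distrib_left mult.left_commute mult.assoc ennreal_leI
        del: ennreal_plus)
  moreover have Gle: "h * cmod (?G w) \<le> (cmod (u w))\<^sup>2" if "w \<in> path_image (rectpath a1 a3)" for w
    using far[OF that] h
    by (simp add: norm_divide norm_power divide_le_eq mult.commute mult_right_mono)
  have pim: "path_image (rectpath a1 a3) =
     {w. Re w \<in> {x - s, x + s} \<and> Im w \<in> {y - h..y + h}} \<union>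
     {w. Im w \<in> {y - h, y + h} \<and> Re w \<in> {x - s..x + s}}"
    using s h by (simp add: path_image_rectpath a)
  have eqC: "(\<lambda>\<xi>. Complex \<xi> c) = (\<lambda>\<xi>. of_real \<xi> + \<i> * of_real c)"
    "(\<lambda>\<xi>. Complex c \<xi>) = (\<lambda>\<xi>. of_real c + \<i> * of_real \<xi>)" for c
    by (simp_all add: complex_eq_iff fun_eq_iff)
  have contC: "continuous_on A (\<lambda>\<xi>. Complex \<xi> c)" "continuous_on A (\<lambda>\<xi>. Complex c \<xi>)" for A c
    unfolding eqC by (intro continuous_intros)+
  have hor: "ennreal (h * cmod (integral {x - s..x + s} (\<lambda>\<xi>. ?G (Complex \<xi> c)))) \<le> line_sq u c"
    if "c \<in> {y - h, y + h}" for c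
  proof -
    have "ennreal (h * cmod (integral {x - s..x + s} (\<lambda>\<xi>. ?G (Complex \<xi> c))))
       \<le> (\<integral>\<^sup>+\<xi>. ennreal ((cmod (u (Complex \<xi> c)))\<^sup>2) * indicator {x - s..x + s} \<xi> \<partial>lborel)"
      by (intro cmod_integral_le_nn_integral continuous_on_compose2[OF contG contC(1)] Gle)
        (use that h in \<open>auto simp: pim\<close>)
    also have "\<dots> \<le> line_sq u c"
      unfolding line_sq_def by (intro nn_integral_mono) (auto simp: indicator_def)
    finally show ?thesis .
  qed
  have ver: "ennreal (h * cmod (integral {y - h..y + h} (\<lambda>\<eta>. ?G (Complex c \<eta>)))) \<le> V c"
    if "c \<in> {x - s, x + s}" for c
    unfolding V_def
    by (intro cmod_integral_le_nn_integral continuous_on_compose2[OF contG contC(2)] Gle)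
      (use that h in \<open>auto simp: pim\<close>)
  have "ennreal (h * cmod I1) + ennreal (h * cmod I2) + ennreal (h * cmod I3) + ennreal (h * cmod I4)
      \<le> line_sq u (y - h) + V (x + s) + line_sq u (y + h) + V (x - s)"
    unfolding I1_def I2_def I3_def I4_def by (intro add_mono hor ver) auto
  ultimately show ?thesis by (rule order_trans)
qed

text \<open>The horizontal sides in \<open>cauchy_rectangle_bound\<close> are controlled by the Hardy norm directly. A single
vertical side is not, but the average over \<open>s\<close> between \<open>h\<close> and \<open>2 h\<close> is an area integral over a
horizontal strip.\<close>

lemma hardy_point_bound:
  assumes u: "u holomorphic_on uhp" and z: "0 < Im z"
  shows "ennreal (Im z * (cmod (u z))\<^sup>2) \<le> 2 * hardy_sq u"
proof -
  define h where "h = Im z / 2"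
  have h: "0 < h" "h < Im z" using z by (auto simp: h_def)
  let ?x = "Re z" and ?y = "Im z" and ?Q = "hardy_sq u"
  let ?J = "{?y - h..?y + h}"
  \<comment> \<open>\<open>V \<xi>\<close> is the contribution of the vertical side over \<open>\<xi>\<close>.\<close>
  define W where "W \<xi> \<eta> = ennreal ((cmod (u (Complex \<xi> \<eta>)))\<^sup>2) * indicator ?J \<eta>" for \<xi> \<eta>
  define V where "V \<xi> = (\<integral>\<^sup>+\<eta>. W \<xi> \<eta> \<partial>lborel)" for \<xi>
  have "closed (UNIV \<times> ?J)" by (intro closed_Times) auto
  then have [measurable]: "(UNIV \<times> ?J :: (real \<times> real) set) \<in> sets borel" by (rule borel_closed)
  have "(\<lambda>p. indicator (UNIV \<times> ?J) p *\<^sub>R u (Complex (fst p) (snd p))) \<in> borel_measurable borel"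
    using h by (intro borel_measurable_continuous_on_indicator continuous_on_uhp_Complex[OF u] continuous_intros) auto
  then have "(\<lambda>p. ennreal ((cmod (indicator (UNIV \<times> ?J) p *\<^sub>R u (Complex (fst p) (snd p))))\<^sup>2)) \<in> borel_measurable borel"
    by measurable
  also have "(\<lambda>p. ennreal ((cmod (indicator (UNIV \<times> ?J) p *\<^sub>R u (Complex (fst p) (snd p))))\<^sup>2)) = (\<lambda>p. W (fst p) (snd p))"
    by (auto simp: W_def indicator_def fun_eq_iff)
  finally have meas: "(\<lambda>(\<xi>, \<eta>). W \<xi> \<eta>) \<in> borel_measurable (lborel \<Otimes>\<^sub>M lborel)"
    by (simp add: lborel_prod case_prod_beta')
  have Vm: "V \<in> borel_measurable borel"
    using sigma_finite_measure.borel_measurable_nn_integral[OF sigma_finite_lborel meas]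
    unfolding V_def by simp
  have "(\<integral>\<^sup>+\<xi>. V \<xi> \<partial>lborel) = (\<integral>\<^sup>+\<eta>. \<integral>\<^sup>+\<xi>. W \<xi> \<eta> \<partial>lborel \<partial>lborel)"
    unfolding V_def by (rule lborel_pair.Fubini'[symmetric]) (rule meas)
  also have "\<dots> \<le> (\<integral>\<^sup>+\<eta>. ?Q * indicator ?J \<eta> \<partial>lborel)"
  proof (intro nn_integral_mono)
    fix \<eta> :: real
    show "(\<integral>\<^sup>+\<xi>. W \<xi> \<eta> \<partial>lborel) \<le> ?Q * indicator ?J \<eta>"
      using line_sq_le_hardy_sq[of \<eta> u] h by (auto simp: W_def indicator_def line_sq_def)
  qed
  also have "\<dots> = ?Q * ennreal (2 * h)"
    using h by (subst nn_integral_cmult_indicator) auto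
  finally have VQ: "(\<integral>\<^sup>+\<xi>. V \<xi> \<partial>lborel) \<le> ?Q * ennreal (2 * h)" .
  let ?S = "{h..2 * h}"
  have shift: "(\<integral>\<^sup>+s. V (?x + s) * indicator ?S s \<partial>lborel) \<le> ?Q * ennreal (2 * h)"
    "(\<integral>\<^sup>+s. V (?x - s) * indicator ?S s \<partial>lborel) \<le> ?Q * ennreal (2 * h)"
  proof -
    have "(\<integral>\<^sup>+s. V (?x + s) * indicator ?S s \<partial>lborel) \<le> (\<integral>\<^sup>+s. V (?x + 1 * s) \<partial>lborel)"
      by (intro nn_integral_mono) (auto simp: indicator_def)
    also have "\<dots> = (\<integral>\<^sup>+\<xi>. V \<xi> \<partial>lborel)"
      using nn_integral_real_affine[OF Vm, of 1 ?x] by simp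
    finally show "(\<integral>\<^sup>+s. V (?x + s) * indicator ?S s \<partial>lborel) \<le> ?Q * ennreal (2 * h)" using VQ by simp
    have "(\<integral>\<^sup>+s. V (?x - s) * indicator ?S s \<partial>lborel) \<le> (\<integral>\<^sup>+s. V (?x + (-1) * s) \<partial>lborel)"
      by (intro nn_integral_mono) (auto simp: indicator_def)
    also have "\<dots> = (\<integral>\<^sup>+\<xi>. V \<xi> \<partial>lborel)"
      using nn_integral_real_affine[OF Vm, of "-1" ?x] by simp
    finally show "(\<integral>\<^sup>+s. V (?x - s) * indicator ?S s \<partial>lborel) \<le> ?Q * ennreal (2 * h)" using VQ by simp
  qed
  have [measurable]: "(\<lambda>s. V (?x + s)) \<in> borel_measurable borel" "(\<lambda>s. V (?x - s)) \<in> borel_measurable borel"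
    using Vm by (auto intro: measurable_compose[rotated])
  define c where "c = ennreal (2 * pi * h * (cmod (u z))\<^sup>2)"
  have "c * ennreal h = (\<integral>\<^sup>+s. c * indicator ?S s \<partial>lborel)"
    using h by (subst nn_integral_cmult_indicator) auto
  also have "\<dots> \<le> (\<integral>\<^sup>+s. (2 * ?Q) * indicator ?S s + (V (?x + s) * indicator ?S s + V (?x - s) * indicator ?S s) \<partial>lborel)"
  proof (intro nn_integral_mono)
    fix s :: real
    show "c * indicator ?S s \<le> (2 * ?Q) * indicator ?S s + (V (?x + s) * indicator ?S s + V (?x - s) * indicator ?S s)"
    proof (cases "s \<in> ?S")
      case True
      have "c \<le> line_sq u (?y - h) + V (?x + s) + line_sq u (?y + h) + V (?x - s)"
        using cauchy_rectangle_bound[OF u, of h s z] True h unfolding c_def V_def W_def by simp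
      also have "\<dots> \<le> ?Q + V (?x + s) + ?Q + V (?x - s)"
        using h by (intro add_mono line_sq_le_hardy_sq order_refl) auto
      also have "\<dots> = 2 * ?Q + (V (?x + s) + V (?x - s))"
        unfolding mult_2 by (simp add: add_ac)
      finally show ?thesis using True by simp
    qed simp
  qed
  also have "\<dots> = (2 * ?Q) * ennreal h + ((\<integral>\<^sup>+s. V (?x + s) * indicator ?S s \<partial>lborel) + (\<integral>\<^sup>+s. V (?x - s) * indicator ?S s \<partial>lborel))"
    using h by (simp add: nn_integral_add nn_integral_cmult_indicator)
  also have "\<dots> \<le> (2 * ?Q) * ennreal h + (?Q * ennreal (2 * h) + ?Q * ennreal (2 * h))"
    by (intro add_mono shift order_refl)
  also have "\<dots> = 6 * ?Q * ennreal h"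
  proof -
    have "ennreal (2 * h) = 2 * ennreal h" using h by (simp add: ennreal_mult)
    moreover have "6 * ?Q * ennreal h = (2 + 2 + 2) * ?Q * ennreal h" by simp
    ultimately show ?thesis by (simp only: distrib_right distrib_left mult_ac add_ac)
  qed
  finally have le: "c * ennreal h \<le> 6 * ?Q * ennreal h" .
  show ?thesis
  proof (cases "?Q = top")
    case False
    then obtain q where q: "?Q = ennreal q" "0 \<le> q" by (cases "?Q") auto
    have "2 * pi * h * (cmod (u z))\<^sup>2 * h \<le> 6 * q * h"
      using le h q unfolding c_def
      by (simp add: ennreal_mult[symmetric] flip: ennreal_numeral)
    then have "pi * ?y * (cmod (u z))\<^sup>2 \<le> 6 * q"
      using h by (simp add: h_def mult_ac)
    moreover have "3 * (?y * (cmod (u z))\<^sup>2) \<le> pi * (?y * (cmod (u z))\<^sup>2)"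
      using pi_gt3 z by (intro mult_right_mono) auto
    ultimately have "?y * (cmod (u z))\<^sup>2 \<le> 2 * q" by simp
    then show ?thesis using q by (simp add: ennreal_mult[symmetric] flip: ennreal_numeral)
  qed (simp add: ennreal_mult_top)
qed

section \<open>The Poisson inequality and contractivity of composition operators\<close>

lemma hardy_sq_cong:
  assumes "\<And>z. z \<in> uhp \<Longrightarrow> u z = v z"
  shows "hardy_sq u = hardy_sq v"
  unfolding hardy_sq_def by (intro SUP_cong nn_integral_cong) (auto simp: assms uhp_def)

lemma line_sq_measurable:
  assumes "u holomorphic_on uhp" and "0 < y"
  shows "(\<lambda>x. ennreal ((cmod (u (Complex x y)))\<^sup>2)) \<in> borel_measurable lborel"
proof -
  have "continuous_on UNIV (\<lambda>x. u (Complex x y))"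
    using assms by (intro continuous_on_uhp_Complex continuous_intros) auto
  from borel_measurable_continuous_onI[OF this] show ?thesis by measurable
qed

lemma Im_cauchy_kernel: "Im (1 / (of_real t - z)) = Im z / (cmod (of_real t - z))\<^sup>2"
  by (simp add: Im_divide cmod_power2)

lemma bounded_displacement_id: "bounded_displacement (\<lambda>z. z)"
  unfolding bounded_displacement_def by (auto intro: exI[of _ 0])

lemma poisson_mass_real:
  assumes "0 < Im z"
  shows "(\<integral>\<^sup>+t. ennreal (Im (1 / (of_real t - z))) \<partial>lborel) = ennreal pi"
proof -
  have "Im (1 / (of_real t - z)) = Im (1 / (of_real (Re z) - Complex t (Im z)))" for t
    by (simp add: Im_divide power2_commute)
  then show ?thesis
    using poisson_mass[OF bounded_displacement_id assms, of "Re z"] by simp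
qed

text \<open>The quotient \<open>(f(w) - f(z)) / ((w - z) (w - cnj z))\<close> has a removable singularity at \<open>z\<close> and decays
quadratically, so its integral over the line vanishes: the Poisson kernel of \<open>z\<close> annihilates
\<open>f - f(z)\<close>. The inequality follows by integrating
\<open>\<bar>f(t)\<bar>\<^sup>2 \<ge> \<bar>f(z)\<bar>\<^sup>2 + 2 Re ((f(t) - f(z)) cnj f(z))\<close> against the kernel.\<close>

lemma poisson_inequality:
  assumes e: "0 < e" and f: "f holomorphic_on {z. - e < Im z}"
    and M: "\<And>z. 0 \<le> Im z \<Longrightarrow> cmod (f z) \<le> M" and z: "0 < Im z"
  shows "ennreal (pi * (cmod (f z))\<^sup>2)
           \<le> (\<integral>\<^sup>+t. ennreal (Im (1 / (of_real t - z)) * (cmod (f (of_real t)))\<^sup>2) \<partial>lborel)"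
proof -
  define e' where "e' = min e (Im z)"
  have e': "0 < e'" "e' \<le> e" "e' \<le> Im z" using e z by (auto simp: e'_def)
  let ?S = "{w. - e' < Im w}"
  define q where "q w = (if w = z then deriv f z else (f w - f z) / (w - z))" for w
  define G where "G w = q w / (w - cnj z)" for w
  have ne: "w - cnj z \<noteq> 0" if "- e' < Im w" for w
    using that e' by (auto simp: complex_eq_iff)
  have S: "open ?S" using open_halfspace_Im_gt[of "- e'"] by simp
  have fS: "f holomorphic_on ?S"
    by (rule holomorphic_on_subset[OF f]) (use e' in auto)
  have "q holomorphic_on ?S"
    using pole_lemma_open[OF fS S, of z] unfolding q_def .
  then have G: "G holomorphic_on ?S"
    unfolding G_def by (intro holomorphic_intros) (use ne in auto)
  \<comment> \<open>Beyond this radius both denominators of \<open>G\<close> are at least \<open>cmod w / 2\<close>.\<close>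
  define R where "R = 2 * cmod z + 1"
  have M0: "0 \<le> M" using M[of z] z norm_ge_zero[of "f z"] by linarith
  have large: "cmod (G w) \<le> 8 * M / (cmod w)\<^sup>2" if "0 \<le> Im w" "R \<le> cmod w" for w
  proof -
    have "2 * cmod z + 1 \<le> cmod w" using that by (simp add: R_def)
    then have w: "cmod w / 2 \<le> cmod (w - z)" "cmod w / 2 \<le> cmod (w - cnj z)" "0 < cmod w"
      using norm_triangle_sub[of w z] norm_triangle_sub[of w "cnj z"] norm_ge_zero[of z]
      unfolding complex_mod_cnj by linarith+
    have "w \<noteq> z" using w by auto
    then have "cmod (G w) = cmod (f w - f z) / (cmod (w - z) * cmod (w - cnj z))"
      by (simp add: G_def q_def norm_divide norm_mult)
    also have "\<dots> \<le> (2 * M) / (cmod w / 2 * (cmod w / 2))"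
      using M0 M[of w] M[of z] that z w norm_triangle_ineq4[of "f w" "f z"]
      by (intro frac_le mult_mono mult_pos_pos) auto
    also have "\<dots> = 8 * M / (cmod w)\<^sup>2" by (simp add: power2_eq_square)
    finally show ?thesis .
  qed
  have "compact (cball 0 R \<inter> {w::complex. 0 \<le> Im w})"
    using closed_halfspace_Im_ge[of 0] by (intro compact_Int_closed compact_cball) auto
  moreover have "continuous_on (cball 0 R \<inter> {w. 0 \<le> Im w}) G"
    by (rule continuous_on_subset[OF holomorphic_on_imp_continuous_on[OF G]]) (use e' in auto)
  ultimately have "bounded (G ` (cball 0 R \<inter> {w. 0 \<le> Im w}))"
    by (intro compact_imp_bounded compact_continuous_image)
  then obtain K where K: "\<And>w. cmod w \<le> R \<Longrightarrow> 0 \<le> Im w \<Longrightarrow> cmod (G w) \<le> K"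
    unfolding bounded_iff by (metis (mono_tags, lifting) IntI dist_0_norm image_eqI mem_Collect_eq mem_cball)
  define D where "D = 16 * M + K * (1 + R\<^sup>2)"
  have K0: "0 \<le> K" using order_trans[OF norm_ge_zero K[of 0]] by (simp add: R_def)
  have bound: "cmod (G w) \<le> D / (1 + (cmod w)\<^sup>2)" if w: "0 \<le> Im w" for w
  proof (cases "cmod w \<le> R")
    case True
    have "cmod (G w) * (1 + (cmod w)\<^sup>2) \<le> K * (1 + R\<^sup>2)"
      using K[OF True w] True K0 by (intro mult_mono add_left_mono power_mono) auto
    then show ?thesis
      using M0 by (simp add: D_def pos_le_divide_eq add_pos_nonneg)
  next
    case False
    then have R: "R \<le> cmod w" "1 \<le> cmod w" using norm_ge_zero[of z] unfolding R_def by linarith+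
    have "1 \<le> (cmod w)\<^sup>2" using R(2) by (simp add: one_le_power)
    then have "0 < (cmod w)\<^sup>2 * (1 + (cmod w)\<^sup>2)" by (intro mult_pos_pos) linarith+
    with \<open>1 \<le> (cmod w)\<^sup>2\<close> have "8 * M / (cmod w)\<^sup>2 \<le> 16 * M / (1 + (cmod w)\<^sup>2)"
      using M0 divide_left_mono[of "1 + (cmod w)\<^sup>2" "2 * (cmod w)\<^sup>2" "16 * M"] by simp
    also have "\<dots> \<le> D / (1 + (cmod w)\<^sup>2)"
      using K0 by (intro divide_right_mono) (auto simp: D_def)
    finally show ?thesis using large[OF w R(1)] by simp
  qed
  note int = integral_real_line_eq_0[OF e'(1) G bound]
  let ?p = "\<lambda>t. Im (1 / (of_real t - z))" and ?F = "\<lambda>t. f (of_real t)"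
  have p0: "0 \<le> ?p t" for t using z unfolding Im_cauchy_kernel by simp
  have tz: "of_real t - z \<noteq> 0" for t using z by (auto simp: complex_eq_iff)
  have contp: "continuous_on UNIV ?p"
    using tz by (intro continuous_intros) auto
  have contF: "continuous_on UNIV ?F"
    using e by (intro continuous_on_compose2[OF holomorphic_on_imp_continuous_on[OF f]] continuous_intros) auto
  have [measurable]: "?p \<in> borel_measurable borel" "?F \<in> borel_measurable borel"
    by (intro borel_measurable_continuous_onI contp contF)+
  have pint: "integrable lborel ?p"
    using poisson_mass_real[OF z] p0 by (intro integrableI_nonneg) auto
  have "ennreal (LINT t|lborel. ?p t) = ennreal pi"
    using nn_integral_eq_integral[OF pint] p0 poisson_mass_real[OF z] by simp
  then have pmass: "(LINT t|lborel. ?p t) = pi"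
    using p0 by (simp add: integral_nonneg_AE)
  have pFint: "integrable lborel (\<lambda>t. ?p t * (cmod (?F t))\<^sup>2)"
  proof (rule Bochner_Integration.integrable_bound)
    show "integrable lborel (\<lambda>t. M\<^sup>2 * ?p t)" using pint by simp
    show "AE t in lborel. norm (?p t * (cmod (?F t))\<^sup>2) \<le> norm (M\<^sup>2 * ?p t)"
    proof (intro AE_I2)
      fix t :: real
      have "?p t * (cmod (?F t))\<^sup>2 \<le> ?p t * M\<^sup>2"
        using p0 M[of "of_real t"] by (intro mult_left_mono power_mono) auto
      then show "norm (?p t * (cmod (?F t))\<^sup>2) \<le> norm (M\<^sup>2 * ?p t)"
        using p0[of t] by (simp add: abs_mult mult.commute)
    qed
  qed measurable
  have alg: "c * p + 2 * h * X \<le> p * d" if "h * X = p * Y" "c + 2 * Y \<le> d" "0 \<le> p"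
    for c p h X Y d :: real
    using mult_left_mono[OF that(2,3)] that(1) by (simp add: algebra_simps)
  have ptw: "(cmod (f z))\<^sup>2 * ?p t + 2 * Im z * Re (G (of_real t) * cnj (f z)) \<le> ?p t * (cmod (?F t))\<^sup>2" for t
  proof -
    have "G (of_real t) = (?F t - f z) / (of_real ((cmod (of_real t - z))\<^sup>2))"
    proof -
      have "(of_real t - z) * (of_real t - cnj z) = of_real ((cmod (of_real t - z))\<^sup>2)"
        using complex_norm_square[of "of_real t - z"] by simp
      moreover have "of_real t \<noteq> z" using tz[of t] by auto
      ultimately show ?thesis by (simp add: G_def q_def)
    qed
    then have "Im z * Re (G (of_real t) * cnj (f z)) = ?p t * Re ((?F t - f z) * cnj (f z))"
      by (simp only: Im_cauchy_kernel times_divide_eq_left Re_divide_of_real times_divide_eq_right)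
    moreover have "(cmod (f z))\<^sup>2 + 2 * Re ((?F t - f z) * cnj (f z)) \<le> (cmod (?F t))\<^sup>2"
    proof -
      have "(cmod (?F t))\<^sup>2 - ((cmod (f z))\<^sup>2 + 2 * Re ((?F t - f z) * cnj (f z))) = (cmod (?F t - f z))\<^sup>2"
        unfolding cmod_power2 by (simp add: power2_eq_square algebra_simps)
      then show ?thesis using zero_le_power2[of "cmod (?F t - f z)"] by linarith
    qed
    ultimately show ?thesis
      by (rule alg) (rule p0)
  qed
  have Gint: "integrable lborel (\<lambda>t. Re (G (of_real t) * cnj (f z)))"
    using int(1) by (intro integrable_Re integrable_mult_left) auto
  have "(LINT t|lborel. Re (G (of_real t) * cnj (f z))) = Re ((LINT t|lborel. G (of_real t)) * cnj (f z))"
    using int(1) by simp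
  then have G0: "(LINT t|lborel. Re (G (of_real t) * cnj (f z))) = 0"
    using int(2) by simp
  have "pi * (cmod (f z))\<^sup>2 = (LINT t|lborel. (cmod (f z))\<^sup>2 * ?p t + 2 * Im z * Re (G (of_real t) * cnj (f z)))"
    using pint Gint by (simp add: pmass G0 del: times_complex.sel)
  also have "\<dots> \<le> (LINT t|lborel. ?p t * (cmod (?F t))\<^sup>2)"
    using pint Gint pFint by (intro integral_mono ptw) auto
  finally have "ennreal (pi * (cmod (f z))\<^sup>2) \<le> ennreal (LINT t|lborel. ?p t * (cmod (?F t))\<^sup>2)"
    by (rule ennreal_leI)
  also have "\<dots> = (\<integral>\<^sup>+t. ennreal (?p t * (cmod (?F t))\<^sup>2) \<partial>lborel)"
    using pFint p0 by (intro nn_integral_eq_integral[symmetric]) auto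
  finally show ?thesis .
qed

lemma holomorphic_on_shift_up:
  assumes "u holomorphic_on uhp" and "0 \<le> e"
  shows "(\<lambda>z. u (z + \<i> * of_real e)) holomorphic_on {z. - e < Im z}"
proof -
  have "(u \<circ> (\<lambda>z. z + \<i> * of_real e)) holomorphic_on {z. - e < Im z}"
    by (intro holomorphic_on_compose_gen[OF _ assms(1)] holomorphic_intros) (auto simp: uhp_def)
  then show ?thesis by (simp add: o_def)
qed

text \<open>Apply the Poisson inequality to \<open>u(z + i e)\<close> at the points \<open>\<Psi>(x + i y)\<close>, integrate over \<open>x\<close>, and
exchange the integrals: by \<open>poisson_mass\<close> the inner integral is the constant \<open>\<pi>\<close>. The shift by
\<open>e\<close> makes the function bounded and holomorphic across the real line.\<close>

lemma line_integral_composition_le: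
  assumes u: "u holomorphic_on uhp" and fin: "hardy_sq u < \<infinity>"
    and \<Psi>: "bounded_displacement \<Psi>" and y: "0 < y" and e: "0 < e"
  shows "(\<integral>\<^sup>+x. ennreal ((cmod (u (\<Psi> (Complex x y) + \<i> * of_real e)))\<^sup>2) \<partial>lborel) \<le> line_sq u e"
proof -
  let ?f = "\<lambda>z. u (z + \<i> * of_real e)"
  obtain q where q: "hardy_sq u = ennreal q" "0 \<le> q"
    using fin by (cases "hardy_sq u") auto
  have f: "?f holomorphic_on {z. - e < Im z}"
    using holomorphic_on_shift_up[OF u] e by simp
  have bd: "cmod (?f z) \<le> sqrt (2 * q / e)" if "0 \<le> Im z" for z
  proof -
    have "ennreal (Im (z + \<i> * of_real e) * (cmod (?f z))\<^sup>2) \<le> ennreal (2 * q)"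
      using hardy_point_bound[OF u, of "z + \<i> * of_real e"] that e q
      by (simp add: ennreal_mult flip: ennreal_numeral)
    then have "(Im z + e) * (cmod (?f z))\<^sup>2 \<le> 2 * q"
      using q by simp
    moreover have "e * (cmod (?f z))\<^sup>2 \<le> (Im z + e) * (cmod (?f z))\<^sup>2"
      using that by (intro mult_right_mono) auto
    ultimately have "(cmod (?f z))\<^sup>2 \<le> 2 * q / e"
      using e by (simp add: pos_le_divide_eq mult.commute)
    then show ?thesis by (rule real_le_rsqrt)
  qed
  have hol: "\<Psi> holomorphic_on uhp" and Im: "\<And>z. 0 < Im z \<Longrightarrow> Im z \<le> Im (\<Psi> z)"
    using \<Psi> unfolding bounded_displacement_def uhp_def by auto
  define w where "w x = \<Psi> (Complex x y)" for x
  have w: "0 < Im (w x)" for x using Im[of "Complex x y"] y by (simp add: w_def)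
  have contw: "continuous_on A (\<lambda>x. w (g x))" if "continuous_on A g" for A :: "(real \<times> real) set" and g
    unfolding w_def using y by (intro continuous_on_uhp_Complex hol that continuous_intros) auto
  have fline: "?f (of_real t) = u (Complex t e)" for t
    by (simp add: Complex_eq)
  define P where "P x t = ennreal (Im (1 / (of_real t - w x)) * (cmod (u (Complex t e)))\<^sup>2)" for x t
  have "continuous_on UNIV (\<lambda>p. Im (1 / (of_real (snd p) - w (fst p))) * (cmod (u (Complex (snd p) e)))\<^sup>2)"
  proof (intro continuous_intros contw continuous_on_uhp_Complex[OF u])
    show "\<forall>p\<in>UNIV. of_real (snd p) - w (fst p) \<noteq> 0"
    proof
      fix p :: "real \<times> real"
      show "of_real (snd p) - w (fst p) \<noteq> 0" using w[of "fst p"] by (auto simp: complex_eq_iff)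
    qed
  qed (use e in auto)
  then have "(\<lambda>p. P (fst p) (snd p)) \<in> borel_measurable borel"
    unfolding P_def by (intro measurable_compose[OF borel_measurable_continuous_onI measurable_ennreal])
  then have Pm: "(\<lambda>(x, t). P x t) \<in> borel_measurable (lborel \<Otimes>\<^sub>M lborel)"
    by (simp add: lborel_prod case_prod_beta')
  have um: "(\<lambda>t. ennreal ((cmod (u (Complex t e)))\<^sup>2)) \<in> borel_measurable lborel"
    by (rule line_sq_measurable[OF u e])
  have wm: "(\<lambda>x. ennreal ((cmod (?f (w x)))\<^sup>2)) \<in> borel_measurable lborel"
  proof -
    have "continuous_on UNIV (\<lambda>x. w x)"
      unfolding w_def using y by (intro continuous_on_uhp_Complex hol continuous_intros) auto
    then have "continuous_on UNIV (\<lambda>x. ?f (w x))"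
      using w e by (intro continuous_on_compose2[OF holomorphic_on_imp_continuous_on[OF f]]) (auto intro: less_trans[of _ 0])
    from borel_measurable_continuous_onI[OF this] show ?thesis by measurable
  qed
  have "ennreal pi * (\<integral>\<^sup>+x. ennreal ((cmod (?f (w x)))\<^sup>2) \<partial>lborel)
      = (\<integral>\<^sup>+x. ennreal (pi * (cmod (?f (w x)))\<^sup>2) \<partial>lborel)"
    using wm by (simp add: nn_integral_cmult ennreal_mult)
  also have "\<dots> \<le> (\<integral>\<^sup>+x. \<integral>\<^sup>+t. P x t \<partial>lborel \<partial>lborel)"
    unfolding P_def fline[symmetric] by (intro nn_integral_mono poisson_inequality[OF e f bd w])
  also have "\<dots> = (\<integral>\<^sup>+t. \<integral>\<^sup>+x. P x t \<partial>lborel \<partial>lborel)"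
    by (rule lborel_pair.Fubini'[symmetric]) (rule Pm)
  also have "\<dots> = (\<integral>\<^sup>+t. ennreal pi * ennreal ((cmod (u (Complex t e)))\<^sup>2) \<partial>lborel)"
  proof (intro nn_integral_cong)
    fix t :: real
    have "P x t = ennreal (Im (1 / (of_real t - w x))) * ennreal ((cmod (u (Complex t e)))\<^sup>2)" for x
      unfolding P_def using w[of x] by (intro ennreal_mult) (auto simp: Im_cauchy_kernel)
    moreover have "(\<lambda>x. ennreal (Im (1 / (of_real t - w x)))) \<in> borel_measurable lborel"
    proof -
      have "continuous_on UNIV (\<lambda>x. w x)"
        unfolding w_def using y by (intro continuous_on_uhp_Complex hol continuous_intros) auto
      moreover have "of_real t - w x \<noteq> 0" for x using w[of x] by (auto simp: complex_eq_iff)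
      ultimately have "continuous_on UNIV (\<lambda>x. Im (1 / (of_real t - w x)))"
        by (intro continuous_intros) auto
      from borel_measurable_continuous_onI[OF this] show ?thesis by measurable
    qed
    ultimately show "(\<integral>\<^sup>+x. P x t \<partial>lborel) = ennreal pi * ennreal ((cmod (u (Complex t e)))\<^sup>2)"
      using poisson_mass[OF \<Psi> y, of t] by (simp add: nn_integral_multc w_def)
  qed
  also have "\<dots> = ennreal pi * line_sq u e"
    using um by (simp add: nn_integral_cmult line_sq_def)
  finally show ?thesis
    by (simp add: w_def ennreal_mult_le_mult_iff)
qed

lemma line_sq_antimono:
  assumes u: "u holomorphic_on uhp" and fin: "hardy_sq u < \<infinity>" and y: "0 < y" "y \<le> y'"
  shows "line_sq u y' \<le> line_sq u y"
proof (cases "y = y'")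
  case False
  have "Complex x (y' - y) + \<i> * of_real y = Complex x y'" for x
    by (simp add: complex_eq_iff)
  then show ?thesis
    using line_integral_composition_le[OF u fin bounded_displacement_id, of "y' - y" y] False y
    by (simp add: line_sq_def)
qed simp

text \<open>The supremum defining the Hardy norm is a limit. This is what makes the norm satisfy the parallelogram
law, since each single line gives an \<open>L\<^sup>2\<close> norm.\<close>

lemma line_sq_tendsto_hardy_sq:
  assumes "u holomorphic_on uhp" and "hardy_sq u < \<infinity>"
  shows "(\<lambda>n. line_sq u (1 / real (Suc n))) \<longlonglongrightarrow> hardy_sq u"
proof -
  have "incseq (\<lambda>n. line_sq u (1 / real (Suc n)))"
    by (intro incseq_SucI line_sq_antimono assms) (auto simp: field_simps)
  then have "(\<lambda>n. line_sq u (1 / real (Suc n))) \<longlonglongrightarrow> (SUP n. line_sq u (1 / real (Suc n)))"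
    by (rule LIMSEQ_SUP)
  also have "(SUP n. line_sq u (1 / real (Suc n))) = hardy_sq u"
  proof (rule antisym)
    show "(SUP n. line_sq u (1 / real (Suc n))) \<le> hardy_sq u"
      by (intro SUP_least line_sq_le_hardy_sq) simp
    show "hardy_sq u \<le> (SUP n. line_sq u (1 / real (Suc n)))"
      unfolding hardy_sq_line_sq
    proof (intro SUP_least)
      fix y :: real assume "y \<in> {0<..}"
      then obtain n where "1 / real (Suc n) < y"
        using nat_approx_posE[of y] by auto
      then have "line_sq u y \<le> line_sq u (1 / real (Suc n))"
        by (intro line_sq_antimono assms) auto
      then show "line_sq u y \<le> (SUP n. line_sq u (1 / real (Suc n)))"
        by (rule SUP_upper2[rotated]) simp
    qed
  qed
  finally show ?thesis .
qed

text \<open>Fatou's lemma on each horizontal line. It replaces every passage to boundary values, and it gives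
completeness.\<close>

lemma hardy_sq_Fatou:
  assumes u: "\<And>n::nat. u n holomorphic_on uhp"
    and lim: "\<And>z. z \<in> uhp \<Longrightarrow> (\<lambda>n. u n z) \<longlonglongrightarrow> v z"
  shows "hardy_sq v \<le> liminf (\<lambda>n. hardy_sq (u n))"
  unfolding hardy_sq_line_sq[of v]
proof (intro SUP_least)
  fix y :: real assume "y \<in> {0<..}"
  then have y: "0 < y" by simp
  let ?g = "\<lambda>n x. ennreal ((cmod (u n (Complex x y)))\<^sup>2)"
  have "(\<lambda>n. ?g n x) \<longlonglongrightarrow> ennreal ((cmod (v (Complex x y)))\<^sup>2)" for x
    using lim[of "Complex x y"] y by (intro tendsto_ennrealI tendsto_intros) (auto simp: uhp_def)
  then have "line_sq v y = (\<integral>\<^sup>+x. liminf (\<lambda>n. ?g n x) \<partial>lborel)"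
    unfolding line_sq_def by (intro nn_integral_cong lim_imp_Liminf[symmetric]) auto
  also have "\<dots> \<le> liminf (\<lambda>n. line_sq (u n) y)"
    unfolding line_sq_def by (intro nn_integral_liminf line_sq_measurable u y)
  also have "\<dots> \<le> liminf (\<lambda>n. hardy_sq (u n))"
    by (intro Liminf_mono always_eventually allI line_sq_le_hardy_sq y)
  finally show "line_sq v y \<le> liminf (\<lambda>n. hardy_sq (u n))" .
qed

lemma tendsto_shift_up:
  assumes u: "u holomorphic_on uhp" and z: "z \<in> uhp"
  shows "(\<lambda>n. u (z + \<i> * of_real (1 / real (Suc n)))) \<longlonglongrightarrow> u z"
proof -
  have "isCont u z"
    using holomorphic_on_imp_continuous_on[OF u] z open_halfspace_Im_gt[of 0]
    by (simp add: continuous_on_eq_continuous_at uhp_def)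
  moreover have "(\<lambda>n. z + \<i> * of_real (1 / real (Suc n))) \<longlonglongrightarrow> z + \<i> * of_real 0"
    using LIMSEQ_inverse_real_of_nat by (intro tendsto_intros) (simp add: inverse_eq_divide)
  ultimately show ?thesis
    using isCont_tendsto_compose by fastforce
qed

text \<open>For the maps \<open>\<Phi>\<close> this is the contractivity of the composition operator; for vertical shifts it says
that moving up does not increase the norm.\<close>

lemma hardy_sq_composition_le:
  assumes u: "u holomorphic_on uhp" and fin: "hardy_sq u < \<infinity>" and \<Psi>: "bounded_displacement \<Psi>"
  shows "hardy_sq (\<lambda>z. u (\<Psi> z)) \<le> hardy_sq u"
proof -
  have hol: "\<Psi> holomorphic_on uhp" and map: "\<Psi> z \<in> uhp" if "z \<in> uhp" for z
    using \<Psi> that unfolding bounded_displacement_def uhp_def by force+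
  define v where "v n z = u (\<Psi> z + \<i> * of_real (1 / real (Suc n)))" for n z
  have "v n holomorphic_on uhp" for n
  proof -
    have "((\<lambda>z. u (z + \<i> * of_real (1 / real (Suc n)))) \<circ> \<Psi>) holomorphic_on uhp"
    proof (intro holomorphic_on_compose_gen[OF _ holomorphic_on_shift_up[OF u]])
      show "\<Psi> holomorphic_on uhp" using \<Psi> unfolding bounded_displacement_def by blast
    qed (use map in \<open>auto simp: uhp_def intro: less_trans[of _ 0]\<close>)
    then show ?thesis by (simp add: v_def[abs_def] o_def)
  qed
  moreover have "(\<lambda>n. v n z) \<longlonglongrightarrow> u (\<Psi> z)" if "z \<in> uhp" for z
    unfolding v_def by (intro tendsto_shift_up u map that)
  ultimately have "hardy_sq (\<lambda>z. u (\<Psi> z)) \<le> liminf (\<lambda>n. hardy_sq (v n))"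
    by (rule hardy_sq_Fatou)
  also have "\<dots> \<le> liminf (\<lambda>n::nat. hardy_sq u)"
  proof (intro Liminf_mono always_eventually allI)
    fix n
    show "hardy_sq (v n) \<le> hardy_sq u"
      unfolding hardy_sq_def[of "v n"] v_def
      by (intro SUP_least order_trans[OF line_integral_composition_le[OF u fin \<Psi>] line_sq_le_hardy_sq]) auto
  qed
  also have "\<dots> = hardy_sq u" by (simp add: Liminf_const)
  finally show ?thesis .
qed

section \<open>The Hardy space is a Hilbert space\<close>

lemma hardy_space_simps [simp]:
  "u \<in> vcarrier hardy_space \<longleftrightarrow> u \<in> extensional uhp \<and> u holomorphic_on uhp \<and> hardy_sq u < \<infinity>"
  "vzero hardy_space = (\<lambda>z\<in>uhp. 0)"
  "vadd hardy_space u v = (\<lambda>z\<in>uhp. u z + v z)"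
  "vscale hardy_space a u = (\<lambda>z\<in>uhp. a * u z)"
  "vnorm hardy_space u = sqrt (enn2real (hardy_sq u))"
  by (simp_all add: hardy_space_def)

lemma hardy_sq_restrict [simp]: "hardy_sq (restrict u uhp) = hardy_sq u"
  by (rule hardy_sq_cong) simp

lemma holomorphic_on_restrict [simp]: "restrict u uhp holomorphic_on uhp \<longleftrightarrow> u holomorphic_on uhp"
  by (rule holomorphic_cong) auto

lemma hardy_sq_add_le:
  assumes u: "u holomorphic_on uhp" and v: "v holomorphic_on uhp"
  shows "hardy_sq (\<lambda>z. u z + v z) \<le> 2 * hardy_sq u + 2 * hardy_sq v"
  unfolding hardy_sq_def[of "\<lambda>z. u z + v z"]
proof (intro SUP_least)
  fix y :: real assume "y \<in> {0<..}"
  then have y: "0 < y" by simp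
  let ?a = "\<lambda>x. (cmod (u (Complex x y)))\<^sup>2" and ?b = "\<lambda>x. (cmod (v (Complex x y)))\<^sup>2"
  have le: "(cmod (a + b))\<^sup>2 \<le> 2 * (cmod a)\<^sup>2 + 2 * (cmod b)\<^sup>2" for a b :: complex
  proof -
    have "(cmod (a + b))\<^sup>2 \<le> (cmod a + cmod b)\<^sup>2"
      by (intro power_mono norm_triangle_ineq) auto
    then show ?thesis using sum_squares_bound[of "cmod a" "cmod b"] by (simp add: power2_sum)
  qed
  have "(\<integral>\<^sup>+x. ennreal ((cmod (u (Complex x y) + v (Complex x y)))\<^sup>2) \<partial>lborel)
     \<le> (\<integral>\<^sup>+x. 2 * ennreal (?a x) + 2 * ennreal (?b x) \<partial>lborel)"
  proof (intro nn_integral_mono)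
    fix x :: real
    have "ennreal ((cmod (u (Complex x y) + v (Complex x y)))\<^sup>2) \<le> ennreal (2 * ?a x + 2 * ?b x)"
      by (intro ennreal_leI le)
    then show "ennreal ((cmod (u (Complex x y) + v (Complex x y)))\<^sup>2) \<le> 2 * ennreal (?a x) + 2 * ennreal (?b x)"
      by (simp add: ennreal_mult)
  qed
  also have "\<dots> = 2 * line_sq u y + 2 * line_sq v y"
    using line_sq_measurable[OF u y] line_sq_measurable[OF v y]
    by (simp add: nn_integral_add nn_integral_cmult line_sq_def)
  also have "\<dots> \<le> 2 * hardy_sq u + 2 * hardy_sq v"
    using y by (intro add_mono mult_left_mono line_sq_le_hardy_sq) auto
  finally show "(\<integral>\<^sup>+x. ennreal ((cmod (u (Complex x y) + v (Complex x y)))\<^sup>2) \<partial>lborel) \<le> 2 * hardy_sq u + 2 * hardy_sq v" .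
qed

lemma hardy_sq_scale:
  assumes u: "u holomorphic_on uhp"
  shows "hardy_sq (\<lambda>z. a * u z) = ennreal ((cmod a)\<^sup>2) * hardy_sq u"
proof -
  have "line_sq (\<lambda>z. a * u z) y = ennreal ((cmod a)\<^sup>2) * line_sq u y" if "y \<in> {0<..}" for y
    using line_sq_measurable[OF u, of y] that
    by (simp add: line_sq_def norm_mult power_mult_distrib ennreal_mult nn_integral_cmult)
  then show ?thesis
    unfolding hardy_sq_line_sq by (simp add: SUP_mult_left_ennreal)
qed

lemma hardy_add_closed:
  assumes "u \<in> vcarrier hardy_space" and "v \<in> vcarrier hardy_space"
  shows "vadd hardy_space u v \<in> vcarrier hardy_space"
proof -
  have "hardy_sq (\<lambda>z. u z + v z) \<le> 2 * hardy_sq u + 2 * hardy_sq v"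
    using assms by (intro hardy_sq_add_le) auto
  also have "\<dots> < \<infinity>" using assms by (simp add: ennreal_mult_less_top)
  finally show ?thesis using assms by (simp add: holomorphic_intros)
qed

lemma hardy_scale_closed:
  assumes "u \<in> vcarrier hardy_space"
  shows "vscale hardy_space a u \<in> vcarrier hardy_space"
  using assms by (simp add: holomorphic_intros hardy_sq_scale ennreal_mult_less_top)

lemma complex_vector_space_hardy: "complex_vector_space hardy_space"
proof -
  have z: "vzero hardy_space \<in> vcarrier hardy_space"
    using hardy_sq_scale[of "\<lambda>z. 0" 0] by simp
  show ?thesis
    unfolding complex_vector_space_def
    by (intro conjI ballI allI z hardy_add_closed hardy_scale_closed)
      (auto simp: fun_eq_iff extensional_def algebra_simps)
qed

lemma hardy_line_integrable:
  assumes u: "u holomorphic_on uhp" and fin: "hardy_sq u < \<infinity>" and y: "0 < y"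
  shows "integrable lborel (\<lambda>x. (cmod (u (Complex x y)))\<^sup>2)"
    and "(LINT x|lborel. (cmod (u (Complex x y)))\<^sup>2) = enn2real (line_sq u y)"
proof -
  have "continuous_on UNIV (\<lambda>x. (cmod (u (Complex x y)))\<^sup>2)"
    using y by (intro continuous_intros continuous_on_uhp_Complex u) auto
  then have m: "(\<lambda>x. (cmod (u (Complex x y)))\<^sup>2) \<in> borel_measurable borel"
    by (rule borel_measurable_continuous_onI)
  then show "integrable lborel (\<lambda>x. (cmod (u (Complex x y)))\<^sup>2)"
    using order_le_less_trans[OF line_sq_le_hardy_sq[OF y] fin]
    by (intro integrableI_nonneg) (auto simp: line_sq_def)
  show "(LINT x|lborel. (cmod (u (Complex x y)))\<^sup>2) = enn2real (line_sq u y)"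
    unfolding line_sq_def using m by (intro integral_eq_nn_integral) auto
qed

lemma hardy_line_product_integrable:
  assumes u: "u holomorphic_on uhp" "hardy_sq u < \<infinity>" and v: "v holomorphic_on uhp" "hardy_sq v < \<infinity>"
    and y: "0 < y"
  shows "integrable lborel (\<lambda>x. u (Complex x y) * cnj (v (Complex x y)))"
proof (rule Bochner_Integration.integrable_bound)
  show "integrable lborel (\<lambda>x. (cmod (u (Complex x y)))\<^sup>2 + (cmod (v (Complex x y)))\<^sup>2)"
    by (intro Bochner_Integration.integrable_add hardy_line_integrable u v y)
  have "continuous_on UNIV (\<lambda>x. u (Complex x y) * cnj (v (Complex x y)))"
    using y by (intro continuous_intros continuous_on_uhp_Complex u v) auto
  from borel_measurable_continuous_onI[OF this]
  show "(\<lambda>x. u (Complex x y) * cnj (v (Complex x y))) \<in> borel_measurable lborel" by simp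
  show "AE x in lborel. norm (u (Complex x y) * cnj (v (Complex x y)))
      \<le> norm ((cmod (u (Complex x y)))\<^sup>2 + (cmod (v (Complex x y)))\<^sup>2)"
  proof (intro AE_I2)
    fix x
    have "a * b \<le> a\<^sup>2 + b\<^sup>2" if "0 \<le> a" "0 \<le> b" for a b :: real
      using sum_squares_bound[of a b] mult_nonneg_nonneg[OF that] by linarith
    then show "norm (u (Complex x y) * cnj (v (Complex x y)))
      \<le> norm ((cmod (u (Complex x y)))\<^sup>2 + (cmod (v (Complex x y)))\<^sup>2)"
      by (simp add: norm_mult)
  qed
qed

lemma hardy_line_form:
  assumes y: "0 < y"
  shows "hermitian_form hardy_space (\<lambda>u v. LINT x|lborel. u (Complex x y) * cnj (v (Complex x y)))"
  unfolding hermitian_form_def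
proof (intro conjI ballI allI)
  have C: "Complex x y \<in> uhp" for x using y by (simp add: uhp_def)
  fix u v assume u: "u \<in> vcarrier hardy_space" and v: "v \<in> vcarrier hardy_space"
  show "(LINT x|lborel. v (Complex x y) * cnj (u (Complex x y))) = cnj (LINT x|lborel. u (Complex x y) * cnj (v (Complex x y)))"
    by (subst Bochner_Integration.integral_cnj[symmetric]) (simp only: complex_cnj_mult complex_cnj_cnj mult.commute)
  show "(LINT x|lborel. vscale hardy_space a u (Complex x y) * cnj (v (Complex x y)))
      = a * (LINT x|lborel. u (Complex x y) * cnj (v (Complex x y)))" for a
    using C by (simp add: mult.assoc)
  show "(LINT x|lborel. vadd hardy_space u v (Complex x y) * cnj (w (Complex x y)))
      = (LINT x|lborel. u (Complex x y) * cnj (w (Complex x y))) + (LINT x|lborel. v (Complex x y) * cnj (w (Complex x y)))"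
    if "w \<in> vcarrier hardy_space" for w
    using C u v that y
    by (simp add: distrib_right hardy_line_product_integrable)
qed

text \<open>The inner product is the limit of the \<open>L\<^sup>2\<close> inner products over the lines \<open>Im z = 1 / (n + 1)\<close>.\<close>

lemma hardy_inner_product: "\<exists>ip. inner_product_for hardy_space ip"
proof -
  define B where "B n u v = (LINT x|lborel. u (Complex x (1 / real (Suc n))) * cnj (v (Complex x (1 / real (Suc n)))))"
    for n and u v :: "complex \<Rightarrow> complex"
  have B: "hermitian_form hardy_space (B n)" for n
    unfolding B_def by (rule hardy_line_form) simp
  have diag: "(\<lambda>n. B n u u) \<longlonglongrightarrow> complex_of_real ((vnorm hardy_space u)\<^sup>2)" if u: "u \<in> vcarrier hardy_space" for u
  proof -
    have "B n u u = complex_of_real (enn2real (line_sq u (1 / real (Suc n))))" for n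
      unfolding B_def complex_norm_square[symmetric]
      using u by (subst integral_complex_of_real) (simp add: hardy_line_integrable)
    moreover have "(\<lambda>n. enn2real (line_sq u (1 / real (Suc n)))) \<longlonglongrightarrow> enn2real (hardy_sq u)"
      using line_sq_tendsto_hardy_sq[of u] u
      by (intro tendsto_enn2real) (auto simp: less_top ennreal_enn2real simp del: of_nat_Suc)
    ultimately show ?thesis by (simp add: tendsto_of_real)
  qed
  then have conv: "convergent (\<lambda>n. B n u u)" if "u \<in> vcarrier hardy_space" for u
    using that convergent_def by blast
  define L where "L u v = lim (\<lambda>n. B n u v)" for u v
  have Lh: "hermitian_form hardy_space L"
    and Llim: "\<And>u v. u \<in> vcarrier hardy_space \<Longrightarrow> v \<in> vcarrier hardy_space \<Longrightarrow> (\<lambda>n. B n u v) \<longlonglongrightarrow> L u v"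
    using hermitian_form_limit[of hardy_space B, OF complex_vector_space_hardy B conv] unfolding L_def by blast+
  have Ldiag: "L u u = complex_of_real ((vnorm hardy_space u)\<^sup>2)" if u: "u \<in> vcarrier hardy_space" for u
    using Llim[OF u u] diag[OF u] LIMSEQ_unique by blast
  have "u = vzero hardy_space" if u: "u \<in> vcarrier hardy_space" and 0: "L u u = 0" for u
  proof -
    have "enn2real (hardy_sq u) = 0" using Ldiag[OF u] 0 by simp
    then have "hardy_sq u = 0" using u by (auto simp: enn2real_eq_0_iff)
    then have "u z = 0" if "z \<in> uhp" for z
      using hardy_point_bound[of u z] u that by (auto simp: uhp_def mult_le_0_iff)
    then show ?thesis using u by (auto simp: fun_eq_iff extensional_def)
  qed
  moreover have "0 \<le> vnorm hardy_space u" for u by simp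
  ultimately have "inner_product_for hardy_space L"
    using Lh Ldiag unfolding inner_product_for_def hermitian_form_def by blast
  then show ?thesis by blast
qed

lemma vdist_hardy:
  "vdist hardy_space u v = sqrt (enn2real (hardy_sq (\<lambda>z. u z - v z)))"
proof -
  have "hardy_sq (\<lambda>z\<in>uhp. u z + (\<lambda>z\<in>uhp. - 1 * v z) z) = hardy_sq (\<lambda>z. u z - v z)"
    by (rule hardy_sq_cong) simp
  then show ?thesis by (simp add: vdist_def)
qed

text \<open>By the point bound a Cauchy sequence converges uniformly on each half-plane \<open>Im z \<ge> y\<close>, so the limit
is holomorphic; Fatou's lemma then turns the Cauchy condition into convergence in norm.\<close>

lemma hardy_norm_complete: "norm_complete hardy_space"
  unfolding norm_complete_def
proof (intro allI impI)
  fix X :: "nat \<Rightarrow> complex \<Rightarrow> complex"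
  assume "range X \<subseteq> vcarrier hardy_space"
    and Cauchy: "\<forall>e>0. \<exists>N. \<forall>m\<ge>N. \<forall>n\<ge>N. vdist hardy_space (X m) (X n) < e"
  then have X: "X n \<in> vcarrier hardy_space" for n by blast
  then have hol: "X n holomorphic_on uhp" and fin: "hardy_sq (X n) < \<infinity>" for n by auto
  have dfin: "hardy_sq (\<lambda>z. X m z - X n z) < \<infinity>" for m n
  proof -
    have "vadd hardy_space (X m) (vscale hardy_space (-1) (X n)) \<in> vcarrier hardy_space"
      by (intro hardy_add_closed hardy_scale_closed X)
    moreover have "hardy_sq (\<lambda>z\<in>uhp. X m z + (\<lambda>z\<in>uhp. - 1 * X n z) z) = hardy_sq (\<lambda>z. X m z - X n z)"
      by (rule hardy_sq_cong) simp
    ultimately show ?thesis by simp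
  qed
  have C: "\<exists>N. \<forall>m\<ge>N. \<forall>n\<ge>N. hardy_sq (\<lambda>z. X m z - X n z) \<le> ennreal (e\<^sup>2)" if e: "0 < e" for e
  proof -
    obtain N where N: "\<And>m n. m \<ge> N \<Longrightarrow> n \<ge> N \<Longrightarrow> vdist hardy_space (X m) (X n) < e"
      using Cauchy e by blast
    have "hardy_sq (\<lambda>z. X m z - X n z) \<le> ennreal (e\<^sup>2)" if "m \<ge> N" "n \<ge> N" for m n
    proof -
      have "enn2real (hardy_sq (\<lambda>z. X m z - X n z)) \<le> e\<^sup>2"
        using N[OF that] e unfolding vdist_hardy by (simp add: sqrt_le_D less_imp_le)
      then show ?thesis
        using dfin[of m n] by (simp add: enn2real_le)
    qed
    then show ?thesis by blast
  qed
  define L where "L = (\<lambda>z\<in>uhp. lim (\<lambda>n. X n z))"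
  have unif: "uniform_limit {z. y \<le> Im z} X (\<lambda>z. lim (\<lambda>n. X n z)) sequentially" if y: "0 < y" for y
    unfolding uniformly_convergent_uniform_limit_iff[symmetric]
  proof (rule Cauchy_uniformly_convergent, rule uniformly_Cauchy_onI)
    fix e :: real assume e: "0 < e"
    \<comment> \<open>The point bound turns a norm distance \<open>d\<close> into a pointwise distance below \<open>e\<close>.\<close>
    define d where "d = e / 2 * sqrt (y / 2)"
    have d: "0 < d" "2 * d\<^sup>2 / y < e\<^sup>2"
      using e y by (auto simp: d_def power_mult_distrib power_divide)
    obtain N where N: "\<And>m n. m \<ge> N \<Longrightarrow> n \<ge> N \<Longrightarrow> hardy_sq (\<lambda>z. X m z - X n z) \<le> ennreal (d\<^sup>2)"
      using C[OF d(1)] by blast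
    have "dist (X m z) (X n z) < e" if z: "z \<in> {z. y \<le> Im z}" and "m \<ge> N" "n \<ge> N" for z m n
    proof -
      have "ennreal (Im z * (cmod (X m z - X n z))\<^sup>2) \<le> 2 * hardy_sq (\<lambda>z. X m z - X n z)"
        using z y by (intro hardy_point_bound holomorphic_intros hol) auto
      also have "\<dots> \<le> 2 * ennreal (d\<^sup>2)" by (intro mult_left_mono N that) auto
      also have "\<dots> = ennreal (2 * d\<^sup>2)" by (simp add: ennreal_mult)
      finally have "Im z * (cmod (X m z - X n z))\<^sup>2 \<le> 2 * d\<^sup>2" by simp
      moreover have "y * (cmod (X m z - X n z))\<^sup>2 \<le> Im z * (cmod (X m z - X n z))\<^sup>2"
        using z by (intro mult_right_mono) auto
      ultimately have "(cmod (X m z - X n z))\<^sup>2 \<le> 2 * d\<^sup>2 / y"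
        using y by (simp add: pos_le_divide_eq mult.commute)
      then have "(cmod (X m z - X n z))\<^sup>2 < e\<^sup>2" using d(2) by linarith
      then show ?thesis using e by (simp add: dist_norm power2_less_imp_less)
    qed
    then show "\<exists>M. \<forall>x\<in>{z. y \<le> Im z}. \<forall>m\<ge>M. \<forall>n\<ge>M. dist (X m x) (X n x) < e" by blast
  qed
  have "(\<lambda>z. lim (\<lambda>n. X n z)) holomorphic_on uhp"
  proof (rule holomorphic_uniform_sequence)
    show "open uhp" using open_halfspace_Im_gt[of 0] by (simp add: uhp_def)
    show "X n holomorphic_on uhp" for n by (rule hol)
    fix z assume "z \<in> uhp"
    then have z: "0 < Im z" by (simp add: uhp_def)
    have sub: "cball z (Im z / 2) \<subseteq> {w. Im z / 2 \<le> Im w}"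
    proof
      fix w assume "w \<in> cball z (Im z / 2)"
      then have "\<bar>Im (z - w)\<bar> \<le> Im z / 2"
        using abs_Im_le_cmod[of "z - w"] by (simp add: dist_norm)
      then show "w \<in> {w. Im z / 2 \<le> Im w}" unfolding mem_Collect_eq minus_complex.sel by linarith
    qed
    then show "\<exists>d>0. cball z d \<subseteq> uhp \<and> uniform_limit (cball z d) X (\<lambda>z. lim (\<lambda>n. X n z)) sequentially"
      using z uniform_limit_on_subset[OF unif[of "Im z / 2"] sub]
      by (intro exI[of _ "Im z / 2"]) (auto simp: uhp_def)
  qed
  then have holL: "L holomorphic_on uhp" by (simp add: L_def)
  have ptw: "(\<lambda>n. X n z) \<longlonglongrightarrow> L z" if "z \<in> uhp" for z
    using tendsto_uniform_limitI[OF unif[of "Im z"], of z] that by (simp add: L_def uhp_def)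
  have close: "\<exists>N. \<forall>n\<ge>N. hardy_sq (\<lambda>z. X n z - L z) \<le> ennreal (e\<^sup>2)" if e: "0 < e" for e
  proof -
    obtain N where N: "\<And>m n. m \<ge> N \<Longrightarrow> n \<ge> N \<Longrightarrow> hardy_sq (\<lambda>z. X m z - X n z) \<le> ennreal (e\<^sup>2)"
      using C[OF e] by blast
    have "hardy_sq (\<lambda>z. X n z - L z) \<le> ennreal (e\<^sup>2)" if n: "n \<ge> N" for n
    proof -
      have "hardy_sq (\<lambda>z. X n z - L z) \<le> liminf (\<lambda>m. hardy_sq (\<lambda>z. X n z - X m z))"
        by (intro hardy_sq_Fatou holomorphic_intros hol tendsto_intros ptw)
      also have "\<dots> \<le> liminf (\<lambda>m::nat. ennreal (e\<^sup>2))"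
        using N[OF n] by (intro Liminf_mono) (auto intro: eventually_sequentiallyI)
      finally show ?thesis by (simp add: Liminf_const)
    qed
    then show ?thesis by blast
  qed
  have LX: "L \<in> vcarrier hardy_space"
  proof -
    obtain N where N: "hardy_sq (\<lambda>z. X N z - L z) \<le> ennreal (1\<^sup>2)"
      using close[of 1] by auto
    have "hardy_sq L = hardy_sq (\<lambda>z. X N z + (-1) * (X N z - L z))"
      by (rule hardy_sq_cong) simp
    also have "\<dots> \<le> 2 * hardy_sq (X N) + 2 * hardy_sq (\<lambda>z. (-1) * (X N z - L z))"
      by (intro hardy_sq_add_le holomorphic_intros hol holL)
    also have "\<dots> = 2 * hardy_sq (X N) + 2 * hardy_sq (\<lambda>z. X N z - L z)"
      by (subst hardy_sq_scale) (auto intro!: holomorphic_intros hol holL)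
    also have "\<dots> < \<infinity>"
      using fin[of N] order_le_less_trans[OF N] by (simp add: ennreal_mult_less_top)
    finally show ?thesis using holL by (simp add: L_def)
  qed
  have "(\<lambda>n. vdist hardy_space (X n) L) \<longlonglongrightarrow> 0"
    unfolding LIMSEQ_def
  proof (intro allI impI)
    fix e :: real assume e: "0 < e"
    obtain N where N: "\<And>n. n \<ge> N \<Longrightarrow> hardy_sq (\<lambda>z. X n z - L z) \<le> ennreal ((e / 2)\<^sup>2)"
      using close[of "e / 2"] e by auto
    have "dist (vdist hardy_space (X n) L) 0 < e" if "n \<ge> N" for n
    proof -
      have "enn2real (hardy_sq (\<lambda>z. X n z - L z)) \<le> (e / 2)\<^sup>2"
        using N[OF that] by (intro enn2real_leI) auto
      then have "vdist hardy_space (X n) L \<le> e / 2"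
        unfolding vdist_hardy using e by (intro real_le_lsqrt) auto
      then show ?thesis using e by (simp add: vdist_hardy dist_norm)
    qed
    then show "\<exists>N. \<forall>n\<ge>N. dist (vdist hardy_space (X n) L) 0 < e" by blast
  qed
  then show "\<exists>l\<in>vcarrier hardy_space. (\<lambda>n. vdist hardy_space (X n) l) \<longlonglongrightarrow> 0"
    using LX by blast
qed

lemma complex_hilbert_space_hardy: "complex_hilbert_space hardy_space"
  unfolding complex_hilbert_space_def
  using complex_vector_space_hardy hardy_inner_product hardy_norm_complete by blast

lemma hardy_parallelogram:
  assumes u: "u \<in> vcarrier hardy_space" and v: "v \<in> vcarrier hardy_space"
  shows "enn2real (hardy_sq (\<lambda>z. u z + v z)) + enn2real (hardy_sq (\<lambda>z. u z - v z))
           = 2 * enn2real (hardy_sq u) + 2 * enn2real (hardy_sq v)"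
proof -
  obtain ip where ip: "inner_product_for hardy_space ip"
    using hardy_inner_product by blast
  then have h: "hermitian_form hardy_space ip"
    unfolding inner_product_for_def hermitian_form_def by blast
  have d: "ip w w = complex_of_real (enn2real (hardy_sq w))" if "w \<in> vcarrier hardy_space" for w
    using ip that unfolding inner_product_for_def by simp
  define s where "s a = vadd hardy_space u (vscale hardy_space a v)" for a
  have s: "s a \<in> vcarrier hardy_space" for a
    unfolding s_def by (intro hardy_add_closed hardy_scale_closed u v)
  have "ip (s 1) (s 1) + ip (s (-1)) (s (-1)) = 2 * ip u u + 2 * ip v v"
    unfolding s_def hermitian_form_diagonal[OF complex_vector_space_hardy h u v] by simp
  moreover have "hardy_sq (s 1) = hardy_sq (\<lambda>z. u z + v z)" "hardy_sq (s (-1)) = hardy_sq (\<lambda>z. u z - v z)"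
    unfolding s_def by (auto intro!: hardy_sq_cong)
  ultimately have "complex_of_real (enn2real (hardy_sq (\<lambda>z. u z + v z)) + enn2real (hardy_sq (\<lambda>z. u z - v z)))
      = complex_of_real (2 * enn2real (hardy_sq u) + 2 * enn2real (hardy_sq v))"
    using d[OF s[of 1]] d[OF s[of "-1"]] d[OF u] d[OF v] by simp
  then show ?thesis by (simp only: of_real_eq_iff)
qed

lemma bounded_displacement_shift_up: "0 \<le> e \<Longrightarrow> bounded_displacement (\<lambda>z. z + \<i> * of_real e)"
  unfolding bounded_displacement_def by (auto intro!: holomorphic_intros exI[of _ e] simp: norm_mult)

text \<open>Let \<open>w\<close> be the upward shift of \<open>u\<close> by a small amount. Then \<open>\<parallel>w\<parallel> \<le> \<parallel>u\<parallel>\<close>, while by Fatou's lemma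
\<open>\<parallel>u + w\<parallel>\<close> cannot drop below \<open>2 \<parallel>u\<parallel>\<close> in the limit. The parallelogram law then forces
\<open>\<parallel>u - w\<parallel>\<close> to vanish in the limit.\<close>

lemma hardy_shift_up_approx:
  assumes u: "u holomorphic_on uhp" and fin: "hardy_sq u < \<infinity>" and \<delta>: "0 < \<delta>"
  shows "\<exists>e>0. hardy_sq (\<lambda>z. u z - u (z + \<i> * of_real e)) < ennreal \<delta>"
proof -
  define d where "d n = 1 / real (Suc n)" for n
  have d: "0 < d n" for n by (simp add: d_def)
  define w where "w n z = u (z + \<i> * of_real (d n))" for n z
  have w: "w n holomorphic_on uhp" "hardy_sq (w n) \<le> hardy_sq u" for n
  proof -
    show "w n holomorphic_on uhp"
      unfolding w_def using d[of n]
      by (intro holomorphic_on_subset[OF holomorphic_on_shift_up[OF u]]) (auto simp: uhp_def intro: less_trans[of _ 0])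
    show "hardy_sq (w n) \<le> hardy_sq u"
      unfolding w_def using d[of n] by (intro hardy_sq_composition_le[OF u fin bounded_displacement_shift_up]) auto
  qed
  obtain q where q: "hardy_sq u = ennreal q" "0 \<le> q" using fin by (cases "hardy_sq u") auto
  have par: "enn2real (hardy_sq (\<lambda>z. u z + w n z)) + enn2real (hardy_sq (\<lambda>z. u z - w n z)) \<le> 4 * q" for n
  proof -
    have e: "hardy_sq (\<lambda>z. restrict u uhp z + restrict (w n) uhp z) = hardy_sq (\<lambda>z. u z + w n z)"
      "hardy_sq (\<lambda>z. restrict u uhp z - restrict (w n) uhp z) = hardy_sq (\<lambda>z. u z - w n z)"
      by (auto intro!: hardy_sq_cong)
    have "restrict u uhp \<in> vcarrier hardy_space" "restrict (w n) uhp \<in> vcarrier hardy_space"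
      using u w[of n] fin by (auto intro: order_le_less_trans)
    from hardy_parallelogram[OF this]
    have "enn2real (hardy_sq (\<lambda>z. u z + w n z)) + enn2real (hardy_sq (\<lambda>z. u z - w n z))
        = 2 * q + 2 * enn2real (hardy_sq (w n))"
      unfolding e using q by simp
    moreover have "enn2real (hardy_sq (w n)) \<le> q"
      using w(2)[of n] q by (intro enn2real_leI) auto
    ultimately show ?thesis by linarith
  qed
  have fins: "hardy_sq (\<lambda>z. u z + w n z) < \<infinity>" "hardy_sq (\<lambda>z. u z - w n z) < \<infinity>" for n
  proof -
    have "hardy_sq (\<lambda>z. u z + a * w n z) < \<infinity>" for a
    proof -
      have "hardy_sq (\<lambda>z. u z + a * w n z) \<le> 2 * hardy_sq u + 2 * hardy_sq (\<lambda>z. a * w n z)"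
        by (intro hardy_sq_add_le holomorphic_intros u w)
      also have "\<dots> < \<infinity>"
        using fin order_le_less_trans[OF w(2) fin]
        by (simp add: hardy_sq_scale w ennreal_mult_less_top)
      finally show ?thesis .
    qed
    from this[of 1] this[of "-1"]
    show "hardy_sq (\<lambda>z. u z + w n z) < \<infinity>" "hardy_sq (\<lambda>z. u z - w n z) < \<infinity>" by simp_all
  qed
  obtain n where n: "4 * q - \<delta> < enn2real (hardy_sq (\<lambda>z. u z + w n z))"
  proof (cases "4 * q - \<delta> < 0")
    case True
    then show ?thesis by (intro that[of 0] less_le_trans[OF _ enn2real_nonneg])
  next
    case False
    have "ennreal (4 * q) = hardy_sq (\<lambda>z. u z + u z)"
      using hardy_sq_scale[OF u, of 2] q by (simp add: ennreal_mult)
    also have "\<dots> \<le> liminf (\<lambda>n. hardy_sq (\<lambda>z. u z + w n z))"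
      unfolding w_def d_def
      by (intro hardy_sq_Fatou holomorphic_intros u w[unfolded w_def d_def] tendsto_intros tendsto_shift_up)
    finally have le: "ennreal (4 * q) \<le> liminf (\<lambda>n. hardy_sq (\<lambda>z. u z + w n z))" .
    have "ennreal (4 * q - \<delta>) < ennreal (4 * q)"
      using False \<delta> by (intro ennreal_lessI) auto
    then have "ennreal (4 * q - \<delta>) < liminf (\<lambda>n. hardy_sq (\<lambda>z. u z + w n z))"
      using le by (rule less_le_trans)
    then obtain n where "ennreal (4 * q - \<delta>) < hardy_sq (\<lambda>z. u z + w n z)"
      using less_LiminfD eventually_happens'[OF sequentially_bot] by blast
    then show ?thesis
      using that[of n] False fins(1)[of n] by (cases "hardy_sq (\<lambda>z. u z + w n z)") (auto simp: ennreal_less_iff)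
  qed
  then have "enn2real (hardy_sq (\<lambda>z. u z - w n z)) < \<delta>" using par[of n] by linarith
  then have "hardy_sq (\<lambda>z. u z - w n z) < ennreal \<delta>"
    using fins(2)[of n] by (cases "hardy_sq (\<lambda>z. u z - w n z)") (auto simp: ennreal_less_iff)
  then show ?thesis
    unfolding w_def using d[of n] by blast
qed

section \<open>Composition operators bounded below along the orbit\<close>

lemma bounded_displacement_iterate:
  assumes "bounded_displacement \<Psi>"
  shows "bounded_displacement (\<Psi> ^^ n)"
proof (induction n)
  case 0
  then show ?case using bounded_displacement_id by (simp add: id_def)
next
  case (Suc n)
  let ?P = "\<Psi> ^^ n"
  have P: "Im z \<le> Im (?P z)" and Q: "Im z \<le> Im (\<Psi> z)" if "0 < Im z" for z
    using bounded_displacementD(2)[OF Suc, of z] bounded_displacementD(2)[OF assms, of z] that by (auto simp: uhp_def)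
  have "(\<lambda>z. \<Psi> (?P z)) holomorphic_on uhp"
    by (rule holomorphic_on_bounded_displacement[OF Suc bounded_displacementD(1)[OF assms]])
  moreover have "Im z \<le> Im (\<Psi> (?P z))" if "z \<in> uhp" for z
    using P[of z] Q[of "?P z"] that by (simp add: uhp_def)
  moreover have "\<exists>K. \<forall>z. y \<le> Im z \<longrightarrow> cmod (\<Psi> (?P z) - z) \<le> K" if y: "0 < y" for y
  proof -
    obtain K1 K2 where K1: "\<And>z. y \<le> Im z \<Longrightarrow> cmod (?P z - z) \<le> K1"
      and K2: "\<And>z. y \<le> Im z \<Longrightarrow> cmod (\<Psi> z - z) \<le> K2"
      using Suc assms y unfolding bounded_displacement_def by metis
    have "cmod (\<Psi> (?P z) - z) \<le> K2 + K1" if z: "y \<le> Im z" for z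
    proof -
      have "y \<le> Im (?P z)" using P[of z] y z by linarith
      then have "cmod (\<Psi> (?P z) - ?P z) + cmod (?P z - z) \<le> K2 + K1"
        using K1[OF z] K2 by (intro add_mono)
      then show ?thesis
        using norm_triangle_ineq[of "\<Psi> (?P z) - ?P z" "?P z - z"] by simp
    qed
    then show ?thesis by blast
  qed
  ultimately show ?case by (simp add: bounded_displacement_def o_def)
qed

lemma composition_operator_linear:
  assumes "bounded_displacement \<Psi>"
  shows "linear_operator hardy_space hardy_space (composition_operator \<Psi>)"
proof -
  note map = bounded_displacementD(3)[OF assms]
  have "composition_operator \<Psi> u \<in> vcarrier hardy_space" if "u \<in> vcarrier hardy_space" for u
  proof -
    have u: "u holomorphic_on uhp" "hardy_sq u < \<infinity>" using that by auto
    have "(\<lambda>z. u (\<Psi> z)) holomorphic_on uhp"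
      by (rule holomorphic_on_bounded_displacement[OF assms u(1)])
    moreover have "hardy_sq (\<lambda>z. u (\<Psi> z)) < \<infinity>"
      by (rule order_le_less_trans[OF hardy_sq_composition_le[OF u assms] u(2)])
    ultimately show ?thesis
      by (simp add: composition_operator_def compose_def o_def)
  qed
  then show ?thesis
    unfolding linear_operator_def
    by (auto simp: composition_operator_def compose_def fun_eq_iff map)
qed

lemma composition_operator_iterate:
  assumes \<Psi>: "\<And>z. z \<in> uhp \<Longrightarrow> \<Psi> z \<in> uhp" and u: "u \<in> extensional uhp"
  shows "(composition_operator \<Psi> ^^ n) u = (\<lambda>z\<in>uhp. u ((\<Psi> ^^ n) z))"
proof (induction n)
  case 0
  then show ?case using u by (auto simp: fun_eq_iff extensional_def)
next
  case (Suc n)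
  then show ?case
    using \<Psi> by (auto simp: composition_operator_def compose_def fun_eq_iff funpow_swap1)
qed

text \<open>A lower bound on vertical shifts is enough, since they approximate every \<open>u\<close> and all operators involved
are contractions. The factor \<open>4\<close> comes from using \<open>\<bar>p + q\<bar>\<^sup>2 \<le> 2 \<bar>p\<bar>\<^sup>2 + 2 \<bar>q\<bar>\<^sup>2\<close> twice.\<close>

lemma similar_to_isometry_composition:
  assumes \<Psi>: "bounded_displacement \<Psi>" and K: "0 \<le> K"
    and below: "\<And>u e n. u holomorphic_on uhp \<Longrightarrow> hardy_sq u < \<infinity> \<Longrightarrow> 0 < e \<Longrightarrow>
       hardy_sq (\<lambda>z. u (z + \<i> * of_real e))
         \<le> ennreal K * hardy_sq (\<lambda>z. u ((\<Psi> ^^ n) z + \<i> * of_real e))"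
  shows "similar_to_isometry hardy_space (composition_operator \<Psi>)"
proof (rule similar_to_isometry_contraction[where C = "sqrt (4 * K)"])
  note map = bounded_displacementD(3)[OF \<Psi>]
  show "complex_hilbert_space hardy_space" by (rule complex_hilbert_space_hardy)
  show "linear_operator hardy_space hardy_space (composition_operator \<Psi>)"
    by (rule composition_operator_linear[OF \<Psi>])
  fix u assume "u \<in> vcarrier hardy_space"
  then have u: "u \<in> extensional uhp" "u holomorphic_on uhp" and fin: "hardy_sq u < \<infinity>" by auto
  have contr: "hardy_sq (\<lambda>z. v ((\<Psi> ^^ n) z)) \<le> hardy_sq v"
    if "v holomorphic_on uhp" "hardy_sq v < \<infinity>" for v n
    using that by (intro hardy_sq_composition_le bounded_displacement_iterate \<Psi>)
  show "vnorm hardy_space (composition_operator \<Psi> u) \<le> vnorm hardy_space u"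
    using contr[OF u(2) fin, of 1] fin
    by (auto simp: composition_operator_def compose_def intro!: enn2real_mono)
  fix n
  note holn = holomorphic_on_bounded_displacement[OF bounded_displacement_iterate[OF \<Psi>, of n]]
  let ?un = "\<lambda>z. u ((\<Psi> ^^ n) z)"
  obtain q where q: "hardy_sq u = ennreal q" "0 \<le> q" using fin by (cases "hardy_sq u") auto
  obtain p where p: "hardy_sq ?un = ennreal p" "0 \<le> p"
    using order_le_less_trans[OF contr[OF u(2) fin, of n] fin] by (cases "hardy_sq ?un") auto
  have "q \<le> 4 * K * p"
  proof (rule field_le_epsilon)
    fix \<epsilon> :: real assume \<epsilon>: "0 < \<epsilon>"
    \<comment> \<open>The errors below add up to \<open>(4 * K + 2) * \<delta>\<close>.\<close>
    define \<delta> where "\<delta> = \<epsilon> / (4 * K + 2)"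
    have \<delta>: "0 < \<delta>" using \<epsilon> K by (simp add: \<delta>_def)
    obtain e where e: "0 < e" and small: "hardy_sq (\<lambda>z. u z - u (z + \<i> * of_real e)) < ennreal \<delta>"
      using hardy_shift_up_approx[OF u(2) fin \<delta>] by blast
    let ?v = "\<lambda>z. u (z + \<i> * of_real e)"
    have v: "?v holomorphic_on uhp"
      using e by (intro holomorphic_on_subset[OF holomorphic_on_shift_up[OF u(2)]]) (auto simp: uhp_def)
    have small': "hardy_sq (\<lambda>z. ?v z - u z) < ennreal \<delta>"
      using small hardy_sq_scale[of "\<lambda>z. u z - ?v z" "-1"] u v by (simp add: holomorphic_intros)
    have vn: "hardy_sq (\<lambda>z. ?v ((\<Psi> ^^ n) z)) \<le> 2 * ennreal p + 2 * ennreal \<delta>"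
    proof -
      have d: "(\<lambda>z. ?v z - u z) holomorphic_on uhp" by (intro holomorphic_intros v u)
      have "hardy_sq (\<lambda>z. ?v ((\<Psi> ^^ n) z)) = hardy_sq (\<lambda>z. ?un z + (?v ((\<Psi> ^^ n) z) - ?un z))" by simp
      also have "\<dots> \<le> 2 * hardy_sq ?un + 2 * hardy_sq (\<lambda>z. ?v ((\<Psi> ^^ n) z) - ?un z)"
        by (intro hardy_sq_add_le holn[OF u(2)] holn[OF d])
      also have "\<dots> \<le> 2 * ennreal p + 2 * ennreal \<delta>"
        unfolding p(1)
        by (intro add_left_mono mult_left_mono order_trans[OF contr[OF d] less_imp_le[OF small']]
            less_trans[OF small']) auto
      finally show ?thesis .
    qed
    have "hardy_sq u = hardy_sq (\<lambda>z. ?v z + (u z - ?v z))" by simp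
    also have "\<dots> \<le> 2 * hardy_sq ?v + 2 * hardy_sq (\<lambda>z. u z - ?v z)"
      by (intro hardy_sq_add_le holomorphic_intros v u)
    also have "\<dots> \<le> 2 * (ennreal K * (2 * ennreal p + 2 * ennreal \<delta>)) + 2 * ennreal \<delta>"
    proof (intro add_mono mult_left_mono)
      show "hardy_sq ?v \<le> ennreal K * (2 * ennreal p + 2 * ennreal \<delta>)"
        by (rule order_trans[OF below[OF u(2) fin e] mult_left_mono[OF vn]]) simp
      show "hardy_sq (\<lambda>z. u z - ?v z) \<le> ennreal \<delta>" by (rule less_imp_le[OF small])
    qed auto
    finally have "ennreal q \<le> 2 * (ennreal K * (2 * ennreal p + 2 * ennreal \<delta>)) + 2 * ennreal \<delta>"
      unfolding q(1) .
    also have "\<dots> = ennreal (2 * (K * (2 * p + 2 * \<delta>)) + 2 * \<delta>)"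
      using K p(2) \<delta> by (simp add: ennreal_mult ennreal_plus)
    finally have "q \<le> 2 * (K * (2 * p + 2 * \<delta>)) + 2 * \<delta>"
      using K p(2) \<delta> by (subst (asm) ennreal_le_iff) auto
    also have "\<dots> = 4 * K * p + (4 * K + 2) * \<delta>" by (simp add: algebra_simps)
    also have "(4 * K + 2) * \<delta> = \<epsilon>" using K by (simp add: \<delta>_def)
    finally show "q \<le> 4 * K * p + \<epsilon>" .
  qed
  then have "sqrt q \<le> sqrt (4 * K) * sqrt p"
    by (simp flip: real_sqrt_mult)
  then show "vnorm hardy_space u \<le> sqrt (4 * K) * vnorm hardy_space ((composition_operator \<Psi> ^^ n) u)"
    using q p by (simp add: composition_operator_iterate[OF map u(1)])
qed

section \<open>A weighted transfer inequality on the real line\<close>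

text \<open>A step of length at least one increases \<open>arctan\<close> by at least a fixed multiple of \<open>1 / (1 + x\<^sup>2)\<close>, the
size of the excess derivative of \<open>\<Phi>\<close>, measured at either end of the step.\<close>

lemma arctan_step:
  fixes x y :: real
  assumes "1 \<le> y - x"
  shows "1 / (3 * (1 + x\<^sup>2)) \<le> arctan y - arctan x"
    and "1 / (3 * (1 + y\<^sup>2)) \<le> arctan y - arctan x"
proof -
  have step: "\<exists>z>l. z < l + 1 \<and> arctan (l + 1) - arctan l = 1 / (1 + z\<^sup>2)" for l :: real
    using MVT2[of l "l + 1" arctan "\<lambda>x. inverse (1 + x\<^sup>2)"] DERIV_arctan
    by (auto simp: inverse_eq_divide)
  have near: "1 / (3 * (1 + p\<^sup>2)) \<le> 1 / (1 + z\<^sup>2)" if "\<bar>z - p\<bar> \<le> 1" for p z :: real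
  proof -
    have "(z - p)\<^sup>2 \<le> 1" using that abs_square_le_1 by blast
    moreover have "z\<^sup>2 \<le> 2 * p\<^sup>2 + 2 * (z - p)\<^sup>2"
      using zero_le_power2[of "z - 2 * p"] by (simp add: power2_eq_square algebra_simps)
    ultimately have "z\<^sup>2 \<le> 2 * p\<^sup>2 + 2 * 1"
      by (meson add_left_mono mult_left_mono order_trans zero_le_numeral)
    also have "\<dots> \<le> 3 * p\<^sup>2 + 2" by simp
    finally have "1 + z\<^sup>2 \<le> 3 * (1 + p\<^sup>2)" by simp
    then show ?thesis by (intro divide_left_mono mult_pos_pos) (auto intro: add_pos_nonneg)
  qed
  \<comment> \<open>The rest of the step, beyond length one, only helps, by monotonicity.\<close>
  obtain z where "x < z" "z < x + 1" "arctan (x + 1) - arctan x = 1 / (1 + z\<^sup>2)"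
    using step[of x] by auto
  moreover have "arctan (x + 1) \<le> arctan y" using assms by (simp add: arctan_le_iff)
  ultimately show "1 / (3 * (1 + x\<^sup>2)) \<le> arctan y - arctan x"
    using near[of z x] by simp
  obtain z' where "y - 1 < z'" "z' < y" "arctan y - arctan (y - 1) = 1 / (1 + z'\<^sup>2)"
    using step[of "y - 1"] by auto
  moreover have "arctan x \<le> arctan (y - 1)" using assms by (simp add: arctan_le_iff)
  ultimately show "1 / (3 * (1 + y\<^sup>2)) \<le> arctan y - arctan x"
    using near[of z' y] by simp
qed

text \<open>The images of the two half-lines together cover the line, by \<open>overlap\<close> and \<open>near_id\<close>. The condition \<open>w_super\<close> says that \<open>\<phi>\<close> pushes the measure \<open>w dx\<close>,
restricted to either branch, to a measure that dominates \<open>w dx\<close> on the image. Between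
\<open>a\<close> and \<open>b\<close>, where the boundary values of \<open>\<Phi>\<close> leave the real line, no orbit is followed.\<close>

locale two_branch_map =
  fixes a b D :: real and \<phi> \<phi>' w :: "real \<Rightarrow> real"
  assumes ab: "a < b"
    and \<phi>_measurable [measurable]: "\<phi> \<in> borel_measurable borel"
    and \<phi>_deriv: "\<And>x. x \<le> a \<or> b \<le> x \<Longrightarrow> (\<phi> has_real_derivative \<phi>' x) (at x)"
    and \<phi>'_cont: "continuous_on ({..a} \<union> {b..}) \<phi>'"
    and \<phi>'_nonneg: "\<And>x. x \<le> a \<or> b \<le> x \<Longrightarrow> 0 \<le> \<phi>' x"
    and near_id: "\<And>x. x \<le> a \<or> b \<le> x \<Longrightarrow> \<bar>\<phi> x - x\<bar> \<le> D"
    and overlap: "\<phi> b \<le> \<phi> a"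
    and w_measurable [measurable]: "w \<in> borel_measurable borel"
    and w_nonneg: "\<And>x. 0 \<le> w x"
    and w_super: "\<And>x. x \<le> a \<or> b \<le> x \<Longrightarrow> w (\<phi> x) * \<phi>' x \<le> w x"
begin

definition branches :: "real set" where
  "branches = {..a} \<union> {b..}"

lemma branches_measurable [measurable]: "branches \<in> sets borel"
  unfolding branches_def by simp

lemma transfer_interval:
  assumes [measurable]: "F \<in> borel_measurable borel" and F: "\<And>y. 0 \<le> F y"
    and xy: "x \<le> y" and sub: "{x..y} \<subseteq> branches"
  shows "(\<integral>\<^sup>+t. ennreal (F t * w t) * indicator {\<phi> x..\<phi> y} t \<partial>lborel)
           \<le> (\<integral>\<^sup>+t. ennreal (F (\<phi> t) * w t) * indicator {x..y} t \<partial>lborel)"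
proof -
  have br: "t \<le> a \<or> b \<le> t" if "t \<in> {x..y}" for t
    using sub that by (auto simp: branches_def)
  have "(\<integral>\<^sup>+t. ennreal (F t * w t) * indicator {\<phi> x..\<phi> y} t \<partial>lborel)
      = (\<integral>\<^sup>+t. ennreal (F t * w t * indicator {\<phi> x..\<phi> y} t) \<partial>lborel)"
    by (intro nn_integral_cong) (auto simp: indicator_def)
  also have "\<dots> = (\<integral>\<^sup>+t. ennreal (F (\<phi> t) * w (\<phi> t) * \<phi>' t * indicator {x..y} t) \<partial>lborel)"
  proof (rule nn_integral_substitution)
    show "set_borel_measurable borel {\<phi> x..\<phi> y} (\<lambda>t. F t * w t)"
      unfolding set_borel_measurable_def by measurable
    show "continuous_on {x..y} \<phi>'"
      using \<phi>'_cont sub unfolding branches_def by (rule continuous_on_subset)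
  qed (use br \<phi>_deriv \<phi>'_nonneg xy in blast)+
  also have "\<dots> \<le> (\<integral>\<^sup>+t. ennreal (F (\<phi> t) * w t) * indicator {x..y} t \<partial>lborel)"
  proof (intro nn_integral_mono)
    fix t
    have "F (\<phi> t) * w (\<phi> t) * \<phi>' t \<le> F (\<phi> t) * w t" if "t \<in> {x..y}"
      using mult_left_mono[OF w_super[OF br[OF that]] F[of "\<phi> t"]] by (simp add: mult.assoc)
    then show "ennreal (F (\<phi> t) * w (\<phi> t) * \<phi>' t * indicator {x..y} t) \<le> ennreal (F (\<phi> t) * w t) * indicator {x..y} t"
      by (auto simp: indicator_def intro: ennreal_leI)
  qed
  finally show ?thesis .
qed

text \<open>Exhaust the two half-lines by compact intervals, whose images increase to a covering of the line, and apply
\<open>transfer_interval\<close> to each.\<close>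

lemma transfer_step:
  assumes [measurable]: "F \<in> borel_measurable borel" and F: "\<And>y. 0 \<le> F y"
  shows "(\<integral>\<^sup>+y. ennreal (F y * w y) \<partial>lborel)
           \<le> (\<integral>\<^sup>+x. ennreal (indicator branches x * F (\<phi> x) * w x) \<partial>lborel)"
proof -
  let ?L = "\<lambda>n. {\<phi> (a - real n)..\<phi> a}" and ?R = "\<lambda>n. {\<phi> b..\<phi> (b + real n)}"
  let ?g = "\<lambda>n y. ennreal (F y * w y) * indicator (?L n) y + ennreal (F y * w y) * indicator (?R n) y"
  have "(\<integral>\<^sup>+y. ennreal (F y * w y) \<partial>lborel) \<le> (\<integral>\<^sup>+y. liminf (\<lambda>n. ?g n y) \<partial>lborel)"
  proof (intro nn_integral_mono Liminf_bounded)
    fix y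
    \<comment> \<open>For \<open>n \<ge> N\<close> the point \<open>y\<close> lies between the images of the outer end points, so one of the two intervals catches it.\<close>
    obtain N where N: "\<bar>y\<bar> + \<bar>a\<bar> + \<bar>b\<bar> + D \<le> real N" using real_arch_simple by blast
    show "\<forall>\<^sub>F n in sequentially. ennreal (F y * w y) \<le> ?g n y"
    proof (intro eventually_sequentiallyI[of N])
      fix n assume "N \<le> n"
      then have n: "\<bar>y\<bar> + \<bar>a\<bar> + \<bar>b\<bar> + D \<le> real n" using N by linarith
      have "\<phi> (a - real n) \<le> y" "y \<le> \<phi> (b + real n)"
        using near_id[of "a - real n"] near_id[of "b + real n"] n by linarith+
      then have "y \<in> ?L n \<or> y \<in> ?R n" using overlap by auto
      then show "ennreal (F y * w y) \<le> ?g n y" by (auto simp: indicator_def)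
    qed
  qed
  also have "\<dots> \<le> liminf (\<lambda>n. \<integral>\<^sup>+y. ?g n y \<partial>lborel)"
    by (intro nn_integral_liminf) measurable
  also have "\<dots> \<le> liminf (\<lambda>n::nat. \<integral>\<^sup>+x. ennreal (indicator branches x * F (\<phi> x) * w x) \<partial>lborel)"
  proof (intro Liminf_mono always_eventually allI)
    fix n :: nat
    have "(\<integral>\<^sup>+y. ?g n y \<partial>lborel)
        = (\<integral>\<^sup>+y. ennreal (F y * w y) * indicator (?L n) y \<partial>lborel) + (\<integral>\<^sup>+y. ennreal (F y * w y) * indicator (?R n) y \<partial>lborel)"
      by (intro nn_integral_add) measurable
    also have "\<dots> \<le> (\<integral>\<^sup>+t. ennreal (F (\<phi> t) * w t) * indicator {a - real n..a} t \<partial>lborel)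
        + (\<integral>\<^sup>+t. ennreal (F (\<phi> t) * w t) * indicator {b..b + real n} t \<partial>lborel)"
      by (intro add_mono transfer_interval F) (auto simp: branches_def)
    also have "\<dots> = (\<integral>\<^sup>+t. ennreal (F (\<phi> t) * w t) * indicator {a - real n..a} t
        + ennreal (F (\<phi> t) * w t) * indicator {b..b + real n} t \<partial>lborel)"
      by (intro nn_integral_add[symmetric]) measurable
    also have "\<dots> \<le> (\<integral>\<^sup>+x. ennreal (indicator branches x * F (\<phi> x) * w x) \<partial>lborel)"
      using ab by (intro nn_integral_mono) (auto simp: indicator_def branches_def)
    finally show "(\<integral>\<^sup>+y. ?g n y \<partial>lborel) \<le> (\<integral>\<^sup>+x. ennreal (indicator branches x * F (\<phi> x) * w x) \<partial>lborel)" .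
  qed
  also have "\<dots> = (\<integral>\<^sup>+x. ennreal (indicator branches x * F (\<phi> x) * w x) \<partial>lborel)"
    by (simp add: Liminf_const)
  finally show ?thesis .
qed

text \<open>Only orbits along the branches are controlled. When \<open>\<phi>\<close> is the boundary map of \<open>\<Phi>\<close>, it is at these
points that the \<open>n\<close>-th iterate of \<open>\<Phi>\<close> is known to extend continuously to the real line.\<close>

definition staying :: "nat \<Rightarrow> real set" where
  "staying n = {x. \<forall>k<n. (\<phi> ^^ k) x \<in> branches}"

lemma iterate_measurable [measurable]: "\<phi> ^^ n \<in> borel_measurable borel"
  by (induction n) (auto intro: measurable_comp)

lemma transfer_iterate:
  assumes "F \<in> borel_measurable borel" and "\<And>y. 0 \<le> F y"
  shows "(\<integral>\<^sup>+y. ennreal (F y * w y) \<partial>lborel)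
           \<le> (\<integral>\<^sup>+x. ennreal (indicator (staying n) x * F ((\<phi> ^^ n) x) * w x) \<partial>lborel)"
  using assms
proof (induction n arbitrary: F)
  case 0
  then show ?case by (simp add: staying_def)
next
  case (Suc n)
  note [measurable] = Suc.prems(1)
  let ?F = "\<lambda>x. indicator branches x * F (\<phi> x)"
  have "(\<integral>\<^sup>+y. ennreal (F y * w y) \<partial>lborel) \<le> (\<integral>\<^sup>+x. ennreal (?F x * w x) \<partial>lborel)"
    by (rule transfer_step[OF Suc.prems])
  also have "\<dots> \<le> (\<integral>\<^sup>+x. ennreal (indicator (staying n) x * ?F ((\<phi> ^^ n) x) * w x) \<partial>lborel)"
    by (rule Suc.IH) (use Suc.prems in auto)
  also have "\<dots> = (\<integral>\<^sup>+x. ennreal (indicator (staying (Suc n)) x * F ((\<phi> ^^ Suc n) x) * w x) \<partial>lborel)"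
    by (intro nn_integral_cong) (auto simp: indicator_def staying_def less_Suc_eq)
  finally show ?case .
qed

lemma transfer_iterate_unweighted:
  assumes [measurable]: "F \<in> borel_measurable borel" and F: "\<And>y. 0 \<le> F y"
    and m: "0 < m" "\<And>x. m \<le> w x" "\<And>x. w x \<le> M"
  shows "(\<integral>\<^sup>+y. ennreal (F y) \<partial>lborel)
           \<le> ennreal (M / m) * (\<integral>\<^sup>+x. ennreal (indicator (staying n) x * F ((\<phi> ^^ n) x)) \<partial>lborel)"
proof -
  have [measurable]: "staying n \<in> sets borel"
    unfolding staying_def by measurable
  have M: "0 \<le> M" using m by (meson less_imp_le order_trans)
  have "(\<integral>\<^sup>+y. ennreal (F y) \<partial>lborel) \<le> (\<integral>\<^sup>+y. ennreal (1 / m) * ennreal (F y * w y) \<partial>lborel)"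
  proof (intro nn_integral_mono)
    fix y
    have "F y * m \<le> F y * w y" by (intro mult_left_mono m F)
    then have "F y \<le> 1 / m * (F y * w y)" using m(1) by (simp add: field_simps)
    then show "ennreal (F y) \<le> ennreal (1 / m) * ennreal (F y * w y)"
      using m(1) by (simp add: ennreal_mult'[symmetric] ennreal_leI)
  qed
  also have "\<dots> = ennreal (1 / m) * (\<integral>\<^sup>+y. ennreal (F y * w y) \<partial>lborel)"
    by (intro nn_integral_cmult) measurable
  also have "\<dots> \<le> ennreal (1 / m) * (\<integral>\<^sup>+x. ennreal (indicator (staying n) x * F ((\<phi> ^^ n) x) * w x) \<partial>lborel)"
    by (intro mult_left_mono transfer_iterate F) auto
  also have "\<dots> \<le> ennreal (1 / m) * (\<integral>\<^sup>+x. ennreal M * ennreal (indicator (staying n) x * F ((\<phi> ^^ n) x)) \<partial>lborel)"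
  proof (intro mult_left_mono nn_integral_mono)
    fix x
    have "0 \<le> indicator (staying n) x * F ((\<phi> ^^ n) x)" using F by simp
    then have "indicator (staying n) x * F ((\<phi> ^^ n) x) * w x \<le> M * (indicator (staying n) x * F ((\<phi> ^^ n) x))"
      using m(3)[of x] by (subst mult.commute) (intro mult_right_mono)
    then show "ennreal (indicator (staying n) x * F ((\<phi> ^^ n) x) * w x) \<le> ennreal M * ennreal (indicator (staying n) x * F ((\<phi> ^^ n) x))"
      using M by (simp add: ennreal_mult'[symmetric] ennreal_leI)
  qed auto
  also have "\<dots> = ennreal (1 / m) * (ennreal M * (\<integral>\<^sup>+x. ennreal (indicator (staying n) x * F ((\<phi> ^^ n) x)) \<partial>lborel))"
    by (subst nn_integral_cmult) auto
  also have "\<dots> = ennreal (M / m) * (\<integral>\<^sup>+x. ennreal (indicator (staying n) x * F ((\<phi> ^^ n) x)) \<partial>lborel)"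
  proof -
    have "ennreal (1 / m) * ennreal M = ennreal (M / m)"
      using m(1) M by (subst ennreal_mult'[symmetric]) auto
    then show ?thesis by (simp add: mult.assoc[symmetric])
  qed
  finally show ?thesis .
qed

end


section \<open>The Nevanlinna function of a compactly supported measure\<close>

text \<open>In \<open>Phi\<close> the integrand equals \<open>(1 + t\<^sup>2) / (t - z) - t\<close>. Hence \<open>\<Phi>\<close> is a translation plus the
Cauchy transform of the finite measure \<open>(1 + t\<^sup>2) \<rho>\<close>, which is small near infinity.\<close>

locale compactly_supported = finite_measure \<rho> for \<rho> :: "real measure" +
  fixes c d :: real
  assumes sets_\<rho> [measurable_cong]: "sets \<rho> = sets borel"
    and support: "AE t in \<rho>. t \<in> {c..d}"
begin

definition off_support :: "complex set" where
  "off_support = - (of_real ` {c..d})"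

definition sigma_mass :: real where
  "sigma_mass = (LINT t|\<rho>. 1 + t\<^sup>2)"

definition cauchy_sigma :: "complex \<Rightarrow> complex" where
  "cauchy_sigma z = (LINT t|\<rho>. of_real (1 + t\<^sup>2) / (of_real t - z))"

lemma open_off_support: "open off_support"
proof -
  have "compact (of_real ` {c..d} :: complex set)"
    by (intro compact_continuous_image continuous_intros) auto
  then show ?thesis
    unfolding off_support_def by (simp add: compact_imp_closed open_Compl)
qed

lemma uhp_off_support: "uhp \<subseteq> off_support"
  by (auto simp: uhp_def off_support_def)

lemma of_real_off_support: "of_real x \<in> off_support \<longleftrightarrow> x \<notin> {c..d}"
  by (auto simp: off_support_def)

lemma off_support_gap:
  assumes "z \<in> off_support"
  obtains \<delta> where "0 < \<delta>" and "\<And>t. t \<in> {c..d} \<Longrightarrow> \<delta> \<le> cmod (of_real t - z)"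
proof -
  obtain \<delta> where \<delta>: "0 < \<delta>" "ball z \<delta> \<subseteq> off_support"
    using open_off_support assms open_contains_ball by blast
  have "\<delta> \<le> cmod (of_real t - z)" if t: "t \<in> {c..d}" for t
  proof (rule ccontr)
    assume "\<not> \<delta> \<le> cmod (of_real t - z)"
    then have "of_real t \<in> ball z \<delta>" by (simp add: dist_norm norm_minus_commute)
    then show False using \<delta>(2) t by (auto simp: off_support_def)
  qed
  then show ?thesis using that \<delta>(1) by blast
qed

lemma integrable_bounded_on_support:
  fixes f :: "real \<Rightarrow> 'b::{banach, second_countable_topology}"
  assumes [measurable]: "f \<in> borel_measurable borel"
    and le: "\<And>t. t \<in> {c..d} \<Longrightarrow> norm (f t) \<le> B"
  shows "integrable \<rho> f"
proof (rule integrable_const_bound)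
  show "AE t in \<rho>. norm (f t) \<le> B" using support by eventually_elim (rule le)
qed measurable

lemma integrable_continuous_on_support:
  fixes f :: "real \<Rightarrow> real"
  assumes "continuous_on UNIV f"
  shows "integrable \<rho> f"
proof -
  have "bounded (f ` {c..d})"
    by (intro compact_imp_bounded compact_continuous_image continuous_on_subset[OF assms]) auto
  then obtain B where "\<forall>x\<in>f ` {c..d}. norm x \<le> B" unfolding bounded_iff by blast
  then show ?thesis
    by (intro integrable_bounded_on_support[where B = B] borel_measurable_continuous_onI assms) auto
qed

lemma integrable_sigma: "integrable \<rho> (\<lambda>t. 1 + t\<^sup>2)"
  by (intro integrable_continuous_on_support continuous_intros)

lemma sigma_mass_nonneg: "0 \<le> sigma_mass"
  unfolding sigma_mass_def by (intro integral_nonneg_AE) (auto intro: add_nonneg_nonneg)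

text \<open>All estimates of the Cauchy transform and of its derivative are instances of this one, with \<open>g\<close> a power
of \<open>1 / (t - z)\<close> bounded on the support.\<close>

lemma integral_sigma_le:
  fixes g :: "real \<Rightarrow> complex"
  assumes [measurable]: "g \<in> borel_measurable borel"
    and le: "\<And>t. t \<in> {c..d} \<Longrightarrow> cmod (g t) \<le> B"
  shows "integrable \<rho> (\<lambda>t. of_real (1 + t\<^sup>2) * g t)"
    and "cmod (LINT t|\<rho>. of_real (1 + t\<^sup>2) * g t) \<le> sigma_mass * B"
proof -
  have n: "norm (of_real (1 + t\<^sup>2) * g t) \<le> norm ((1 + t\<^sup>2) * B)" if "t \<in> {c..d}" for t
  proof -
    have "norm (of_real (1 + t\<^sup>2) * g t) = (1 + t\<^sup>2) * cmod (g t)"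
      by (simp only: norm_mult norm_of_real) simp
    also have "\<dots> \<le> (1 + t\<^sup>2) * B" using le[OF that] by (intro mult_left_mono) auto
    also have "\<dots> \<le> norm ((1 + t\<^sup>2) * B)" by simp
    finally show ?thesis .
  qed
  show int: "integrable \<rho> (\<lambda>t. of_real (1 + t\<^sup>2) * g t)"
  proof (rule Bochner_Integration.integrable_bound)
    show "integrable \<rho> (\<lambda>t. (1 + t\<^sup>2) * B)" using integrable_sigma by (rule integrable_mult_left)
    show "AE t in \<rho>. norm (of_real (1 + t\<^sup>2) * g t) \<le> norm ((1 + t\<^sup>2) * B)"
      using support by eventually_elim (rule n)
  qed measurable
  have "cmod (LINT t|\<rho>. of_real (1 + t\<^sup>2) * g t) \<le> (LINT t|\<rho>. cmod (of_real (1 + t\<^sup>2) * g t))"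
    by (rule integral_norm_bound)
  also have "\<dots> \<le> (LINT t|\<rho>. (1 + t\<^sup>2) * B)"
  proof (rule integral_mono_AE)
    show "integrable \<rho> (\<lambda>t. cmod (of_real (1 + t\<^sup>2) * g t))" using int by (rule integrable_norm)
    show "integrable \<rho> (\<lambda>t. (1 + t\<^sup>2) * B)" using integrable_sigma by (rule integrable_mult_left)
    show "AE t in \<rho>. cmod (of_real (1 + t\<^sup>2) * g t) \<le> (1 + t\<^sup>2) * B"
      using support
    proof eventually_elim
      fix t assume t: "t \<in> {c..d}"
      have "norm (of_real (1 + t\<^sup>2) * g t) = (1 + t\<^sup>2) * cmod (g t)"
        by (simp only: norm_mult norm_of_real) simp
      then show "cmod (of_real (1 + t\<^sup>2) * g t) \<le> (1 + t\<^sup>2) * B"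
        using le[OF t] by (simp add: mult_left_mono)
    qed
  qed
  also have "\<dots> = sigma_mass * B" unfolding sigma_mass_def by simp
  finally show "cmod (LINT t|\<rho>. of_real (1 + t\<^sup>2) * g t) \<le> sigma_mass * B" .
qed

lemma cauchy_sigma_bound:
  assumes "0 < \<delta>" and gap: "\<And>t. t \<in> {c..d} \<Longrightarrow> \<delta> \<le> cmod (of_real t - z)"
  shows "integrable \<rho> (\<lambda>t. of_real (1 + t\<^sup>2) / (of_real t - z))"
    and "cmod (cauchy_sigma z) \<le> sigma_mass / \<delta>"
proof -
  have m: "(\<lambda>t. inverse (of_real t - z)) \<in> borel_measurable borel" by measurable
  have le: "cmod (inverse (of_real t - z)) \<le> inverse \<delta>" if "t \<in> {c..d}" for t
    using gap[OF that] \<open>0 < \<delta>\<close> by (simp add: norm_inverse le_imp_inverse_le)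
  show "integrable \<rho> (\<lambda>t. of_real (1 + t\<^sup>2) / (of_real t - z))"
    unfolding divide_inverse by (rule integral_sigma_le(1)[OF m le])
  show "cmod (cauchy_sigma z) \<le> sigma_mass / \<delta>"
    unfolding cauchy_sigma_def divide_inverse by (rule integral_sigma_le(2)[OF m le])
qed

lemma Phi_eq_cauchy_sigma:
  assumes "z \<in> off_support"
  shows "Phi \<rho> \<alpha> z = of_real (\<alpha> - (LINT t|\<rho>. t)) + z + cauchy_sigma z"
proof -
  obtain \<delta> where \<delta>: "0 < \<delta>" "\<And>t. t \<in> {c..d} \<Longrightarrow> \<delta> \<le> cmod (of_real t - z)"
    using off_support_gap[OF assms] by blast
  have "(LINT t|\<rho>. (1 + of_real t * z) / (of_real t - z))
      = (LINT t|\<rho>. of_real (1 + t\<^sup>2) / (of_real t - z) - of_real t)"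
  proof (rule integral_cong_AE)
    show "AE t in \<rho>. (1 + of_real t * z) / (of_real t - z) = of_real (1 + t\<^sup>2) / (of_real t - z) - of_real t"
      using support
    proof eventually_elim
      fix t assume "t \<in> {c..d}"
      then have "of_real t - z \<noteq> 0" using \<delta> by fastforce
      then show "(1 + of_real t * z) / (of_real t - z) = of_real (1 + t\<^sup>2) / (of_real t - z) - of_real t"
        by (simp add: field_simps power2_eq_square)
    qed
  qed measurable
  also have "\<dots> = cauchy_sigma z - of_real (LINT t|\<rho>. t)"
    unfolding cauchy_sigma_def
    using Bochner_Integration.integral_diff[OF cauchy_sigma_bound(1)[OF \<delta>]
        integrable_of_real[OF integrable_continuous_on_support[OF continuous_on_id]]]
    by (simp only: integral_complex_of_real)
  finally show ?thesis by (simp add: Phi_def)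
qed

definition cauchy_sigma_deriv :: "complex \<Rightarrow> complex" where
  "cauchy_sigma_deriv z = (LINT t|\<rho>. of_real (1 + t\<^sup>2) * inverse ((of_real t - z)\<^sup>2))"

text \<open>The remainder of the difference quotient is \<open>w - z\<close> times the integral of
\<open>(1 + t\<^sup>2) / ((t - w) (t - z)\<^sup>2)\<close>, which stays bounded as \<open>w\<close> tends to \<open>z\<close>.\<close>

lemma cauchy_sigma_has_derivative:
  assumes z: "z \<in> off_support"
  shows "(cauchy_sigma has_field_derivative cauchy_sigma_deriv z) (at z)"
proof -
  obtain \<delta> where \<delta>: "0 < \<delta>" and gap: "\<And>t. t \<in> {c..d} \<Longrightarrow> \<delta> \<le> cmod (of_real t - z)"
    using off_support_gap[OF z] by blast
  let ?q = "\<lambda>w. (cauchy_sigma w - cauchy_sigma z) / (w - z)"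
  let ?r = "\<lambda>w t. inverse ((of_real t - w) * (of_real t - z)\<^sup>2)"
  have "\<forall>\<^sub>F w in at z. cmod (?q w - cauchy_sigma_deriv z) \<le> cmod (w - z) * (sigma_mass * inverse (\<delta> / 2 * \<delta>\<^sup>2))"
  proof (unfold eventually_at, intro exI[of _ "\<delta> / 2"] conjI ballI impI)
    show "0 < \<delta> / 2" using \<delta> by simp
    fix w assume w: "w \<noteq> z \<and> dist w z < \<delta> / 2"
    have gw: "\<delta> / 2 \<le> cmod (of_real t - w)" if t: "t \<in> {c..d}" for t
      using gap[OF t] w norm_triangle_ineq[of "of_real t - w" "w - z"] by (simp add: dist_norm)
    have \<delta>2: "0 < \<delta> / 2" using \<delta> by simp
    have m: "(\<lambda>t. inverse (of_real t - w)) \<in> borel_measurable borel"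
      "(\<lambda>t. inverse ((of_real t - z)\<^sup>2)) \<in> borel_measurable borel" "?r w \<in> borel_measurable borel"
      by measurable
    have le2: "cmod (inverse ((of_real t - z)\<^sup>2)) \<le> inverse (\<delta>\<^sup>2)" if "t \<in> {c..d}" for t
      using gap[OF that] \<delta> by (simp add: norm_inverse norm_power le_imp_inverse_le power_mono)
    have le3: "cmod (?r w t) \<le> inverse (\<delta> / 2 * \<delta>\<^sup>2)" if "t \<in> {c..d}" for t
    proof -
      have "\<delta> / 2 * \<delta>\<^sup>2 \<le> cmod ((of_real t - w) * (of_real t - z)\<^sup>2)"
        unfolding norm_mult norm_power using gap[OF that] gw[OF that] \<delta>
        by (intro mult_mono power_mono) auto
      then show ?thesis
        unfolding norm_inverse using \<delta> by (intro le_imp_inverse_le) auto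
    qed
    note i = cauchy_sigma_bound(1)[OF \<delta>2 gw] cauchy_sigma_bound(1)[OF \<delta> gap]
      integral_sigma_le(1)[OF m(2) le2] integral_sigma_le(1)[OF m(3) le3]
    have "cauchy_sigma w - cauchy_sigma z - (w - z) * cauchy_sigma_deriv z
        = (LINT t|\<rho>. of_real (1 + t\<^sup>2) / (of_real t - w) - of_real (1 + t\<^sup>2) / (of_real t - z)
            - (w - z) * (of_real (1 + t\<^sup>2) * inverse ((of_real t - z)\<^sup>2)))"
      unfolding cauchy_sigma_def cauchy_sigma_deriv_def
      using i by (simp add: Bochner_Integration.integral_diff integrable_mult_right Bochner_Integration.integrable_diff
          del: of_real_add of_real_power)
    also have "\<dots> = (LINT t|\<rho>. (w - z)\<^sup>2 * (of_real (1 + t\<^sup>2) * ?r w t))"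
    proof (rule integral_cong_AE)
      show "AE t in \<rho>. of_real (1 + t\<^sup>2) / (of_real t - w) - of_real (1 + t\<^sup>2) / (of_real t - z)
            - (w - z) * (of_real (1 + t\<^sup>2) * inverse ((of_real t - z)\<^sup>2)) = (w - z)\<^sup>2 * (of_real (1 + t\<^sup>2) * ?r w t)"
        using support
      proof eventually_elim
        fix t assume t: "t \<in> {c..d}"
        have "of_real t - z \<noteq> 0" "of_real t - w \<noteq> 0" using gap[OF t] gw[OF t] \<delta> by fastforce+
        moreover have "s / a - s / b - (b - a) * (s * inverse (b\<^sup>2)) = (b - a)\<^sup>2 * (s * inverse (a * b\<^sup>2))"
          if "a \<noteq> 0" "b \<noteq> 0" for a b s :: complex
          using that by (simp add: field_simps power2_eq_square)
        moreover have ba: "w - z = (of_real t - z) - (of_real t - w)" by simp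
        ultimately show "of_real (1 + t\<^sup>2) / (of_real t - w) - of_real (1 + t\<^sup>2) / (of_real t - z)
            - (w - z) * (of_real (1 + t\<^sup>2) * inverse ((of_real t - z)\<^sup>2)) = (w - z)\<^sup>2 * (of_real (1 + t\<^sup>2) * ?r w t)"
          unfolding ba by blast
      qed
    qed measurable
    also have "\<dots> = (w - z)\<^sup>2 * (LINT t|\<rho>. of_real (1 + t\<^sup>2) * ?r w t)" by simp
    finally have eq: "cauchy_sigma w - cauchy_sigma z - (w - z) * cauchy_sigma_deriv z
        = (w - z)\<^sup>2 * (LINT t|\<rho>. of_real (1 + t\<^sup>2) * ?r w t)" .
    have "?q w - cauchy_sigma_deriv z = (cauchy_sigma w - cauchy_sigma z - (w - z) * cauchy_sigma_deriv z) / (w - z)"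
      using w by (simp add: field_simps)
    also have "\<dots> = (w - z) * (LINT t|\<rho>. of_real (1 + t\<^sup>2) * ?r w t)"
      unfolding eq using w by (simp add: power2_eq_square)
    finally show "cmod (?q w - cauchy_sigma_deriv z) \<le> cmod (w - z) * (sigma_mass * inverse (\<delta> / 2 * \<delta>\<^sup>2))"
      using integral_sigma_le(2)[OF m(3) le3] by (simp only: norm_mult mult_left_mono norm_ge_zero)
  qed
  moreover have "((\<lambda>w. cmod (w - z) * k) \<longlongrightarrow> 0) (at z)" for k :: real
  proof -
    have "((\<lambda>w. cmod (w - z) * k) \<longlongrightarrow> cmod (z - z) * k) (at z)" by (intro tendsto_intros)
    then show ?thesis by simp
  qed
  ultimately have "((\<lambda>w. ?q w - cauchy_sigma_deriv z) \<longlongrightarrow> 0) (at z)"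
    by (rule Lim_null_comparison)
  then show ?thesis
    unfolding has_field_derivative_iff using LIM_zero_iff by blast
qed

lemma Phi_has_derivative:
  assumes z: "z \<in> off_support"
  shows "(Phi \<rho> \<alpha> has_field_derivative 1 + cauchy_sigma_deriv z) (at z)"
proof -
  have "((\<lambda>z. of_real (\<alpha> - (LINT t|\<rho>. t)) + z + cauchy_sigma z) has_field_derivative 0 + 1 + cauchy_sigma_deriv z) (at z)"
    by (intro derivative_intros cauchy_sigma_has_derivative z)
  then have "((\<lambda>z. of_real (\<alpha> - (LINT t|\<rho>. t)) + z + cauchy_sigma z) has_field_derivative 1 + cauchy_sigma_deriv z) (at z)"
    by simp
  then show ?thesis
    by (rule has_field_derivative_transform_within_open[OF _ open_off_support z])
      (simp add: Phi_eq_cauchy_sigma)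
qed

lemma Phi_holomorphic: "Phi \<rho> \<alpha> holomorphic_on off_support"
  using Phi_has_derivative open_off_support by (auto simp: holomorphic_on_open)

lemma continuous_on_cauchy_sigma_deriv: "continuous_on off_support cauchy_sigma_deriv"
proof -
  have "cauchy_sigma holomorphic_on off_support"
    using cauchy_sigma_has_derivative open_off_support by (auto simp: holomorphic_on_open)
  then have "deriv cauchy_sigma holomorphic_on off_support"
    using open_off_support by (rule holomorphic_deriv)
  moreover have "deriv cauchy_sigma z = cauchy_sigma_deriv z" if "z \<in> off_support" for z
    using cauchy_sigma_has_derivative[OF that] by (rule DERIV_imp_deriv)
  ultimately show ?thesis
    using holomorphic_on_imp_continuous_on continuous_on_cong by metis
qed

lemma uhp_gap:
  assumes "0 < Im z"
  shows "Im z \<le> cmod (of_real t - z)"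
  using abs_Im_le_cmod[of "of_real t - z"] assms by simp

lemma bounded_displacement_Phi: "bounded_displacement (Phi \<rho> \<alpha>)"
  unfolding bounded_displacement_def
proof (intro conjI ballI allI impI)
  show "Phi \<rho> \<alpha> holomorphic_on uhp"
    by (rule holomorphic_on_subset[OF Phi_holomorphic uhp_off_support])
next
  fix z assume z: "z \<in> uhp"
  then have pos: "0 < Im z" by (simp add: uhp_def)
  have int: "integrable \<rho> (\<lambda>t. of_real (1 + t\<^sup>2) / (of_real t - z))"
    by (rule cauchy_sigma_bound(1)[OF pos uhp_gap[OF pos]])
  have im: "Im (of_real a * w) = a * Im w" for a w by simp
  have "0 \<le> Im (of_real (1 + t\<^sup>2) / (of_real t - z))" for t
  proof -
    have "Im (of_real (1 + t\<^sup>2) / (of_real t - z)) = (1 + t\<^sup>2) * Im (1 / (of_real t - z))"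
      using im[of "1 + t\<^sup>2" "1 / (of_real t - z)"] by (simp only: times_divide_eq_right mult_1_right)
    then show ?thesis using pos unfolding Im_cauchy_kernel by simp
  qed
  then have "0 \<le> (LINT t|\<rho>. Im (of_real (1 + t\<^sup>2) / (of_real t - z)))"
    by (intro integral_nonneg_AE) auto
  also have "\<dots> = Im (cauchy_sigma z)"
    unfolding cauchy_sigma_def using int by (rule integral_Im)
  finally show "Im z \<le> Im (Phi \<rho> \<alpha> z)"
    using z uhp_off_support by (subst Phi_eq_cauchy_sigma) auto
next
  fix y :: real assume y: "0 < y"
  show "\<exists>K. \<forall>z. y \<le> Im z \<longrightarrow> cmod (Phi \<rho> \<alpha> z - z) \<le> K"
  proof (intro exI allI impI)
    fix z assume z: "y \<le> Im z"
    then have "0 < Im z" using y by simp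
    then have "z \<in> off_support" using uhp_off_support by (auto simp: uhp_def)
    then have "Phi \<rho> \<alpha> z - z = of_real (\<alpha> - (LINT t|\<rho>. t)) + cauchy_sigma z"
      by (simp add: Phi_eq_cauchy_sigma)
    also have "cmod \<dots> \<le> \<bar>\<alpha> - (LINT t|\<rho>. t)\<bar> + sigma_mass / y"
      using cauchy_sigma_bound(2)[OF y, of z] uhp_gap[OF \<open>0 < Im z\<close>] z
      by (intro order_trans[OF norm_triangle_ineq] add_mono) (auto intro: order_trans simp del: of_real_diff)
    finally show "cmod (Phi \<rho> \<alpha> z - z) \<le> \<bar>\<alpha> - (LINT t|\<rho>. t)\<bar> + sigma_mass / y" .
  qed
qed

lemma Phi_real:
  assumes "x \<notin> {c..d}"
  shows "Phi \<rho> \<alpha> (of_real x) = of_real (Re (Phi \<rho> \<alpha> (of_real x)))"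
proof -
  have "(1 + of_real t * of_real x) / (of_real t - of_real x) = complex_of_real ((1 + t * x) / (t - x))" for t
    by simp
  then have "Phi \<rho> \<alpha> (of_real x) = of_real (\<alpha> + x + (LINT t|\<rho>. (1 + t * x) / (t - x)))"
    unfolding Phi_def by (simp only: integral_complex_of_real of_real_add)
  then show ?thesis by simp
qed

lemma Phi_measurable: "(\<lambda>x. Re (Phi \<rho> \<alpha> (of_real x))) \<in> borel_measurable borel"
  unfolding Phi_def by measurable

lemma Phi_real_has_derivative:
  assumes "x \<notin> {c..d}"
  shows "((\<lambda>x. Re (Phi \<rho> \<alpha> (of_real x))) has_real_derivative 1 + Re (cauchy_sigma_deriv (of_real x))) (at x)"
proof -
  have "((\<lambda>x. Phi \<rho> \<alpha> (of_real x)) has_vector_derivative 1 + cauchy_sigma_deriv (of_real x)) (at x)"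
    using assms by (intro has_vector_derivative_real_field Phi_has_derivative) (simp add: of_real_off_support)
  from has_field_derivative_Re[OF this] show ?thesis by simp
qed

text \<open>The upper bound combines the gap to the support with the decay at infinity: for \<open>\<bar>t\<bar> \<le> R\<close> one has
\<open>1 + x\<^sup>2 \<le> 2 (t - x)\<^sup>2 + (1 + 2 R\<^sup>2)\<close>, and \<open>(t - x)\<^sup>2 / \<delta>\<^sup>2 \<ge> 1\<close> absorbs the constant.\<close>

lemma cauchy_sigma_deriv_real:
  assumes "0 < \<delta>" and gap: "\<And>t. t \<in> {c..d} \<Longrightarrow> \<delta> \<le> \<bar>t - x\<bar>"
    and R: "\<And>t. t \<in> {c..d} \<Longrightarrow> \<bar>t\<bar> \<le> R"
  shows "0 \<le> Re (cauchy_sigma_deriv (of_real x))"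
    and "Re (cauchy_sigma_deriv (of_real x)) \<le> sigma_mass * (2 + (1 + 2 * R\<^sup>2) / \<delta>\<^sup>2) / (1 + x\<^sup>2)"
proof -
  let ?K = "2 + (1 + 2 * R\<^sup>2) / \<delta>\<^sup>2"
  have eq: "of_real (1 + t\<^sup>2) * inverse ((of_real t - of_real x)\<^sup>2) = complex_of_real ((1 + t\<^sup>2) * inverse ((t - x)\<^sup>2))" for t
    by simp
  have "cauchy_sigma_deriv (of_real x) = of_real (LINT t|\<rho>. (1 + t\<^sup>2) * inverse ((t - x)\<^sup>2))"
    unfolding cauchy_sigma_deriv_def eq by (rule integral_complex_of_real)
  moreover have "0 \<le> (LINT t|\<rho>. (1 + t\<^sup>2) * inverse ((t - x)\<^sup>2))"
    by (intro integral_nonneg_AE) (auto intro!: mult_nonneg_nonneg add_nonneg_nonneg)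
  ultimately show "0 \<le> Re (cauchy_sigma_deriv (of_real x))" by simp
  have "cmod (cauchy_sigma_deriv (of_real x)) \<le> sigma_mass * (?K / (1 + x\<^sup>2))"
    unfolding cauchy_sigma_deriv_def
  proof (rule integral_sigma_le(2))
    fix t assume t: "t \<in> {c..d}"
    have d2: "\<delta>\<^sup>2 \<le> (t - x)\<^sup>2"
      using gap[OF t] \<open>0 < \<delta>\<close> by (metis abs_le_square_iff abs_of_pos)
    have "\<bar>t\<bar>\<^sup>2 \<le> R\<^sup>2" using R[OF t] by (intro power_mono) auto
    moreover have "x\<^sup>2 \<le> 2 * t\<^sup>2 + 2 * (t - x)\<^sup>2"
      using zero_le_power2[of "2 * t - x"] by (simp add: power2_eq_square algebra_simps)
    ultimately have "1 + x\<^sup>2 \<le> 2 * (t - x)\<^sup>2 + (1 + 2 * R\<^sup>2) * 1" by simp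
    also have "\<dots> \<le> 2 * (t - x)\<^sup>2 + (1 + 2 * R\<^sup>2) * ((t - x)\<^sup>2 / \<delta>\<^sup>2)"
      using d2 \<open>0 < \<delta>\<close> by (intro add_left_mono mult_left_mono) auto
    also have "\<dots> = ?K * (t - x)\<^sup>2" by (simp add: algebra_simps)
    finally have *: "1 + x\<^sup>2 \<le> ?K * (t - x)\<^sup>2" .
    have pos: "0 < (t - x)\<^sup>2" using d2 \<open>0 < \<delta>\<close> by (meson less_le_trans zero_less_power)
    have "inverse ((t - x)\<^sup>2) \<le> ?K / (1 + x\<^sup>2)"
      using * pos by (simp add: field_simps add_pos_nonneg)
    moreover have "cmod (inverse ((of_real t - of_real x)\<^sup>2)) = inverse ((t - x)\<^sup>2)"
      by (simp add: norm_inverse norm_power flip: of_real_diff)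
    ultimately show "cmod (inverse ((of_real t - of_real x)\<^sup>2)) \<le> ?K / (1 + x\<^sup>2)" by simp
  qed measurable
  then show "Re (cauchy_sigma_deriv (of_real x)) \<le> sigma_mass * ?K / (1 + x\<^sup>2)"
    using complex_Re_le_cmod[of "cauchy_sigma_deriv (of_real x)"] by simp
qed

end

section \<open>The lower bound for the powers of the composition operator\<close>

context compactly_supported
begin

lemma Phi_iterate_real:
  fixes \<alpha> :: real
  defines "\<phi> \<equiv> \<lambda>x. Re (Phi \<rho> \<alpha> (of_real x))"
  assumes "\<And>k. k < n \<Longrightarrow> (\<phi> ^^ k) x \<notin> {c..d}"
  shows "(Phi \<rho> \<alpha> ^^ n) (of_real x) = of_real ((\<phi> ^^ n) x)"
    and "isCont (Phi \<rho> \<alpha> ^^ n) (of_real x)"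
  using assms(2)
proof (induction n)
  case 0
  {
    case 1
    then show ?case by simp
  next
    case 2
    then show ?case by (simp add: id_def)
  }
next
  case (Suc n)
  have val: "(Phi \<rho> \<alpha> ^^ n) (of_real x) = of_real ((\<phi> ^^ n) x)"
    and cont: "isCont (Phi \<rho> \<alpha> ^^ n) (of_real x)"
    if "\<And>k. k < Suc n \<Longrightarrow> (\<phi> ^^ k) x \<notin> {c..d}"
    using Suc.IH that by auto
  {
    case 1
    have "Phi \<rho> \<alpha> (of_real ((\<phi> ^^ n) x)) = of_real (\<phi> ((\<phi> ^^ n) x))"
      unfolding \<phi>_def by (rule Phi_real) (use 1[of n] in \<open>simp add: \<phi>_def\<close>)
    moreover have "(Phi \<rho> \<alpha> ^^ n) (of_real x) = of_real ((\<phi> ^^ n) x)"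
      by (rule val) (rule 1)
    ultimately show ?case by simp
  next
    case 2
    have "of_real ((\<phi> ^^ n) x) \<in> off_support"
      using 2[of n] by (simp add: of_real_off_support)
    moreover have "(Phi \<rho> \<alpha> ^^ n) (of_real x) = of_real ((\<phi> ^^ n) x)"
      by (rule val) (rule 2)
    ultimately have "isCont (Phi \<rho> \<alpha>) ((Phi \<rho> \<alpha> ^^ n) (of_real x))"
      using DERIV_isCont[OF Phi_has_derivative] by simp
    moreover have "isCont (Phi \<rho> \<alpha> ^^ n) (of_real x)"
      by (rule cont) (rule 2)
    ultimately show ?case
      using isCont_o2 by (simp add: o_def)
  }
qed

text \<open>At points of \<open>A\<close> the iterate of \<open>\<Phi>\<close> extends continuously to the real line with real values, so the
integrals over the lines \<open>Im z = 1 / (k + 1)\<close> dominate the boundary integral by Fatou's lemma.\<close>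

lemma boundary_integral_le_hardy_sq:
  fixes \<alpha> :: real
  defines "\<phi> \<equiv> \<lambda>x. Re (Phi \<rho> \<alpha> (of_real x))"
  assumes u: "u holomorphic_on uhp" and e: "0 < e"
    and A: "\<And>x k. x \<in> A \<Longrightarrow> k < n \<Longrightarrow> (\<phi> ^^ k) x \<notin> {c..d}"
  shows "(\<integral>\<^sup>+x. ennreal (indicator A x * (cmod (u (Complex ((\<phi> ^^ n) x) e)))\<^sup>2) \<partial>lborel)
           \<le> hardy_sq (\<lambda>z. u ((Phi \<rho> \<alpha> ^^ n) z + \<i> * of_real e))"
proof -
  let ?P = "Phi \<rho> \<alpha> ^^ n"
  define v where "v z = u (z + \<i> * of_real e)" for z
  define y where "y k = 1 / real (Suc k)" for k
  have y: "0 < y k" for k by (simp add: y_def)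
  have ylim: "y \<longlonglongrightarrow> 0"
    unfolding y_def using LIMSEQ_inverse_real_of_nat by (simp add: inverse_eq_divide)
  have holv: "v holomorphic_on {z. - e < Im z}"
    unfolding v_def using holomorphic_on_shift_up[OF u] e by simp
  then have "v holomorphic_on uhp"
    by (rule holomorphic_on_subset) (use e in \<open>auto simp: uhp_def\<close>)
  then have hol: "(\<lambda>z. v (?P z)) holomorphic_on uhp"
    by (rule holomorphic_on_bounded_displacement[OF bounded_displacement_iterate[OF bounded_displacement_Phi]])
  have lim: "(\<lambda>k. v (?P (Complex x (y k)))) \<longlonglongrightarrow> u (Complex ((\<phi> ^^ n) x) e)" if x: "x \<in> A" for x
  proof -
    have P: "?P (of_real x) = of_real ((\<phi> ^^ n) x)" "isCont ?P (of_real x)"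
      using Phi_iterate_real[of n \<alpha> x] A[OF x] unfolding \<phi>_def by blast+
    have "(\<lambda>k. of_real x + \<i> * of_real (y k)) \<longlonglongrightarrow> of_real x + \<i> * of_real 0"
      by (intro tendsto_intros ylim)
    then have "(\<lambda>k. Complex x (y k)) \<longlonglongrightarrow> of_real x" by (simp add: Complex_eq)
    then have "(\<lambda>k. ?P (Complex x (y k))) \<longlonglongrightarrow> of_real ((\<phi> ^^ n) x)"
      using isCont_tendsto_compose[OF P(2)] P(1) by simp
    moreover have "isCont v (of_real ((\<phi> ^^ n) x))"
      using holomorphic_on_imp_continuous_on[OF holv] open_halfspace_Im_gt[of "- e"] e
      by (simp add: continuous_on_eq_continuous_at)
    ultimately have "(\<lambda>k. v (?P (Complex x (y k)))) \<longlonglongrightarrow> v (of_real ((\<phi> ^^ n) x))"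
      using isCont_tendsto_compose by blast
    then show ?thesis by (simp add: v_def Complex_eq)
  qed
  have "(\<integral>\<^sup>+x. ennreal (indicator A x * (cmod (u (Complex ((\<phi> ^^ n) x) e)))\<^sup>2) \<partial>lborel)
      \<le> (\<integral>\<^sup>+x. liminf (\<lambda>k. ennreal ((cmod (v (?P (Complex x (y k)))))\<^sup>2)) \<partial>lborel)"
  proof (intro nn_integral_mono)
    fix x
    show "ennreal (indicator A x * (cmod (u (Complex ((\<phi> ^^ n) x) e)))\<^sup>2)
        \<le> liminf (\<lambda>k. ennreal ((cmod (v (?P (Complex x (y k)))))\<^sup>2))"
    proof (cases "x \<in> A")
      case True
      then have "(\<lambda>k. ennreal ((cmod (v (?P (Complex x (y k)))))\<^sup>2)) \<longlonglongrightarrow> ennreal ((cmod (u (Complex ((\<phi> ^^ n) x) e)))\<^sup>2)"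
        by (intro tendsto_ennrealI tendsto_power tendsto_norm lim)
      from lim_imp_Liminf[OF sequentially_bot this] show ?thesis using True by simp
    qed simp
  qed
  also have "\<dots> \<le> liminf (\<lambda>k. line_sq (\<lambda>z. v (?P z)) (y k))"
    unfolding line_sq_def by (intro nn_integral_liminf line_sq_measurable[OF hol y])
  also have "\<dots> \<le> liminf (\<lambda>k::nat. hardy_sq (\<lambda>z. v (?P z)))"
    by (intro Liminf_mono always_eventually allI line_sq_le_hardy_sq y)
  finally show ?thesis by (simp add: Liminf_const v_def)
qed

text \<open>The bound on \<open>\<bar>\<alpha>\<bar>\<close> makes \<open>\<phi>\<close> move every point of the two half-lines by at least one in the direction of
\<open>\<alpha>\<close>. Then \<open>\<phi>' \<le> 1 + \<kappa> / (1 + x\<^sup>2) \<le> exp (3 \<kappa> sgn \<alpha> (arctan \<phi>(x) - arctan x))\<close> by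
\<open>arctan_step\<close>, so the weight \<open>w\<close> satisfies the hypotheses of the transfer inequality.\<close>

lemma similar_to_isometry_Phi:
  fixes \<alpha> :: real
  defines "\<phi> \<equiv> \<lambda>x. Re (Phi \<rho> \<alpha> (of_real x))"
  assumes a: "a < c" and cd: "c \<le> d" and b: "d < b" and overlap: "\<phi> b \<le> \<phi> a"
    and big: "\<bar>LINT t|\<rho>. t\<bar> + sigma_mass / min (c - a) (b - d) + 1 \<le> \<bar>\<alpha>\<bar>"
  shows "similar_to_isometry hardy_space (composition_operator (Phi \<rho> \<alpha>))"
proof -
  \<comment> \<open>\<open>\<epsilon>\<close> is the gap between the two half-lines and the support, \<open>\<mu>\<close> the shift between \<open>\<alpha>\<close> and the translation part.\<close>
  define \<epsilon> where "\<epsilon> = min (c - a) (b - d)"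
  define R where "R = max \<bar>c\<bar> \<bar>d\<bar>"
  define \<mu> where "\<mu> = (LINT t|\<rho>. t)"
  define \<kappa> where "\<kappa> = sigma_mass * (2 + (1 + 2 * R\<^sup>2) / \<epsilon>\<^sup>2)"
  define \<phi>' where "\<phi>' x = 1 + Re (cauchy_sigma_deriv (of_real x))" for x
  \<comment> \<open>The weight has to decrease in the direction in which \<open>\<phi>\<close> moves points.\<close>
  define s where "s = sgn \<alpha>"
  define w where "w x = exp (- (3 * \<kappa> * s * arctan x))" for x
  have \<epsilon>: "0 < \<epsilon>" using a b by (simp add: \<epsilon>_def)
  have \<kappa>: "0 \<le> \<kappa>"
    unfolding \<kappa>_def using sigma_mass_nonneg by (intro mult_nonneg_nonneg add_nonneg_nonneg) auto
  have gap: "\<epsilon> \<le> \<bar>t - x\<bar>" if "x \<le> a \<or> b \<le> x" "t \<in> {c..d}" for x t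
    using that by (auto simp: \<epsilon>_def)
  have out: "x \<notin> {c..d}" if "x \<le> a \<or> b \<le> x" for x
    using that a b by auto
  have R: "\<bar>t\<bar> \<le> R" if "t \<in> {c..d}" for t
    using that by (auto simp: R_def)
  have move: "\<bar>\<phi> x - x - (\<alpha> - \<mu>)\<bar> \<le> sigma_mass / \<epsilon>" if x: "x \<le> a \<or> b \<le> x" for x
  proof -
    have "\<phi> x - x - (\<alpha> - \<mu>) = Re (cauchy_sigma (of_real x))"
      unfolding \<phi>_def \<mu>_def using out[OF x] by (subst Phi_eq_cauchy_sigma) (auto simp: of_real_off_support)
    moreover have "cmod (cauchy_sigma (of_real x)) \<le> sigma_mass / \<epsilon>"
    proof (rule cauchy_sigma_bound(2)[OF \<epsilon>])
      show "\<epsilon> \<le> cmod (of_real t - of_real x)" if "t \<in> {c..d}" for t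
        using gap[OF x that] by (simp flip: of_real_diff)
    qed
    ultimately show ?thesis using abs_Re_le_cmod[of "cauchy_sigma (of_real x)"] by linarith
  qed
  have bigS: "\<bar>\<mu>\<bar> + sigma_mass / \<epsilon> + 1 \<le> \<bar>\<alpha>\<bar>" using big by (simp add: \<epsilon>_def \<mu>_def)
  have S\<epsilon>: "0 \<le> sigma_mass / \<epsilon>" using sigma_mass_nonneg \<epsilon> by simp
  have s: "\<bar>s\<bar> = 1" using bigS S\<epsilon> by (auto simp: s_def abs_sgn_eq)
  have gain: "1 / (1 + x\<^sup>2) \<le> 3 * (s * (arctan (\<phi> x) - arctan x))" if x: "x \<le> a \<or> b \<le> x" for x
  proof -
    have "3 * (1 / (3 * k)) = 1 / k" for k :: real by simp
    note third = this[of "1 + x\<^sup>2", symmetric]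
    have "1 / (3 * (1 + x\<^sup>2)) \<le> s * (arctan (\<phi> x) - arctan x)"
    proof (cases "0 < \<alpha>")
      case True
      then have "1 \<le> \<phi> x - x" using move[OF x] bigS by linarith
      from arctan_step(1)[OF this] show ?thesis using True by (simp add: s_def)
    next
      case False
      then have "\<alpha> < 0" using bigS S\<epsilon> by linarith
      then have "1 \<le> x - \<phi> x" using move[OF x] bigS by linarith
      from arctan_step(2)[OF this] show ?thesis using \<open>\<alpha> < 0\<close> by (simp add: s_def)
    qed
    then show ?thesis unfolding third by (intro mult_left_mono) auto
  qed
  interpret two_branch_map a b "\<bar>\<alpha> - \<mu>\<bar> + sigma_mass / \<epsilon>" \<phi> \<phi>' w
  proof
    show "a < b" using a cd b by simp
    show "\<phi> \<in> borel_measurable borel" unfolding \<phi>_def by (rule Phi_measurable)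
    show "(\<phi> has_real_derivative \<phi>' x) (at x)" if "x \<le> a \<or> b \<le> x" for x
      unfolding \<phi>_def \<phi>'_def by (rule Phi_real_has_derivative[OF out[OF that]])
    show "continuous_on ({..a} \<union> {b..}) \<phi>'"
      unfolding \<phi>'_def
      by (intro continuous_intros continuous_on_compose2[OF continuous_on_cauchy_sigma_deriv])
        (use out in \<open>auto simp: of_real_off_support\<close>)
    note d = cauchy_sigma_deriv_real[OF \<epsilon> gap R]
    show "0 \<le> \<phi>' x" if "x \<le> a \<or> b \<le> x" for x
      unfolding \<phi>'_def using d(1)[OF that] by simp
    show "\<bar>\<phi> x - x\<bar> \<le> \<bar>\<alpha> - \<mu>\<bar> + sigma_mass / \<epsilon>" if "x \<le> a \<or> b \<le> x" for x
      using move[OF that] by linarith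
    show "\<phi> b \<le> \<phi> a" by (rule overlap)
    show "w \<in> borel_measurable borel" unfolding w_def by measurable
    show "0 \<le> w x" for x by (simp add: w_def)
    show "w (\<phi> x) * \<phi>' x \<le> w x" if x: "x \<le> a \<or> b \<le> x" for x
    proof -
      have "\<phi>' x \<le> 1 + \<kappa> / (1 + x\<^sup>2)"
        unfolding \<phi>'_def \<kappa>_def using d(2)[OF x] by simp
      also have "\<dots> \<le> exp (\<kappa> / (1 + x\<^sup>2))" by (rule exp_ge_add_one_self)
      also have "\<dots> \<le> exp (3 * \<kappa> * s * arctan (\<phi> x) - 3 * \<kappa> * s * arctan x)"
        using mult_left_mono[OF gain[OF x] \<kappa>] by (simp add: algebra_simps)
      finally have "w (\<phi> x) * \<phi>' x \<le> w (\<phi> x) * exp (3 * \<kappa> * s * arctan (\<phi> x) - 3 * \<kappa> * s * arctan x)"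
        by (intro mult_left_mono) (simp_all add: w_def)
      also have "\<dots> = w x" unfolding w_def by (simp flip: exp_add)
      finally show ?thesis .
    qed
  qed
  have wexp: "\<bar>3 * \<kappa> * s * arctan x\<bar> \<le> 3 * \<kappa> * (pi / 2)" for x
  proof -
    have "\<bar>arctan x\<bar> \<le> pi / 2" using arctan_lbound[of x] arctan_ubound[of x] by linarith
    then have "3 * \<kappa> * \<bar>arctan x\<bar> \<le> 3 * \<kappa> * (pi / 2)"
      using \<kappa> by (intro mult_left_mono) auto
    moreover have "\<bar>3 * \<kappa> * s * arctan x\<bar> = 3 * \<kappa> * \<bar>arctan x\<bar>"
      using \<kappa> s by (simp add: abs_mult)
    ultimately show ?thesis by simp
  qed
  define m M where "m = exp (- (3 * \<kappa> * (pi / 2)))" and "M = exp (3 * \<kappa> * (pi / 2))"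
  have m: "0 < m" "m \<le> w x" "w x \<le> M" for x
    using abs_le_D1[OF wexp[of x]] abs_le_D2[OF wexp[of x]]
    unfolding m_def M_def w_def exp_le_cancel_iff by (simp_all only: exp_gt_zero neg_le_iff_le minus_le_iff)
  show ?thesis
  proof (rule similar_to_isometry_composition[OF bounded_displacement_Phi])
    show "0 \<le> M / m" by (simp add: M_def m_def)
    fix u e n
    assume u: "u holomorphic_on uhp" and fin: "hardy_sq u < \<infinity>" and e: "0 < (e::real)"
    have stay: "(\<phi> ^^ k) x \<notin> {c..d}" if "x \<in> staying n" "k < n" for x k
      using that by (intro out) (auto simp: staying_def branches_def)
    let ?F = "\<lambda>y. (cmod (u (Complex y e)))\<^sup>2"
    have "continuous_on UNIV ?F"
      using e by (intro continuous_intros continuous_on_uhp_Complex u) auto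
    then have F: "?F \<in> borel_measurable borel" by (rule borel_measurable_continuous_onI)
    have "hardy_sq (\<lambda>z. u (z + \<i> * of_real e)) \<le> line_sq u e"
      unfolding hardy_sq_def[of "\<lambda>z. u (z + \<i> * of_real e)"]
      by (intro SUP_least line_integral_composition_le[OF u fin bounded_displacement_id _ e]) simp
    also have "\<dots> \<le> ennreal (M / m) * (\<integral>\<^sup>+x. ennreal (indicator (staying n) x * ?F ((\<phi> ^^ n) x)) \<partial>lborel)"
      unfolding line_sq_def by (rule transfer_iterate_unweighted[OF F _ m]) simp
    also have "\<dots> \<le> ennreal (M / m) * hardy_sq (\<lambda>z. u ((Phi \<rho> \<alpha> ^^ n) z + \<i> * of_real e))"
    proof (rule mult_left_mono)
      show "(\<integral>\<^sup>+x. ennreal (indicator (staying n) x * ?F ((\<phi> ^^ n) x)) \<partial>lborel)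
          \<le> hardy_sq (\<lambda>z. u ((Phi \<rho> \<alpha> ^^ n) z + \<i> * of_real e))"
        unfolding \<phi>_def by (rule boundary_integral_le_hardy_sq[OF u e stay[unfolded \<phi>_def]])
    qed simp
    finally show "hardy_sq (\<lambda>z. u (z + \<i> * of_real e)) \<le> ennreal (M / m) * hardy_sq (\<lambda>z. u ((Phi \<rho> \<alpha> ^^ n) z + \<i> * of_real e))" .
  qed
qed

end

text \<open>A real number strictly between the two limits separates \<open>\<Phi>\<close> at some \<open>a < c\<close> from \<open>\<Phi>\<close> at some
\<open>b > d\<close>. Changing \<open>\<beta>\<close> to \<open>\<alpha>\<close> adds the same constant to both values, so \<open>a\<close> and \<open>b\<close>, and with
them \<open>\<alpha>\<^sub>0\<close>, serve for all \<open>\<alpha>\<close>.\<close>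

theorem theorem4p1:
  fixes c d :: real and \<rho> :: "real measure"
    and \<beta> :: real and Lc Ld :: ereal
  assumes "c \<le> d"
    and "finite_measure \<rho>" and "sets \<rho> = sets borel"
    and "emeasure \<rho> (UNIV - {c..d}) = 0"
    and "((\<lambda>x. ereal (Re (Phi \<rho> \<beta> (of_real x)))) \<longlongrightarrow> Lc) (at_left c)"
    and "((\<lambda>x. ereal (Re (Phi \<rho> \<beta> (of_real x)))) \<longlongrightarrow> Ld) (at_right d)"
    and "Lc > Ld"
  shows "\<exists>\<alpha>\<^sub>0>0. \<forall>\<alpha>::real. \<bar>\<alpha>\<bar> \<ge> \<alpha>\<^sub>0 \<longrightarrow>
           similar_to_isometry hardy_space (composition_operator (Phi \<rho> \<alpha>))"
proof -
  interpret finite_measure \<rho> by fact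
  have "UNIV - {c..d} \<in> null_sets \<rho>"
    using assms(3,4) by (intro null_setsI) auto
  then have "AE t in \<rho>. t \<notin> UNIV - {c..d}" by (rule AE_not_in)
  then have supp: "AE t in \<rho>. t \<in> {c..d}" by eventually_elim simp
  interpret compactly_supported \<rho> c d
    by unfold_locales (use assms(3) supp in auto)
  obtain m :: real where m: "Ld < ereal m" "ereal m < Lc"
    using ereal_dense2[OF assms(7)] by blast
  have "\<forall>\<^sub>F x in at_left c. x < c" "\<forall>\<^sub>F x in at_right d. d < x"
    by (auto simp: eventually_at_filter)
  with order_tendstoD(1)[OF assms(5) m(2)] order_tendstoD(2)[OF assms(6) m(1)]
  have "\<forall>\<^sub>F x in at_left c. m < Re (Phi \<rho> \<beta> (of_real x)) \<and> x < c"
    "\<forall>\<^sub>F x in at_right d. Re (Phi \<rho> \<beta> (of_real x)) < m \<and> d < x"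
    by (auto intro: eventually_conj)
  from eventually_happens'[OF trivial_limit_at_left_real this(1)]
    eventually_happens'[OF trivial_limit_at_right_real this(2)]
  obtain a b where a: "m < Re (Phi \<rho> \<beta> (of_real a))" "a < c"
    and b: "Re (Phi \<rho> \<beta> (of_real b)) < m" "d < b"
    by blast
  define \<alpha>\<^sub>0 where "\<alpha>\<^sub>0 = \<bar>LINT t|\<rho>. t\<bar> + sigma_mass / min (c - a) (b - d) + 1"
  have "0 \<le> sigma_mass / min (c - a) (b - d)"
    using sigma_mass_nonneg a b by (intro divide_nonneg_nonneg) auto
  then have "0 < \<alpha>\<^sub>0" by (simp add: \<alpha>\<^sub>0_def)
  moreover have "similar_to_isometry hardy_space (composition_operator (Phi \<rho> \<alpha>))" if "\<alpha>\<^sub>0 \<le> \<bar>\<alpha>\<bar>" for \<alpha>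
  proof (rule similar_to_isometry_Phi[OF a(2) assms(1) b(2)])
    have "Phi \<rho> \<alpha> z = Phi \<rho> \<beta> z + of_real (\<alpha> - \<beta>)" for z by (simp add: Phi_def)
    then show "Re (Phi \<rho> \<alpha> (of_real b)) \<le> Re (Phi \<rho> \<alpha> (of_real a))"
      using a(1) b(1) by simp
  qed (use that in \<open>simp add: \<alpha>\<^sub>0_def\<close>)
  ultimately show ?thesis by blast
qed

end
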